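(* Let $n\ge1$. For any measurable function $\rho$ on $\mathbb{R}^n$ with $0\le\rho\le 1$ and $0\notin\operatorname{supp}\rho$ (such that the two integrals on the right-hand side are finite), the inequality $$ \left|\int_{\mathbb{R}^n}\frac{x_1\rho(x)}{|x|^{n+1}}\,d_\omega x\right|\le \Phi_n\left(\sqrt{\int_{\mathbb{R}^n}\frac{\rho(x)}{|x|^{n-1}}\,d_\omega x\cdot\int_{\mathbb{R}^n}\frac{\rho(x)}{|x|^{n+1}}\,d_\omega x}\right) $$ holds, where $\Phi_n=\Phi_n(s)$, $s\ge0$, is the unique solution of the (singular) initial problem $$ \Phi_n''=\frac{\Phi_n'\,(\Phi_n'^2-1)}{(n-1)\Phi_n\Phi_n'+s}\quad (s>0),\qquad \Phi_n(0)=0,\quad \Phi_n'(0)=1, $$ subject to the asymptotic condition $$ \lim_{s\to\infty}\frac{\Phi_n(s)}{\ln s}=\frac{\Gamma(\frac{n+2}{2})}{\Gamma(\frac{n+1}{2})\,\Gamma(\frac32)} . $$ The inequality is sharp: for all $u,v>0$, the supremum of the left-hand side over all such $\rho$ with $\int\frac{\rho}{|x|^{n-1}}d_\omega x=u$ and $\int\frac{\rho}{|x|^{n+1}}d_\omega x=v$ equals $\Phi_n(\sqrt{uv})$.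
   Context: $d_\omega x=\frac{1}{\omega_n}dx$ is Lebesgue measure on $\mathbb{R}^n$ normalized by the volume $\omega_n=\pi^{n/2}/\Gamma(\frac n2+1)$ of the unit ball; $x_1$ is the first coordinate of $x$. Solutions of the initial problem are functions continuously differentiable on $[0,\infty)$ and twice differentiable on $(0,\infty)$. *)

theory Defs
  imports "HOL-Analysis.Analysis"
begin

definition lebesgue_ball_normalized :: "(real ^ 'n::finite) measure" where
  "lebesgue_ball_normalized =
     density lebesgue (\<lambda>_. ennreal (1 / unit_ball_vol (real CARD('n))))"

definition admissible :: "(real ^ 'n::finite \<Rightarrow> real) \<Rightarrow> bool" where
  "admissible \<rho> \<longleftrightarrow>
     \<rho> \<in> borel_measurable lebesgue \<and>
     (\<forall>x. 0 \<le> \<rho> x \<and> \<rho> x \<le> 1) \<and>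
     0 \<notin> closure {x. \<rho> x \<noteq> 0} \<and>
     integrable lebesgue_ball_normalized (\<lambda>x. \<rho> x / norm x ^ (CARD('n) - 1)) \<and>
     integrable lebesgue_ball_normalized (\<lambda>x. \<rho> x / norm x ^ (CARD('n) + 1))"

(* Only the values of Phi on [0,\<infinity>) matter; the derivative at 0 is one-sided.
   That the right-hand side of the equation is defined for s > 0 is part of being a
   solution, hence the explicit condition on the denominator (in HOL, x / 0 = 0). *)
definition solves_initial_problem :: "nat \<Rightarrow> (real \<Rightarrow> real) \<Rightarrow> bool" where
  "solves_initial_problem n \<Phi> \<longleftrightarrow>
     (\<exists>\<Phi>' \<Phi>''.
        (\<forall>s\<ge>0. (\<Phi> has_real_derivative \<Phi>' s) (at s within {0..})) \<and>
        continuous_on {0..} \<Phi>' \<and>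
        (\<forall>s>0. (\<Phi>' has_real_derivative \<Phi>'' s) (at s)) \<and>
        (\<forall>s>0. (real n - 1) * \<Phi> s * \<Phi>' s + s \<noteq> 0 \<and>
               \<Phi>'' s = \<Phi>' s * ((\<Phi>' s)\<^sup>2 - 1) / ((real n - 1) * \<Phi> s * \<Phi>' s + s)) \<and>
        \<Phi> 0 = 0 \<and> \<Phi>' 0 = 1)"

definition asymptotic_condition :: "nat \<Rightarrow> (real \<Rightarrow> real) \<Rightarrow> bool" where
  "asymptotic_condition n \<Phi> \<longleftrightarrow>
     ((\<lambda>s. \<Phi> s / ln s) \<longlongrightarrow>
        Gamma ((real n + 2) / 2) / (Gamma ((real n + 1) / 2) * Gamma (3 / 2))) at_top"

end

theory Submission
  imports Defs
begin

text \<open>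
  By the bang-bang principle the extremal densities are the indicators of the lenses
  \<open>{x. a |x|\<^sup>2 + b < x\<^sub>1}\<close>, which are balls not containing the origin. Up to scaling a lens depends only
  on \<open>p = 2 sqrt (a b)\<close>, and for \<open>a = b\<close> both integrals on the right-hand side have the same
  value \<open>U p\<close>, while the left-hand side equals \<open>W p\<close>; so \<open>\<Phi> (U p) = W p\<close>.

  Optimality of the lenses, \<open>W p - q U p \<le> W q - q U q\<close>, gives \<open>W' = p U'\<close> by an envelope argument, that is
  \<open>\<Phi>' (U p) = p\<close>. The differential equation for \<open>\<Phi>\<close> is then equivalent to
  \<open>p (1 - p\<^sup>2) U' = - (U + (n - 1) p W)\<close>, which follows from explicit integral formulas for
  \<open>U\<close> and \<open>W\<close>. These come from polar coordinates, where the distribution of the direction cosine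
  \<open>x\<^sub>1 / |x|\<close> is found by stretching cones perpendicularly to their axis.

  For uniqueness, the solutions with \<open>\<Phi>' < 1\<close> are the rescalings \<open>s \<mapsto> \<Phi> (l s) / l\<close>, and the asymptotic
  condition forces \<open>l = 1\<close>; the remaining ones satisfy \<open>\<Phi> s \<ge> s\<close>.
\<close>

section \<open>The profile of the lenses and the initial problem\<close>

text \<open>The square root of the product comes from Lagrange multipliers. For 0 < p < 1 the
  left-hand integral is at most W p - p U p + a u + b v for all positive a, b with 2 sqrt (a b) = p,
  where u and v are the integrals on the right. For a fixed product a b the sum a u + b v is least
  when a u = b v, with the value p sqrt (u v); choosing p so that U p = sqrt (u v) leaves W p.
  Differentiating the integral formula of W only brings in that of U, but differentiating the
  formula of U brings in a third integral. The envelope argument supplies U' instead, and this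
  closes the system. In dimension one the direction cosine takes only the values 1 and -1 almost
  everywhere and has no density. The angular computations therefore use tail integrals over {t > q},
  for which one formula covers every n \<ge> 1. The right-hand side of the differential equation is
  0 / 0 at s = 0, which is why the initial values leave a family of solutions.\<close>

text \<open>Exchanging the two points in \<open>le\<close> sandwiches the difference quotient
  between \<open>g x\<close> and \<open>g y\<close>, so continuity of \<open>g\<close> at
  \<open>x\<close> already yields the derivative of \<open>f\<close>. It is applied to q |-> -(W q -
  q U q) and to \<Phi>.\<close>

lemma has_real_derivative_envelope:
  fixes f g :: "real \<Rightarrow> real"
  assumes x: "x \<in> S" and cont: "continuous (at x within S) g"
    and le: "\<And>y z. y \<in> S \<Longrightarrow> z \<in> S \<Longrightarrow> f z - f y \<le> g y * (z - y)"
  shows "(f has_real_derivative g x) (at x within S)"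
proof -
  have "((\<lambda>y. (f y - f x) / (y - x) - g x) \<longlongrightarrow> 0) (at x within S)"
  proof (rule Lim_null_comparison)
    show "((\<lambda>y. \<bar>g y - g x\<bar>) \<longlongrightarrow> 0) (at x within S)"
      using cont unfolding continuous_within
      by (intro tendsto_rabs_zero) (simp add: LIM_zero_iff)
    show "\<forall>\<^sub>F y in at x within S. norm ((f y - f x) / (y - x) - g x) \<le> \<bar>g y - g x\<bar>"
      unfolding eventually_at_filter
    proof (intro always_eventually allI impI)
      fix y assume y: "y \<noteq> x" "y \<in> S"
      have "f y - f x \<le> g x * (y - x)" "f x - f y \<le> g y * (x - y)"
        using le x y by auto
      then show "norm ((f y - f x) / (y - x) - g x) \<le> \<bar>g y - g x\<bar>"
      proof (cases "x < y")
        case True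
        have "(f y - f x) / (y - x) \<le> g x"
          using \<open>f y - f x \<le> g x * (y - x)\<close> True by (simp add: divide_le_eq)
        moreover have "g y \<le> (f y - f x) / (y - x)"
          using \<open>f x - f y \<le> g y * (x - y)\<close> True by (simp add: le_divide_eq algebra_simps)
        ultimately show ?thesis by simp
      next
        case False
        then have "y < x" using y by simp
        have "g x \<le> (f y - f x) / (y - x)"
          using \<open>f y - f x \<le> g x * (y - x)\<close> \<open>y < x\<close> by (simp add: le_divide_eq)
        moreover have "(f y - f x) / (y - x) \<le> g y"
          using \<open>f x - f y \<le> g y * (x - y)\<close> \<open>y < x\<close> by (simp add: divide_le_eq algebra_simps)
        ultimately show ?thesis by simp
      qed
    qed
  qed
  then show ?thesis
    by (simp add: has_field_derivative_iff LIM_zero_iff)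
qed

text \<open>The integrating factor exp (- integral of a) turns f into a constant, so the sign at
  \<open>s0\<close> propagates in both directions. Continuity of the coefficient is asked on the
  open half-line only, because the equations in question are singular at 0.\<close>

lemma homogeneous_linear_ode_pos:
  fixes f a :: "real \<Rightarrow> real"
  assumes cont: "continuous_on {0<..} a"
    and f: "\<And>s. s > 0 \<Longrightarrow> (f has_real_derivative a s * f s) (at s)"
    and s0: "s0 > 0" "f s0 > 0" and s: "s > 0"
  shows "f s > 0"
proof -
  define l where "l = min s s0 / 2"
  define u where "u = max s s0 + 1"
  define h where "h x = f x * exp (- integral {l..x} a)" for x
  have lu: "0 < l" "l < s" "l < s0" "s < u" "s0 < u"
    using s0 s by (auto simp: l_def u_def min_def max_def)
  have "\<exists>k. \<forall>x\<in>{l..u}. h x = k"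
  proof (rule has_field_derivative_zero_constant)
    fix x assume x: "x \<in> {l..u}"
    have I: "((\<lambda>x. integral {l..x} a) has_real_derivative a x) (at x within {l..u})"
      using x lu by (intro integral_has_real_derivative continuous_on_subset[OF cont]) auto
    have F: "(f has_real_derivative a x * f x) (at x within {l..u})"
      by (rule has_field_derivative_at_within, rule f) (use x lu in auto)
    show "(h has_real_derivative 0) (at x within {l..u})"
      unfolding h_def
      by (rule DERIV_cong[OF DERIV_mult[OF F DERIV_chain2[OF DERIV_exp DERIV_minus[OF I]]]]) simp
  qed auto
  then obtain k where "\<forall>x\<in>{l..u}. h x = k" ..
  then have "h s = h s0" using lu by simp
  then have "f s * exp (- integral {l..s} a) > 0"
    using s0(2) by (simp add: h_def)
  then show ?thesis by (simp add: zero_less_mult_iff)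
qed

section \<open>The lens integrals as functions of the shape parameter p\<close>

text \<open>A level q in (p, 1) of the direction cosine is written as q = sqrt (p^2 + (1 - p^2)
  y^2). This absorbs the factor 1 / sqrt (q^2 - p^2) that comes from the chords of a lens and makes
  the interval independent of p, so that differentiation under the integral sign is
  possible.\<close>

definition ell :: "nat \<Rightarrow> nat \<Rightarrow> real \<Rightarrow> real" where
  "ell m n p = integral {0..1} (\<lambda>y. sqrt (1 - y\<^sup>2) ^ (n - 1) / sqrt (p\<^sup>2 + (1 - p\<^sup>2) * y\<^sup>2) ^ m)"

text \<open>This is 2 \<omega>_(n-1) / \<omega>_n, where \<omega>_k is the volume of the unit ball
  in dimension k.\<close>

definition growth_const :: "nat \<Rightarrow> real" where
  "growth_const n = Gamma ((real n + 2) / 2) / (Gamma ((real n + 1) / 2) * Gamma (3 / 2))"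

text \<open>For 0 < p < 1 the lens with a = b = p / 2 has the integral \<open>lens_W\<close> for the
  weight x_1 / |x|^(n+1), and \<open>lens_U\<close> for each of the weights 1 / |x|^(n-1) and 1 /
  |x|^(n+1); see \<open>lens_has_integrals\<close>. The formulas are posited here so that the
  one-dimensional theory can precede the geometry.\<close>

definition lens_W :: "nat \<Rightarrow> real \<Rightarrow> real" where
  "lens_W n p = growth_const n * sqrt (1 - p\<^sup>2) ^ n * ell 1 n p"

definition lens_U :: "nat \<Rightarrow> real \<Rightarrow> real" where
  "lens_U n p = growth_const n * p * sqrt (1 - p\<^sup>2) ^ n * ell 3 n p"

lemma growth_const_pos: "growth_const n > 0"
  unfolding growth_const_def by (intro divide_pos_pos mult_pos_pos Gamma_real_pos) auto

lemma lens_Q_pos: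
  fixes p y :: real
  assumes "0 < p" "p \<le> 1"
  shows "0 < p\<^sup>2 + (1 - p\<^sup>2) * y\<^sup>2"
  using assms by (intro add_pos_nonneg mult_nonneg_nonneg) (auto simp: power_le_one_iff)

lemma lens_Q_power_pos:
  fixes p y :: real
  assumes "0 < p" "p \<le> 1"
  shows "0 < sqrt (p\<^sup>2 + (1 - p\<^sup>2) * y\<^sup>2) ^ m"
  using lens_Q_pos[OF assms] by simp

text \<open>The exponent \<open>j\<close> serves two integrands at once: j = 0 is that of
  \<open>ell\<close>, and j = 1 that of its derivative in p. The domain stops short of p = 0, where
  the root in the denominator vanishes at y = 0.\<close>

lemma ell_integrand_continuous:
  "continuous_on ({0<..1} \<times> {0..1})
     (\<lambda>(p, y). sqrt (1 - y\<^sup>2) ^ k * (1 - y\<^sup>2) ^ j / sqrt (p\<^sup>2 + (1 - p\<^sup>2) * y\<^sup>2) ^ m)"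
  unfolding case_prod_unfold
  by (intro continuous_intros ballI less_imp_neq[THEN not_sym] lens_Q_power_pos) auto

lemma ell_integrable:
  assumes "0 < p" "p \<le> 1"
  shows "(\<lambda>y. sqrt (1 - y\<^sup>2) ^ k * (1 - y\<^sup>2) ^ j / sqrt (p\<^sup>2 + (1 - p\<^sup>2) * y\<^sup>2) ^ m)
           integrable_on {0..1}"
proof (rule integrable_continuous_interval)
  show "continuous_on {0..1} (\<lambda>y. sqrt (1 - y\<^sup>2) ^ k * (1 - y\<^sup>2) ^ j
          / sqrt (p\<^sup>2 + (1 - p\<^sup>2) * y\<^sup>2) ^ m)"
    by (intro continuous_intros ballI less_imp_neq[THEN not_sym] lens_Q_power_pos assms)
qed

lemma ell_continuous: "continuous_on {0<..1} (ell m n)"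
  unfolding ell_def[abs_def]
  using integral_continuous_on_param[OF ell_integrand_continuous[of "n - 1" 0 m,
      folded cbox_interval]]
  by (simp add: cbox_interval)

lemma ell_pos:
  assumes "0 < p" "p \<le> 1"
  shows "ell m n p > 0"
proof -
  let ?f = "\<lambda>y. sqrt (1 - y\<^sup>2) ^ (n - 1) / sqrt (p\<^sup>2 + (1 - p\<^sup>2) * y\<^sup>2) ^ m"
  have nn: "?f y \<ge> 0" if "y \<in> {0..1}" for y
    using that less_imp_le[OF lens_Q_power_pos[OF assms, of y m]]
    by (intro divide_nonneg_nonneg zero_le_power[of "sqrt (1 - y\<^sup>2)"] real_sqrt_ge_zero)
      (auto simp: power_le_one)
  have "ell m n p \<ge> 0"
    unfolding ell_def
    using ell_integrable[OF assms, of "n-1" 0 m] nn by (intro integral_nonneg) auto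
  moreover have "ell m n p \<noteq> 0"
  proof
    assume "ell m n p = 0"
    moreover have "continuous_on {0..1} ?f"
      by (intro continuous_intros ballI less_imp_neq[THEN not_sym] lens_Q_power_pos assms)
    ultimately have "\<forall>y\<in>{0..1}. ?f y = 0"
      using integral_eq_0_iff[of 0 1 ?f, OF _ _ nn] unfolding ell_def by (simp only: zero_less_one simp_thms)
    then have "?f 0 = 0" by (rule bspec) simp
    moreover have "?f 0 = 1 / p ^ m" using assms(1) by simp
    moreover have "1 / p ^ m > 0" using assms(1) by (intro divide_pos_pos zero_less_power) auto
    ultimately show False by (simp only: less_irrefl)
  qed
  ultimately show ?thesis by simp
qed

text \<open>Differentiation in p produces a factor 1 - y^2 and raises m by 2. With Q = p^2 + (1 -
  p^2) y^2, the identity (1 - p^2) (1 - y^2) = 1 - Q trades this factor for a difference of two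
  integrals of the same family.\<close>

lemma ell_deriv:
  assumes "0 < p" "p < 1"
  shows "(ell m n has_real_derivative - (real m * p * (ell (m + 2) n p - ell m n p) / (1 - p\<^sup>2))) (at p)"
proof -
  let ?w = "\<lambda>y::real. sqrt (1 - y\<^sup>2) ^ (n - 1)"
  let ?Q = "\<lambda>p y::real. p\<^sup>2 + (1 - p\<^sup>2) * y\<^sup>2"
  let ?f = "\<lambda>p y. ?w y / sqrt (?Q p y) ^ m"
  let ?f' = "\<lambda>p y. - (real m * p) * (?w y * (1 - y\<^sup>2) ^ 1 / sqrt (?Q p y) ^ (m + 2))"
  have "((\<lambda>p. integral (cbox 0 1) (?f p)) has_field_derivative integral (cbox 0 1) (?f' p))
          (at p within {0<..<1})"
  proof (rule leibniz_rule_field_derivative)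
    fix q y :: real assume q: "q \<in> {0<..<1}"
    then have Q: "?Q q y > 0" by (intro lens_Q_pos) auto
    have S: "sqrt (?Q q y) > 0" using Q by simp
    have *: "((\<lambda>q. sqrt (?Q q y)) has_real_derivative q * (1 - y\<^sup>2) / sqrt (?Q q y)) (at q within {0<..<1})"
      using Q by (auto intro!: derivative_eq_intros simp: field_simps)
    have "((\<lambda>S. ?w y * inverse (S ^ m)) has_real_derivative
             - (?w y * (real m * (sqrt (?Q q y) ^ (m - Suc 0)) / (sqrt (?Q q y) ^ m)\<^sup>2)))
           (at (sqrt (?Q q y)))"
      using S by (auto intro!: derivative_eq_intros simp: field_simps power2_eq_square)
    from DERIV_chain2[OF this *]
    have "((\<lambda>q. ?w y * inverse (sqrt (?Q q y) ^ m)) has_real_derivative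
        - (?w y * (real m * (sqrt (?Q q y) ^ (m - Suc 0)) / (sqrt (?Q q y) ^ m)\<^sup>2))
          * (q * (1 - y\<^sup>2) / sqrt (?Q q y))) (at q within {0<..<1})" .
    moreover have "- (?w y * (real m * (sqrt (?Q q y) ^ (m - Suc 0)) / (sqrt (?Q q y) ^ m)\<^sup>2))
          * (q * (1 - y\<^sup>2) / sqrt (?Q q y)) = ?f' q y"
    proof -
      have "- (w * (real m * (S ^ (m - Suc 0)) / (S ^ m)\<^sup>2)) * (q * z / S)
          = - (real m * q) * (w * z ^ 1 / S ^ (m + 2))" if "S > 0" for S w z :: real
        using that by (cases m) (simp_all add: field_simps power2_eq_square)
      from this[OF S] show ?thesis .
    qed
    ultimately show "((\<lambda>q. ?f q y) has_real_derivative ?f' q y) (at q within {0<..<1})"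
      unfolding divide_inverse[of "?w y"] by (simp only:)
  next
    fix q :: real assume "q \<in> {0<..<1}"
    then show "?f q integrable_on cbox 0 1"
      using ell_integrable[of q "n-1" 0 m] by (simp add: cbox_interval)
  next
    have "continuous_on ({0<..<1} \<times> cbox 0 1) (\<lambda>z. - (real m * fst z) *
        (case z of (p, y) \<Rightarrow> ?w y * (1 - y\<^sup>2) ^ 1 / sqrt (?Q p y) ^ (m + 2)))"
      by (intro continuous_intros continuous_on_subset[OF ell_integrand_continuous]) auto
    then show "continuous_on ({0<..<1} \<times> cbox 0 1) (\<lambda>(p, y). ?f' p y)"
      by (simp add: case_prod_unfold)
  qed (use assms in auto)
  then have D: "(ell m n has_real_derivative integral {0..1} (?f' p)) (at p)"
    using assms at_within_open[of p "{0<..<1::real}"] by (simp add: ell_def[abs_def] cbox_interval)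
  have eq: "?f' p y = - (real m * p / (1 - p\<^sup>2)) * (?w y / sqrt (?Q p y) ^ (m + 2) - ?w y / sqrt (?Q p y) ^ m)" for y
  proof -
    have Q: "?Q p y > 0" using assms by (intro lens_Q_pos) auto
    have "1 - p\<^sup>2 > 0" using assms by (simp add: power_less_one_iff)
    have "(1 - p\<^sup>2) * (1 - y\<^sup>2) = 1 - sqrt (?Q p y) ^ 2" using Q by (simp add: algebra_simps)
    then have 1: "(1 - y\<^sup>2) = (1 - sqrt (?Q p y) ^ 2) / (1 - p\<^sup>2)"
      using \<open>1 - p\<^sup>2 > 0\<close> by (simp add: field_simps)
    have alg: "- (real m * p) * (w * ((1 - S ^ 2) / k) ^ 1 / S ^ (m + 2))
      = - (real m * p / k) * (w / S ^ (m + 2) - w / S ^ m)" if "S > 0" "k > 0" for S k w :: real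
      using that by (simp add: field_simps power2_eq_square)
    show ?thesis
      unfolding 1 by (rule alg) (use Q \<open>1 - p\<^sup>2 > 0\<close> in auto)
  qed
  have i: "(\<lambda>y. ?w y / sqrt (?Q p y) ^ k) integrable_on {0..1}" for k
    using ell_integrable[of p "n-1" 0 k] assms by simp
  have "integral {0..1} (?f' p) = integral {0..1} (\<lambda>y. - (real m * p / (1 - p\<^sup>2))
          * (?w y / sqrt (?Q p y) ^ (m + 2) - ?w y / sqrt (?Q p y) ^ m))"
    by (rule integral_cong) (rule eq)
  also have "\<dots> = - (real m * p / (1 - p\<^sup>2)) * (ell (m + 2) n p - ell m n p)"
    unfolding integral_mult_right integral_diff[OF i i] ell_def by (rule refl)
  also have "\<dots> = - (real m * p * (ell (m + 2) n p - ell m n p) / (1 - p\<^sup>2))"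
    by (simp only: times_divide_eq_left mult_minus_left)
  finally show ?thesis using D by (simp only:)
qed

lemma lens_W_pos: "0 < p \<Longrightarrow> p < 1 \<Longrightarrow> lens_W n p > 0"
  unfolding lens_W_def
  by (intro mult_pos_pos growth_const_pos ell_pos zero_less_power) (auto simp: power_less_one_iff)

lemma lens_U_pos: "0 < p \<Longrightarrow> p < 1 \<Longrightarrow> lens_U n p > 0"
  unfolding lens_U_def
  by (intro mult_pos_pos growth_const_pos ell_pos zero_less_power) (auto simp: power_less_one_iff)

lemma lens_W_1: "n \<ge> 1 \<Longrightarrow> lens_W n 1 = 0"
  by (simp add: lens_W_def)

lemma lens_U_1: "n \<ge> 1 \<Longrightarrow> lens_U n 1 = 0"
  by (simp add: lens_U_def)

lemma lens_W_continuous: "continuous_on {0<..1} (lens_W n)"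
  unfolding lens_W_def[abs_def] by (intro continuous_intros ell_continuous)

lemma lens_U_continuous: "continuous_on {0<..1} (lens_U n)"
  unfolding lens_U_def[abs_def] by (intro continuous_intros ell_continuous)

text \<open>Only \<open>ell 1\<close> is differentiated, and its derivative involves just
  \<open>ell 1\<close> and \<open>ell 3\<close>, that is \<open>lens_W\<close> and
  \<open>lens_U\<close>. The same computation for \<open>lens_U\<close> would bring in
  \<open>ell 5\<close>; \<open>lens_U_deriv\<close> takes another way.\<close>

lemma lens_W_deriv:
  assumes n: "n \<ge> 1" and p: "0 < p" "p < 1"
  shows "(lens_W n has_real_derivative
           - (lens_U n p + (real n - 1) * p * lens_W n p) / (1 - p\<^sup>2)) (at p)"
proof -
  define S where "S = sqrt (1 - p\<^sup>2)"
  have "1 - p\<^sup>2 > 0" using p by (simp add: power_less_one_iff)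
  then have S: "S > 0" "1 - p\<^sup>2 = S\<^sup>2" by (auto simp: S_def)
  have D1: "((\<lambda>p. sqrt (1 - p\<^sup>2)) has_real_derivative (- p / S)) (at p)"
    unfolding S_def using \<open>1 - p\<^sup>2 > 0\<close> by (auto intro!: derivative_eq_intros simp: field_simps)
  have D: "(lens_W n has_real_derivative
      growth_const n * (real n * (S ^ (n - Suc 0) * (- p / S))) * ell 1 n p
      + - (real 1 * p * (ell (1 + 2) n p - ell 1 n p) / (1 - p\<^sup>2)) * (growth_const n * S ^ n)) (at p)"
    unfolding lens_W_def[abs_def] S_def
    using DERIV_mult[OF DERIV_cmult[OF DERIV_power[OF D1]] ell_deriv[OF p, of 1 n], of "growth_const n" n]
    by (simp only: S_def ac_simps)
  have alg: "c * (real n * (S ^ (n - Suc 0) * (- p / S))) * a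
      + - (real 1 * p * (b - a) / S\<^sup>2) * (c * S ^ n)
      = - (c * p * S ^ n * b + (real n - 1) * p * (c * S ^ n * a)) / S\<^sup>2" for a b c :: real
    using n S(1) by (cases n) (simp_all add: field_simps power2_eq_square)
  show ?thesis
    unfolding lens_U_def lens_W_def S_def[symmetric]
    using D unfolding lens_W_def S(2) alg by (simp add: numeral_3_eq_3)
qed

text \<open>With Q = p^2 + (1 - p^2) y^2, the kernel p^2 / Q^(3/2) has total mass 1 on [0, 1] and
  first moment p / (1 + p), so it concentrates at y = 0 as p tends to 0. The remaining factor of the
  integrand lies between 1 - (n - 1) y and 1.\<close>

lemma ell_3_bounds:
  assumes p: "0 < p" "p < 1"
  shows "p\<^sup>2 * ell 3 n p \<le> 1" and "1 - real (n - 1) * p \<le> p\<^sup>2 * ell 3 n p"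
proof -
  let ?Q = "\<lambda>y::real. p\<^sup>2 + (1 - p\<^sup>2) * y\<^sup>2"
  let ?j = "\<lambda>y::real. sqrt (1 - y\<^sup>2) ^ (n - 1)"
  have k: "1 - p\<^sup>2 > 0" using p by (simp add: power_less_one_iff)
  have Q: "?Q y > 0" for y using p by (intro lens_Q_pos) auto
  have dQ: "((\<lambda>y. sqrt (?Q y)) has_real_derivative (1 - p\<^sup>2) * y / sqrt (?Q y)) (at y within {0..1})" for y
    using Q[of y] by (auto intro!: derivative_eq_intros simp: field_simps)
  have I: "((\<lambda>y. p\<^sup>2 * (?j y / sqrt (?Q y) ^ 3)) has_integral p\<^sup>2 * ell 3 n p) {0..1}"
    unfolding ell_def
    using ell_integrable[of p "n-1" 0 3] p by (intro has_integral_mult_right integrable_integral) auto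
  have J: "((\<lambda>y. (1 - N * y) * (p\<^sup>2 / sqrt (?Q y) ^ 3)) has_integral (1 - N * (p / (1 + p)))) {0..1}" for N
  proof -
    have "((\<lambda>y. (1 - N * y) * (p\<^sup>2 / sqrt (?Q y) ^ 3)) has_integral
        (1 + N * p\<^sup>2 / (1 - p\<^sup>2)) / sqrt (?Q 1) - (0 + N * p\<^sup>2 / (1 - p\<^sup>2)) / sqrt (?Q 0)) {0..1}"
    proof (rule fundamental_theorem_of_calculus)
      fix y :: real assume "y \<in> {0..1}"
      have S: "sqrt (?Q y) > 0" "sqrt (?Q y) ^ 2 = ?Q y" using Q[of y] by auto
      have alg: "((1 + 0) * S - (y + N * p\<^sup>2 / k) * (k * y / S)) / (S * S) = (1 - N * y) * (p\<^sup>2 / S ^ 3)"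
        if "S > 0" "k > 0" "S\<^sup>2 = p\<^sup>2 + k * y\<^sup>2" for S k :: real
      proof -
        have "((1 + 0) * S - (y + N * p\<^sup>2 / k) * (k * y / S)) / (S * S)
            = (S\<^sup>2 - k * y\<^sup>2 - N * y * p\<^sup>2) / S ^ 3"
          using that(1,2) by (simp add: field_simps power2_eq_square power3_eq_cube)
        then show ?thesis by (simp add: that(3) algebra_simps)
      qed
      \<comment> \<open>The term y / sqrt Q is an antiderivative of the kernel; the term with N is
        one of - N y times the kernel, because Q has the derivative 2 (1 - p^2) y.\<close>
      have "((\<lambda>y. (y + N * p\<^sup>2 / (1 - p\<^sup>2)) / sqrt (?Q y)) has_real_derivative
           ((1 + 0) * sqrt (?Q y) - (y + N * p\<^sup>2 / (1 - p\<^sup>2)) * ((1 - p\<^sup>2) * y / sqrt (?Q y)))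
            / (sqrt (?Q y) * sqrt (?Q y))) (at y within {0..1})"
        using S(1) by (intro DERIV_divide DERIV_add dQ DERIV_ident DERIV_const) simp
      then show "((\<lambda>y. (y + N * p\<^sup>2 / (1 - p\<^sup>2)) / sqrt (?Q y)) has_vector_derivative
          (1 - N * y) * (p\<^sup>2 / sqrt (?Q y) ^ 3)) (at y within {0..1})"
        unfolding alg[OF S(1) k S(2)] has_real_derivative_iff_has_vector_derivative .
    qed simp
    moreover have "(1 + N * p\<^sup>2 / (1 - p\<^sup>2)) / sqrt (?Q 1) - (0 + N * p\<^sup>2 / (1 - p\<^sup>2)) / sqrt (?Q 0)
        = 1 - N * (p / (1 + p))"
    proof -
      have f: "1 - p\<^sup>2 = (1 - p) * (1 + p)" by (simp add: power2_eq_square algebra_simps)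
      have "(1 + N * p\<^sup>2 / (1 - p\<^sup>2)) / sqrt (?Q 1) - (0 + N * p\<^sup>2 / (1 - p\<^sup>2)) / sqrt (?Q 0)
        = 1 + N * p\<^sup>2 / (1 - p\<^sup>2) - N * p\<^sup>2 / (1 - p\<^sup>2) / p"
        using p(1) by simp
      also have "\<dots> = 1 - N * (p / (1 + p))"
        unfolding f using p by (simp add: divide_simps) (simp add: algebra_simps power2_eq_square)
      finally show ?thesis .
    qed
    ultimately show ?thesis by (simp only:)
  qed
  have j: "?j y \<le> 1" "1 - real (n - 1) * y \<le> ?j y" if "y \<in> {0..1}" for y
  proof -
    show "?j y \<le> 1" using that by (intro power_le_one) (auto simp: power_le_one)
    have "(1 - y)\<^sup>2 \<le> 1 - y\<^sup>2"
      using that by (auto simp: power2_eq_square algebra_simps mult_left_le)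
    then have "1 - y \<le> sqrt (1 - y\<^sup>2)" by (rule real_le_rsqrt)
    then have "(1 - y) ^ (n - 1) \<le> ?j y" using that by (intro power_mono) auto
    moreover have "1 + real (n - 1) * (- y) \<le> (1 + - y) ^ (n - 1)"
      using that by (intro Bernoulli_inequality) auto
    ultimately show "1 - real (n - 1) * y \<le> ?j y" by simp
  qed
  have P: "0 < p\<^sup>2 / sqrt (?Q y) ^ 3" for y
    using p Q[of y] by (intro divide_pos_pos zero_less_power) auto
  show "p\<^sup>2 * ell 3 n p \<le> 1"
  proof -
    have "p\<^sup>2 * (?j y / sqrt (?Q y) ^ 3) \<le> (1 - 0 * y) * (p\<^sup>2 / sqrt (?Q y) ^ 3)" if "y \<in> {0..1}" for y
      using mult_right_mono[OF j(1) less_imp_le[OF P], of y y] that by (simp add: field_simps)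
    then show ?thesis using has_integral_le[OF I J[of 0]] by simp
  qed
  have "1 - real (n - 1) * (p / (1 + p)) \<le> p\<^sup>2 * ell 3 n p"
  proof (rule has_integral_le[OF J I])
    fix y :: real assume "y \<in> {0..1}"
    then show "(1 - real (n - 1) * y) * (p\<^sup>2 / sqrt (?Q y) ^ 3) \<le> p\<^sup>2 * (?j y / sqrt (?Q y) ^ 3)"
      using mult_right_mono[OF j(2) less_imp_le[OF P], of y y] by (simp add: mult.commute)
  qed
  moreover have "real (n - 1) * (p / (1 + p)) \<le> real (n - 1) * p"
    using p by (intro mult_left_mono) (auto simp: field_simps)
  ultimately show "1 - real (n - 1) * p \<le> p\<^sup>2 * ell 3 n p" by simp
qed

text \<open>Thus U p behaves like a constant over p. This makes \<open>lens_U\<close> map onto the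
  half-line, and in terms of \<Phi> it says that \<Phi>' s behaves like the same constant over s,
  which gives the logarithmic growth.\<close>

lemma tendsto_times_lens_U: "((\<lambda>p. p * lens_U n p) \<longlongrightarrow> growth_const n) (at_right 0)"
proof (rule tendsto_sandwich)
  let ?c = "growth_const n"
  have eq: "p * lens_U n p = ?c * sqrt (1 - p\<^sup>2) ^ n * (p\<^sup>2 * ell 3 n p)" for p
    by (simp add: lens_U_def power2_eq_square mult_ac)
  have nn: "0 \<le> ?c * sqrt (1 - p\<^sup>2) ^ n" if "0 < p" "p < 1" for p
    using growth_const_pos[of n] that by (intro mult_nonneg_nonneg zero_le_power) (auto simp: power_le_one)
  have ev: "\<forall>\<^sub>F p::real in at_right 0. 0 < p \<and> p < 1"
    unfolding eventually_at_right_field by (intro exI[of _ 1]) auto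
  show "\<forall>\<^sub>F p in at_right 0. ?c * sqrt (1 - p\<^sup>2) ^ n * (1 - real (n - 1) * p) \<le> p * lens_U n p"
    using ev
  proof eventually_elim
    case (elim p)
    then show ?case unfolding eq by (intro mult_left_mono ell_3_bounds nn) auto
  qed
  show "\<forall>\<^sub>F p in at_right 0. p * lens_U n p \<le> ?c * sqrt (1 - p\<^sup>2) ^ n * 1"
    using ev
  proof eventually_elim
    case (elim p)
    then show ?case unfolding eq by (intro mult_left_mono ell_3_bounds nn) auto
  qed
  have "((\<lambda>p. ?c * sqrt (1 - p\<^sup>2) ^ n * (1 - real (n - 1) * p)) \<longlongrightarrow>
          ?c * sqrt (1 - 0\<^sup>2) ^ n * (1 - real (n - 1) * 0)) (at_right 0)"
    by (intro tendsto_intros)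
  then show "((\<lambda>p. ?c * sqrt (1 - p\<^sup>2) ^ n * (1 - real (n - 1) * p)) \<longlongrightarrow> ?c) (at_right 0)" by simp
  have "((\<lambda>p. ?c * sqrt (1 - p\<^sup>2) ^ n * 1) \<longlongrightarrow> ?c * sqrt (1 - 0\<^sup>2) ^ n * 1) (at_right 0)"
    by (intro tendsto_intros)
  then show "((\<lambda>p. ?c * sqrt (1 - p\<^sup>2) ^ n * 1) \<longlongrightarrow> ?c) (at_right 0)" by simp
qed

section \<open>Construction of the solution from the optimality of the lenses\<close>

text \<open>This inverse of U turns out to be the derivative of \<open>lens_Phi\<close>; see
  \<open>lens_Phi_deriv\<close>.\<close>

definition lens_P :: "nat \<Rightarrow> real \<Rightarrow> real" where
  "lens_P n s = inv_into {0<..1} (lens_U n) s"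

definition lens_Phi :: "nat \<Rightarrow> real \<Rightarrow> real" where
  "lens_Phi n s = lens_W n (lens_P n s)"

text \<open>The inequality is the only geometric input to the theory of \<Phi>. It is established in
  \<open>lens_optimality_card\<close> by using one lens as competitor in the problem solved by
  another.\<close>

locale lens_optimality =
  fixes n :: nat
  assumes n: "n \<ge> 1"
    and optimal_interior: "\<lbrakk>0 < p; p < 1; 0 < q; q < 1\<rbrakk>
      \<Longrightarrow> lens_W n p - q * lens_U n p \<le> lens_W n q - q * lens_U n q"
begin

text \<open>The endpoint p = 1, where U and W vanish, corresponds to s = 0. It is reached by
  continuity, one variable at a time, and is what later gives the one-sided derivative of \<Phi> at
  0.\<close>

lemma optimal:
  assumes p: "0 < p" "p \<le> 1" and q: "0 < q" "q \<le> 1"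
  shows "lens_W n p - q * lens_U n p \<le> lens_W n q - q * lens_U n q"
proof -
  have lim1: "h 1 \<ge> 0" if h: "continuous_on {0<..1} h" "\<And>x. 0 < x \<Longrightarrow> x < 1 \<Longrightarrow> h x \<ge> 0"
    for h :: "real \<Rightarrow> real"
  proof (rule tendsto_lowerbound)
    have "(h \<longlongrightarrow> h 1) (at 1 within {0<..1})"
      using h(1) by (auto simp: continuous_on_def)
    then have "(h \<longlongrightarrow> h 1) (at 1 within {0<..<1})" by (rule tendsto_within_subset) auto
    moreover have "at 1 within {0<..<1} = at_left (1::real)"
      by (rule at_within_nhd[of _ "{0<..}"]) auto
    ultimately show "(h \<longlongrightarrow> h 1) (at_left 1)" by simp
    show "\<forall>\<^sub>F x in at_left 1. 0 \<le> h x"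
      unfolding eventually_at_left_field using h(2) by (intro exI[of _ 0]) auto
  qed auto
  have *: "lens_W n p - q * lens_U n p \<le> lens_W n q - q * lens_U n q"
    if p: "0 < p" "p < 1" and q: "0 < q" "q \<le> 1" for p q
  proof (cases "q = 1")
    case True
    have "continuous_on {0<..1} (\<lambda>q. (lens_W n q - q * lens_U n q) - (lens_W n p - q * lens_U n p))"
      by (intro continuous_intros lens_W_continuous lens_U_continuous)
    from lim1[OF this] show ?thesis using optimal_interior[OF p] True by simp
  next
    case False
    then show ?thesis using optimal_interior p q by simp
  qed
  show ?thesis
  proof (cases "p = 1")
    case True
    have "continuous_on {0<..1} (\<lambda>p. (lens_W n q - q * lens_U n q) - (lens_W n p - q * lens_U n p))"
      by (intro continuous_intros lens_W_continuous lens_U_continuous)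
    from lim1[OF this] show ?thesis using *[OF _ _ q] True by simp
  next
    case False
    then show ?thesis using * p q by simp
  qed
qed

text \<open>With F q = W q - q U q, optimality and the envelope lemma give F' = - U. Hence U = (W -
  F) / q is a quotient of functions whose derivatives are known, and \<open>ell 3\<close> is never
  differentiated.\<close>

lemma lens_U_deriv:
  assumes p: "0 < p" "p < 1"
  shows "(lens_U n has_real_derivative
           - (lens_U n p + (real n - 1) * p * lens_W n p) / (p * (1 - p\<^sup>2))) (at p)"
proof -
  have "((\<lambda>q. - (lens_W n q - q * lens_U n q)) has_real_derivative lens_U n p) (at p within {0<..<1})"
  proof (rule has_real_derivative_envelope)
    show "continuous (at p within {0<..<1}) (lens_U n)"
      by (rule continuous_within_subset[of _ "{0<..1}"])
        (use p lens_U_continuous[of n] in \<open>auto simp: continuous_on_eq_continuous_within\<close>)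
    fix y z :: real assume "y \<in> {0<..<1}" "z \<in> {0<..<1}"
    then show "- (lens_W n z - z * lens_U n z) - - (lens_W n y - y * lens_U n y) \<le> lens_U n y * (z - y)"
      using optimal[of y z] by (auto simp: algebra_simps)
  qed (use p in auto)
  then have F: "((\<lambda>q. - (lens_W n q - q * lens_U n q)) has_real_derivative lens_U n p) (at p)"
    using p at_within_open[of p "{0<..<1::real}"] by simp
  let ?w' = "- (lens_U n p + (real n - 1) * p * lens_W n p) / (1 - p\<^sup>2)"
  have "((\<lambda>q. (lens_W n q + - (lens_W n q - q * lens_U n q)) / q) has_real_derivative
      ((?w' + lens_U n p) * p - (lens_W n p + - (lens_W n p - p * lens_U n p)) * 1) / (p * p)) (at p)"
    using p by (intro DERIV_divide DERIV_add lens_W_deriv F n DERIV_ident) auto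
  moreover have "((?w' + lens_U n p) * p - (lens_W n p + - (lens_W n p - p * lens_U n p)) * 1) / (p * p)
      = - (lens_U n p + (real n - 1) * p * lens_W n p) / (p * (1 - p\<^sup>2))"
  proof -
    have "((w / k + u) * p - (W + - (W - p * u)) * 1) / (p * p) = w / (p * k)"
      if "k > 0" for w k u W :: real
      using that p(1) by (simp add: field_simps)
    then show ?thesis using p by (simp add: power_less_one_iff)
  qed
  ultimately have D: "((\<lambda>q. (lens_W n q + - (lens_W n q - q * lens_U n q)) / q) has_real_derivative
      - (lens_U n p + (real n - 1) * p * lens_W n p) / (p * (1 - p\<^sup>2))) (at p)" by simp
  show ?thesis
    by (rule DERIV_cong_ev[THEN iffD1, OF refl _ refl D])
      (rule eventually_mono[OF eventually_nhds_in_open[of "{0<..}" p]], use p in auto)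
qed

lemma lens_U_deriv_neg:
  assumes "0 < p" "p < 1"
  shows "- (lens_U n p + (real n - 1) * p * lens_W n p) / (p * (1 - p\<^sup>2)) < 0"
  using assms n lens_U_pos[OF assms, of n] lens_W_pos[OF assms, of n]
  by (intro divide_neg_pos mult_pos_pos neg_less_0_iff_less[THEN iffD2] add_pos_nonneg)
    (auto simp: power_less_one_iff)

lemma lens_U_strict_antimono:
  assumes "0 < p" "p < q" "q \<le> 1"
  shows "lens_U n q < lens_U n p"
proof (rule DERIV_neg_imp_decreasing_open[OF assms(2)])
  fix x assume "p < x" "x < q"
  then show "\<exists>y. (lens_U n has_real_derivative y) (at x) \<and> y < 0"
    using lens_U_deriv[of x] lens_U_deriv_neg[of x] assms by auto
next
  show "continuous_on {p..q} (lens_U n)"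
    by (rule continuous_on_subset[OF lens_U_continuous]) (use assms in auto)
qed

lemma inj_on_lens_U: "inj_on (lens_U n) {0<..1}"
  by (rule inj_onI) (metis greaterThanAtMost_iff lens_U_strict_antimono less_irrefl linorder_neqE)

lemma lens_U_surj:
  assumes s: "s \<ge> 0"
  shows "\<exists>p. 0 < p \<and> p \<le> 1 \<and> lens_U n p = s"
proof -
  have "filterlim (\<lambda>p. (p * lens_U n p) * inverse p) at_top (at_right 0)"
    by (rule filterlim_tendsto_pos_mult_at_top[OF tendsto_times_lens_U growth_const_pos
          filterlim_inverse_at_top_right])
  then have "\<forall>\<^sub>F p in at_right 0. s \<le> (p * lens_U n p) * inverse p"
    by (simp add: filterlim_at_top)
  moreover have "\<forall>\<^sub>F p::real in at_right 0. 0 < p \<and> p < 1"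
    unfolding eventually_at_right_field by (intro exI[of _ 1]) auto
  ultimately have "\<forall>\<^sub>F p in at_right 0. 0 < p \<and> p < 1 \<and> s \<le> lens_U n p"
    by eventually_elim (simp add: field_simps)
  then obtain p where p: "0 < p" "p < 1" "s \<le> lens_U n p"
    using eventually_happens[of _ "at_right (0::real)"] trivial_limit_at_right_real by blast
  have "\<exists>x\<ge>p. x \<le> 1 \<and> lens_U n x = s"
  proof (rule IVT2')
    show "continuous_on {p..1} (lens_U n)"
      by (rule continuous_on_subset[OF lens_U_continuous]) (use p in auto)
  qed (use p s lens_U_1[OF n] in auto)
  then obtain x where "x \<ge> p" "x \<le> 1" "lens_U n x = s" by blast
  then show ?thesis using p by (intro exI[of _ x]) auto
qed

lemma lens_P:
  assumes "s \<ge> 0"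
  shows "0 < lens_P n s" "lens_P n s \<le> 1" "lens_U n (lens_P n s) = s"
proof -
  have "s \<in> lens_U n ` {0<..1}" using lens_U_surj[OF assms] by force
  then have "lens_P n s \<in> {0<..1}" "lens_U n (lens_P n s) = s"
    unfolding lens_P_def by (rule inv_into_into, rule f_inv_into_f)
  then show "0 < lens_P n s" "lens_P n s \<le> 1" "lens_U n (lens_P n s) = s" by auto
qed

lemma lens_P_lens_U:
  assumes "0 < p" "p \<le> 1"
  shows "lens_P n (lens_U n p) = p"
  unfolding lens_P_def using inj_on_lens_U assms by (intro inv_into_f_f) auto

lemma lens_P_0: "lens_P n 0 = 1"
  using lens_P_lens_U[of 1] lens_U_1[OF n] by simp

lemma lens_P_less_1:
  assumes "s > 0"
  shows "lens_P n s < 1"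
  using lens_P[of s] assms lens_U_1[OF n] by (cases "lens_P n s = 1") auto

lemma lens_P_continuous: "continuous_on {0..} (lens_P n)"
  unfolding continuous_on_eq_continuous_within
proof
  fix s :: real assume s: "s \<in> {0..}"
  \<comment> \<open>Since U decreases, it maps [e, 1] onto [0, s + 1], which is a neighbourhood of s
    in the half-line. On the compact interval [e, 1] the inverse of a continuous injection is
    continuous.\<close>
  define e where "e = lens_P n (s + 1)"
  have e: "0 < e" "e \<le> 1" "lens_U n e = s + 1" using lens_P[of "s + 1"] s by (auto simp: e_def)
  have "continuous_on (lens_U n ` {e..1}) (lens_P n)"
    using e lens_P_lens_U
    by (intro continuous_on_inv continuous_on_subset[OF lens_U_continuous]) auto
  moreover have "{0..s + 1} \<subseteq> lens_U n ` {e..1}"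
  proof
    fix t assume t: "t \<in> {0..s + 1}"
    have "e \<le> lens_P n t"
    proof (rule ccontr)
      assume "\<not> e \<le> lens_P n t"
      then have "lens_U n e < t" using lens_U_strict_antimono[of "lens_P n t" e] lens_P[of t] t e by auto
      then show False using t e by simp
    qed
    then show "t \<in> lens_U n ` {e..1}" using lens_P[of t] t by (intro image_eqI[of _ _ "lens_P n t"]) auto
  qed
  ultimately have "continuous_on {0..s + 1} (lens_P n)" by (rule continuous_on_subset)
  then have "continuous (at s within {0..s + 1}) (lens_P n)"
    using s by (auto simp: continuous_on_eq_continuous_within)
  moreover have "at s within {0..s + 1} = at s within {0..}"
    using s by (intro at_within_nhd[of _ "{..<s + 1}"]) auto
  ultimately show "continuous (at s within {0..}) (lens_P n)" by simp
qed

text \<open>Optimality at q = \<open>lens_P n s\<close> places the graph of \<Phi> below the line of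
  slope \<open>lens_P n s\<close> through its point over s; these lines are the supports of a
  concave function.\<close>

lemma lens_Phi_envelope:
  assumes "s \<ge> 0" "t \<ge> 0"
  shows "lens_Phi n t - lens_Phi n s \<le> lens_P n s * (t - s)"
  using optimal[of "lens_P n t" "lens_P n s"] lens_P[OF assms(1)] lens_P[OF assms(2)]
  unfolding lens_Phi_def by (simp add: algebra_simps)

lemma lens_Phi_deriv:
  assumes "s \<ge> 0"
  shows "(lens_Phi n has_real_derivative lens_P n s) (at s within {0..})"
proof (rule has_real_derivative_envelope)
  show "continuous (at s within {0..}) (lens_P n)"
    using lens_P_continuous assms by (auto simp: continuous_on_eq_continuous_within)
qed (use assms lens_Phi_envelope in auto)

lemma lens_P_deriv:
  assumes s: "s > 0"
  defines "p \<equiv> lens_P n s"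
  shows "(lens_P n has_real_derivative
           p * (p\<^sup>2 - 1) / ((real n - 1) * lens_Phi n s * p + s)) (at s)"
proof -
  have p: "0 < p" "p < 1" "lens_U n p = s"
    using lens_P[of s] lens_P_less_1[of s] s by (auto simp: p_def)
  let ?d = "- (lens_U n p + (real n - 1) * p * lens_W n p) / (p * (1 - p\<^sup>2))"
  have "(lens_P n has_real_derivative inverse ?d) (at s)"
  proof (rule DERIV_inverse_function)
    show "(lens_U n has_real_derivative ?d) (at (lens_P n s))"
      using lens_U_deriv[OF p(1,2)] by (simp add: p_def)
    show "isCont (lens_P n) s"
      using continuous_on_interior[OF lens_P_continuous, of s] s by (simp add: interior_real_atLeast)
    show "0 < s" "s < s + 1" using s by auto
    show "lens_U n (lens_P n y) = y" if "0 < y" "y < s + 1" for y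
      using lens_P[of y] that by simp
    show "?d \<noteq> 0" using lens_U_deriv_neg[OF p(1,2)] by (simp only: less_imp_neq not_False_eq_True)
  qed
  moreover have "inverse ?d = p * (p\<^sup>2 - 1) / ((real n - 1) * lens_Phi n s * p + s)"
  proof -
    have "inverse (- a / (q * k)) = q * (- k) / a" for a q k :: real
      by (simp add: inverse_eq_divide)
    from this[of "s + (real n - 1) * p * lens_W n p" p "1 - p\<^sup>2"] show ?thesis
      unfolding lens_Phi_def p_def[symmetric] p(3) by (simp add: ac_simps)
  qed
  ultimately show ?thesis by simp
qed

lemma lens_Phi_nonneg:
  assumes "s \<ge> 0"
  shows "lens_Phi n s \<ge> 0"
  using lens_P[OF assms] lens_W_pos[of "lens_P n s" n] lens_W_1[OF n]
  unfolding lens_Phi_def by (cases "lens_P n s = 1") auto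

lemma lens_Phi_0: "lens_Phi n 0 = 0"
  by (simp add: lens_Phi_def lens_P_0 lens_W_1[OF n])

lemma lens_Phi_solves: "solves_initial_problem n (lens_Phi n)"
  unfolding solves_initial_problem_def
proof (intro exI conjI allI impI)
  show "(lens_Phi n has_real_derivative lens_P n s) (at s within {0..})" if "s \<ge> 0" for s
    using lens_Phi_deriv that .
  show "continuous_on {0..} (lens_P n)" by (rule lens_P_continuous)
  fix s :: real assume s: "s > 0"
  show "(lens_P n has_real_derivative
      lens_P n s * ((lens_P n s)\<^sup>2 - 1) / ((real n - 1) * lens_Phi n s * lens_P n s + s)) (at s)"
    using lens_P_deriv[OF s] by simp
  have "(real n - 1) * lens_Phi n s * lens_P n s \<ge> 0"
    using n s lens_P[of s] lens_Phi_nonneg[of s] by simp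
  then show "(real n - 1) * lens_Phi n s * lens_P n s + s \<noteq> 0" using s by linarith
qed (auto simp: lens_Phi_0 lens_P_0)

lemma lens_P_tendsto_0: "filterlim (lens_P n) (at_right 0) at_top"
proof -
  have "\<forall>\<^sub>F s in at_top. lens_P n s < e" if "e > 0" for e
  proof -
    define q where "q = min e 1"
    have q: "0 < q" "q \<le> 1" "q \<le> e" using that by (auto simp: q_def)
    have "lens_P n s < e" if "s > max 0 (lens_U n q)" for s
    proof (rule ccontr)
      assume "\<not> lens_P n s < e"
      then have "q \<le> lens_P n s" using q by simp
      then have "lens_U n (lens_P n s) \<le> lens_U n q"
        using lens_U_strict_antimono[of q "lens_P n s"] lens_P[of s] that q by (cases "q = lens_P n s") auto
      then show False using that lens_P[of s] by simp
    qed
    then show ?thesis using eventually_gt_at_top[of "max 0 (lens_U n q)"]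
      by (rule eventually_mono[rotated])
  qed
  moreover have "\<forall>\<^sub>F s in at_top. 0 < lens_P n s"
    using eventually_ge_at_top[of 0] by (rule eventually_mono) (rule lens_P)
  ultimately show ?thesis
    by (intro filterlim_at_withinI order_tendstoI)
      (auto elim!: eventually_mono)
qed

text \<open>By L'Hospital's rule the quotient of derivatives is s \<open>lens_P n s\<close>. With p
  = \<open>lens_P n s\<close> this is p U p, and p tends to 0 from the right.\<close>

lemma lens_Phi_asymptotic: "asymptotic_condition n (lens_Phi n)"
proof -
  have sP: "((\<lambda>s. lens_P n s / inverse s) \<longlongrightarrow> growth_const n) at_top"
  proof (rule Lim_transform_eventually)
    show "((\<lambda>s. lens_P n s * lens_U n (lens_P n s)) \<longlongrightarrow> growth_const n) at_top"
      using filterlim_compose[OF tendsto_times_lens_U lens_P_tendsto_0] .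
    show "\<forall>\<^sub>F s in at_top. lens_P n s * lens_U n (lens_P n s) = lens_P n s / inverse s"
      using eventually_ge_at_top[of 0]
      by (rule eventually_mono) (simp add: lens_P(3) divide_inverse)
  qed
  have "((\<lambda>s. lens_Phi n s / ln s) \<longlongrightarrow> growth_const n) at_top"
  proof (rule lhospital_at_top_at_top[OF _ _ _ _ sP])
    show "filterlim ln at_top (at_top :: real filter)" by (rule ln_at_top)
    show "\<forall>\<^sub>F x in at_top. inverse x \<noteq> (0::real)"
      using eventually_gt_at_top[of 0] by (rule eventually_mono) simp
    show "\<forall>\<^sub>F x in at_top. (lens_Phi n has_real_derivative lens_P n x) (at x)"
      using eventually_gt_at_top[of 0]
    proof (rule eventually_mono)
      fix x :: real assume "x > 0"
      then show "(lens_Phi n has_real_derivative lens_P n x) (at x)"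
        using lens_Phi_deriv[of x] at_within_interior[of x "{0..}"] by (simp add: interior_real_atLeast)
    qed
    show "\<forall>\<^sub>F x::real in at_top. (ln has_real_derivative inverse x) (at x)"
      using eventually_gt_at_top[of 0] by (rule eventually_mono) (rule DERIV_ln)
  qed
  then show ?thesis by (simp add: asymptotic_condition_def growth_const_def)
qed

section \<open>Uniqueness of the solution\<close>

text \<open>The slope p = \<Psi>' serves as parameter: once 0 < p < 1 is known, the point (U, W) of
  the lens profile with this slope is compared with (s, \<Psi> s). The two are proportional, first
  at every s separately and then with a factor l independent of s.\<close>

lemma lens_Phi_unique:
  assumes sol: "solves_initial_problem n \<Psi>" and asy: "asymptotic_condition n \<Psi>" and "s \<ge> 0"
  shows "\<Psi> s = lens_Phi n s"
proof -
  from sol obtain p p' where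
    D\<Psi>: "\<And>s. s \<ge> 0 \<Longrightarrow> (\<Psi> has_real_derivative p s) (at s within {0..})"
    and p_cont: "continuous_on {0..} p"
    and Dp': "\<And>s. s > 0 \<Longrightarrow> (p has_real_derivative p' s) (at s)"
    and den: "\<And>s. s > 0 \<Longrightarrow> (real n - 1) * \<Psi> s * p s + s \<noteq> 0"
    and ode: "\<And>s. s > 0 \<Longrightarrow> p' s = p s * ((p s)\<^sup>2 - 1) / ((real n - 1) * \<Psi> s * p s + s)"
    and init: "\<Psi> 0 = 0" "p 0 = 1"
    unfolding solves_initial_problem_def by blast
  define d where "d s = (real n - 1) * \<Psi> s * p s + s" for s
  have Dp: "(p has_real_derivative p s * ((p s)\<^sup>2 - 1) / d s) (at s)" if "s > 0" for s
    using Dp'[OF that] ode[OF that] by (simp add: d_def)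
  have D\<Psi>0: "(\<Psi> has_real_derivative p s) (at s)" if "s > 0" for s
    using D\<Psi>[of s] at_within_interior[of s "{0..}"] that by (simp add: interior_real_atLeast)
  have \<Psi>_cont: "continuous_on {0..} \<Psi>"
    using D\<Psi> by (auto intro: DERIV_continuous_on)
  have d_cont: "continuous_on {0..} d"
    unfolding d_def by (intro continuous_intros \<Psi>_cont p_cont)

  \<comment> \<open>The denominator d is half the derivative of (n - 1) \<Psi>^2 + s^2, a
    nonnegative function that starts at 0. As d has no zero for s > 0, one negative value would make
    this function decrease from the start.\<close>
  have d_pos: "d s1 > 0" if s1: "s1 > 0" for s1
  proof (rule ccontr)
    assume "\<not> d s1 > 0"
    then have neg: "d s1 < 0" using den[OF s1] by (simp add: d_def)
    have d_neg: "d s < 0" if s: "0 < s" "s \<le> s1" for s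
    proof (rule ccontr)
      assume "\<not> d s < 0"
      moreover have "continuous_on {s..s1} d"
        by (rule continuous_on_subset[OF d_cont]) (use s in auto)
      ultimately obtain x where "s \<le> x" "x \<le> s1" "d x = 0"
        using IVT2'[of d s1 0 s] neg s by auto
      then show False using den[of x] s by (simp add: d_def)
    qed
    have "(real n - 1) * (\<Psi> s1)\<^sup>2 + s1\<^sup>2 < (real n - 1) * (\<Psi> 0)\<^sup>2 + 0\<^sup>2"
    proof (rule DERIV_neg_imp_decreasing_open[OF s1, where f = "\<lambda>s. (real n - 1) * (\<Psi> s)\<^sup>2 + s\<^sup>2"])
      fix x assume x: "0 < x" "x < s1"
      have "((\<lambda>s. (real n - 1) * (\<Psi> s)\<^sup>2 + s\<^sup>2) has_real_derivative 2 * d x) (at x)"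
        using D\<Psi>0[OF x(1)] by (auto intro!: derivative_eq_intros simp: d_def algebra_simps)
      then show "\<exists>y. ((\<lambda>s. (real n - 1) * (\<Psi> s)\<^sup>2 + s\<^sup>2) has_real_derivative y) (at x) \<and> y < 0"
        using d_neg[of x] x by (intro exI[of _ "2 * d x"]) auto
    next
      show "continuous_on {0..s1} (\<lambda>s. (real n - 1) * (\<Psi> s)\<^sup>2 + s\<^sup>2)"
        by (intro continuous_intros continuous_on_subset[OF \<Psi>_cont]) auto
    qed
    moreover have "0 \<le> (real n - 1) * (\<Psi> s1)\<^sup>2 + s1\<^sup>2" using n by simp
    ultimately show False by (simp add: init)
  qed

  have c: "((\<lambda>s. \<Psi> s / ln s) \<longlongrightarrow> growth_const n) at_top"
    using asy by (simp add: asymptotic_condition_def growth_const_def)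

  have "\<exists>s0>0. p s0 < 1"
  proof (rule ccontr)
    assume "\<not> (\<exists>s0>0. p s0 < 1)"
    then have p_ge: "p s \<ge> 1" if "s > 0" for s using that by force
    have \<Psi>_ge: "\<Psi> s \<ge> s" if s: "s > 0" for s
    proof -
      have "\<Psi> 0 - 0 \<le> \<Psi> s - s"
      proof (rule DERIV_nonneg_imp_increasing_open[where f = "\<lambda>s. \<Psi> s - s"])
        fix x assume x: "0 < x" "x < s"
        have "((\<lambda>s. \<Psi> s - s) has_real_derivative p x - 1) (at x)"
          by (intro DERIV_diff D\<Psi>0 x DERIV_ident)
        then show "\<exists>y. ((\<lambda>s. \<Psi> s - s) has_real_derivative y) (at x) \<and> 0 \<le> y"
          using p_ge[OF x(1)] by (intro exI[of _ "p x - 1"]) auto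
      next
        show "continuous_on {0..s} (\<lambda>s. \<Psi> s - s)"
          by (intro continuous_intros continuous_on_subset[OF \<Psi>_cont]) auto
      qed (use s in auto)
      then show ?thesis by (simp add: init)
    qed
    have "((\<lambda>s. (\<Psi> s / ln s) * (ln s / s)) \<longlongrightarrow> growth_const n * 0) at_top"
      by (intro tendsto_mult c ln_x_over_x_tendsto_0)
    moreover have "\<forall>\<^sub>F s in at_top. 1 \<le> (\<Psi> s / ln s) * (ln s / s)"
      using eventually_gt_at_top[of 1]
      by (rule eventually_mono) (use \<Psi>_ge in \<open>force simp: field_simps\<close>)
    ultimately have "1 \<le> growth_const n * 0"
      by (rule tendsto_lowerbound) simp
    then show False by simp
  qed
  then obtain s0 where s0: "s0 > 0" "p s0 < 1" by blast

  \<comment> \<open>The function 1 - p solves a homogeneous linear equation with coefficient p (p +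
    1) / d, so one slope below 1 keeps all slopes below 1. The same device, started near 0 where p
    is close to 1, later keeps p positive.\<close>
  have p_less: "p s < 1" if s: "s > 0" for s
  proof -
    have "1 - p s > 0"
    proof (rule homogeneous_linear_ode_pos[where f = "\<lambda>s. 1 - p s" and a = "\<lambda>s. p s * (p s + 1) / d s"])
      show "continuous_on {0<..} (\<lambda>s. p s * (p s + 1) / d s)"
        using d_pos by (intro continuous_intros continuous_on_subset[OF p_cont]
            continuous_on_subset[OF d_cont]) force+
      show "((\<lambda>s. 1 - p s) has_real_derivative p s * (p s + 1) / d s * (1 - p s)) (at s)" if "s > 0" for s
        using Dp[OF that] d_pos[OF that]
        by (auto intro!: derivative_eq_intros simp: field_simps power2_eq_square)
    qed (use s0 s in auto)
    then show ?thesis by simp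
  qed

  have p_at_0: "(p \<longlongrightarrow> 1) (at_right 0)"
  proof -
    have "(p \<longlongrightarrow> p 0) (at 0 within {0..})"
      using p_cont by (auto simp: continuous_on_def)
    then have "(p \<longlongrightarrow> p 0) (at_right 0)" by (rule tendsto_within_subset) auto
    then show ?thesis by (simp add: init)
  qed
  have \<Psi>_at_0: "(\<Psi> \<longlongrightarrow> 0) (at_right 0)"
  proof -
    have "(\<Psi> \<longlongrightarrow> \<Psi> 0) (at 0 within {0..})"
      using \<Psi>_cont by (auto simp: continuous_on_def)
    then have "(\<Psi> \<longlongrightarrow> \<Psi> 0) (at_right 0)" by (rule tendsto_within_subset) auto
    then show ?thesis by (simp add: init)
  qed

  have "\<forall>\<^sub>F s in at_right 0. 0 < p s"
    by (rule order_tendstoD(1)[OF p_at_0]) simp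
  moreover have "\<forall>\<^sub>F s::real in at_right 0. 0 < s"
    by (rule eventually_at_right_less)
  ultimately have "\<forall>\<^sub>F s in at_right 0. 0 < s \<and> 0 < p s" by eventually_elim simp
  then obtain s2 where s2: "s2 > 0" "p s2 > 0"
    using eventually_happens[of _ "at_right (0::real)"] trivial_limit_at_right_real by blast
  have p_pos: "p s > 0" if s: "s > 0" for s
  proof (rule homogeneous_linear_ode_pos[where f = p and a = "\<lambda>s. ((p s)\<^sup>2 - 1) / d s"])
    show "continuous_on {0<..} (\<lambda>s. ((p s)\<^sup>2 - 1) / d s)"
      using d_pos by (intro continuous_intros continuous_on_subset[OF p_cont]
          continuous_on_subset[OF d_cont]) force+
    show "(p has_real_derivative ((p s)\<^sup>2 - 1) / d s * p s) (at s)" if "s > 0" for s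
      using Dp[OF that] by (simp add: mult.commute)
  qed (use s2 s in auto)

  let ?U = "\<lambda>s. lens_U n (p s)" and ?W = "\<lambda>s. lens_W n (p s)" and ?S = "\<lambda>s. sqrt (1 - (p s)\<^sup>2)"
  let ?Y = "\<lambda>s. ?U s * \<Psi> s - s * ?W s"
  let ?G = "\<lambda>s. ?U s + (real n - 1) * p s * ?W s"
  have S_pos: "1 - (p s)\<^sup>2 > 0" "?S s > 0" if "s > 0" for s
    using p_pos[OF that] p_less[OF that] by (simp_all add: power_less_one_iff)
  have DU: "(?U has_real_derivative ?G s / d s) (at s)" if s: "s > 0" for s
  proof -
    have eq: "- (?G s) / (p s * (1 - (p s)\<^sup>2)) * (p s * ((p s)\<^sup>2 - 1) / d s) = ?G s / d s"
    proof -
      have "- g / (q * k) * (q * (- k) / e) = g / e" if "q > 0" "k > 0" "e > 0" for g q k e :: real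
        using that by (simp add: field_simps)
      from this[OF p_pos[OF s] S_pos(1)[OF s] d_pos[OF s], of "?G s"] show ?thesis by simp
    qed
    show ?thesis
      by (rule DERIV_cong[OF DERIV_chain2[OF lens_U_deriv[OF p_pos[OF s] p_less[OF s]] Dp[OF s]] eq])
  qed
  have DW: "(?W has_real_derivative p s * ?G s / d s) (at s)" if s: "s > 0" for s
  proof -
    have eq: "- (?G s) / (1 - (p s)\<^sup>2) * (p s * ((p s)\<^sup>2 - 1) / d s) = p s * ?G s / d s"
    proof -
      have "- g / k * (q * (- k) / e) = q * g / e" if "k > 0" "e > 0" for g q k e :: real
        using that by (simp add: field_simps)
      from this[OF S_pos(1)[OF s] d_pos[OF s], of "?G s" "p s"] show ?thesis by simp
    qed
    show ?thesis
      by (rule DERIV_cong[OF DERIV_chain2[OF lens_W_deriv[OF n p_pos[OF s] p_less[OF s]] Dp[OF s]] eq])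
  qed
  \<comment> \<open>The derivatives of U(p s) and W(p s) share the factor \<open>?G s / d s\<close>,
    that of W carrying an additional p. Inserting d = (n - 1) \<Psi> p + s then leaves a multiple of
    Y, so Y again obeys a linear equation.\<close>
  have DY: "(?Y has_real_derivative ?Y s * (1 + (real n - 1) * (p s)\<^sup>2) / d s) (at s)" if s: "s > 0" for s
  proof -
    have "(?Y has_real_derivative (?G s / d s * \<Psi> s + p s * ?U s) -
        (1 * ?W s + p s * ?G s / d s * s)) (at s)"
      by (intro DERIV_diff DERIV_mult DU DW D\<Psi>0 s DERIV_ident)
    moreover have "(?G s / d s * \<Psi> s + p s * ?U s) - (1 * ?W s + p s * ?G s / d s * s)
       = (?G s * \<Psi> s + p s * ?U s * d s - ?W s * d s - p s * ?G s * s) / d s"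
      using d_pos[OF s] by (simp add: field_simps)
    moreover have "?G s * \<Psi> s + p s * ?U s * d s - ?W s * d s - p s * ?G s * s
       = ?Y s * (1 + (real n - 1) * (p s)\<^sup>2)"
      unfolding d_def by (simp add: algebra_simps power2_eq_square)
    ultimately show ?thesis by (simp only:)
  qed
  have DS: "(?S has_real_derivative (p s)\<^sup>2 * ?S s / d s) (at s)" if s: "s > 0" for s
  proof -
    have "((\<lambda>x. sqrt (1 - x\<^sup>2)) has_real_derivative (- p s / ?S s)) (at (p s))"
      using S_pos[OF s] by (auto intro!: derivative_eq_intros simp: field_simps)
    note D = DERIV_chain2[OF this Dp[OF s]]
    have alg: "- q / S * (q * (q\<^sup>2 - 1) / e) = q\<^sup>2 * S / e" if "S > 0" "S\<^sup>2 = 1 - q\<^sup>2" for q S e :: real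
    proof -
      have "q\<^sup>2 - 1 = - (S * S)" using that(2) by (simp add: power2_eq_square)
      then show ?thesis using that(1) by (simp add: power2_eq_square)
    qed
    show ?thesis
      by (rule DERIV_cong[OF D alg]) (use S_pos[OF s] in auto)
  qed

  txt \<open>The Wronskian-type expression \<open>p Y / S\<^sup>n\<close> is a first integral; it vanishes at \<open>0\<close> because
    \<open>U\<close> and \<open>W\<close> both carry the factor \<open>S\<^sup>n\<close>.\<close>
  let ?E = "\<lambda>s. p s * ?Y s / ?S s ^ n"
  have "\<exists>k. \<forall>s\<in>{0<..}. ?E s = k"
  proof (rule has_field_derivative_zero_constant)
    fix s :: real assume "s \<in> {0<..}"
    then have s: "s > 0" by simp
    have "(?E has_real_derivative
       ((p s * ((p s)\<^sup>2 - 1) / d s * ?Y s + ?Y s * (1 + (real n - 1) * (p s)\<^sup>2) / d s * p s) * ?S s ^ n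
         - (p s * ?Y s) * (real n * (?S s ^ (n - Suc 0) * ((p s)\<^sup>2 * ?S s / d s)))) / (?S s ^ n * ?S s ^ n))
       (at s)"
      using S_pos[OF s] DERIV_power[OF DS[OF s], of n]
      by (intro DERIV_divide DERIV_mult[OF Dp[OF s] DY[OF s]]) (auto simp: mult_ac)
    moreover have "(p s * ((p s)\<^sup>2 - 1) / d s * ?Y s + ?Y s * (1 + (real n - 1) * (p s)\<^sup>2) / d s * p s) * ?S s ^ n
         - (p s * ?Y s) * (real n * (?S s ^ (n - Suc 0) * ((p s)\<^sup>2 * ?S s / d s))) = 0"
    proof -
      have "?S s ^ (n - Suc 0) * ((p s)\<^sup>2 * ?S s / d s) = ?S s ^ n * ((p s)\<^sup>2 / d s)"
        using n by (cases n) auto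
      then show ?thesis using d_pos[OF s] by (simp only:) (simp add: field_simps)
    qed
    ultimately have "(?E has_real_derivative 0) (at s)" by simp
    then show "(?E has_real_derivative 0) (at s within {0<..})"
      by (rule has_field_derivative_at_within)
  qed simp
  then obtain k where k: "\<And>s. s > 0 \<Longrightarrow> ?E s = k" by auto
  have "((\<lambda>s. p s * (growth_const n * p s * ell 3 n (p s) * \<Psi> s - s * (growth_const n * ell 1 n (p s))))
      \<longlongrightarrow> 1 * (growth_const n * 1 * ell 3 n 1 * 0 - 0 * (growth_const n * ell 1 n 1))) (at_right 0)"
  proof -
    have "((\<lambda>s. ell m n (p s)) \<longlongrightarrow> ell m n 1) (at_right 0)" for m
    proof (rule continuous_on_tendsto_compose[OF ell_continuous p_at_0])
      show "\<forall>\<^sub>F s in at_right 0. p s \<in> {0<..1}"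
        using eventually_at_right_less[of "0::real"]
        by (rule eventually_mono) (use p_pos p_less in \<open>auto intro: less_imp_le\<close>)
    qed auto
    then show ?thesis by (intro tendsto_intros p_at_0 \<Psi>_at_0)
  qed
  moreover have "\<forall>\<^sub>F s in at_right 0.
      p s * (growth_const n * p s * ell 3 n (p s) * \<Psi> s - s * (growth_const n * ell 1 n (p s))) = k"
    using eventually_at_right_less[of "0::real"]
  proof (rule eventually_mono)
    fix s :: real assume s: "0 < s"
    have "?Y s = (growth_const n * p s * ell 3 n (p s) * \<Psi> s - s * (growth_const n * ell 1 n (p s))) * ?S s ^ n"
      unfolding lens_U_def lens_W_def by (simp add: algebra_simps)
    then show "p s * (growth_const n * p s * ell 3 n (p s) * \<Psi> s - s * (growth_const n * ell 1 n (p s))) = k"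
      using k[OF s] S_pos[OF s] by simp
  qed
  ultimately have "((\<lambda>s. k) \<longlongrightarrow> 0) (at_right (0::real))"
    using Lim_transform_eventually by fastforce
  then have "k = 0" by (simp add: tendsto_const_iff)
  then have Y0: "?U s * \<Psi> s = s * ?W s" if "s > 0" for s
    using k[OF that] p_pos[OF that] S_pos[OF that] by simp

  \<comment> \<open>Since Y = 0 replaces s W by U \<Psi>, the logarithmic derivative of U(p s)
    equals 1 / s; the factor of proportionality is therefore constant.\<close>
  have "\<exists>l. \<forall>s\<in>{0<..}. ?U s / s = l"
  proof (rule has_field_derivative_zero_constant)
    fix s :: real assume "s \<in> {0<..}"
    then have s: "s > 0" by simp
    have "((\<lambda>s. ?U s / s) has_real_derivative (?G s / d s * s - ?U s * 1) / (s * s)) (at s)"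
      using s by (intro DERIV_divide DU DERIV_ident) auto
    moreover have "?G s * s = ?U s * d s"
    proof -
      have "?G s * s = ?U s * s + (real n - 1) * p s * (s * ?W s)" by (simp add: algebra_simps)
      also have "\<dots> = ?U s * d s" unfolding Y0[OF s, symmetric] d_def by (simp add: algebra_simps)
      finally show ?thesis .
    qed
    then have "?G s / d s * s - ?U s * 1 = 0" using d_pos[OF s] by (simp add: field_simps)
    ultimately have "((\<lambda>s. ?U s / s) has_real_derivative 0) (at s)" by simp
    then show "((\<lambda>s. ?U s / s) has_real_derivative 0) (at s within {0<..})"
      by (rule has_field_derivative_at_within)
  qed simp
  then obtain l where "\<And>s. s > 0 \<Longrightarrow> ?U s / s = l" by auto
  then have l: "?U s = l * s" if "s > 0" for s using that by (simp add: field_simps)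
  have l_pos: "l > 0"
    using l[of 1] lens_U_pos[OF p_pos[of 1] p_less[of 1], of n] by simp
  have \<Psi>_eq: "lens_Phi n (l * s) = l * \<Psi> s" if s: "s > 0" for s
  proof -
    have "lens_P n (l * s) = p s"
      using lens_P_lens_U[OF p_pos[OF s] less_imp_le[OF p_less[OF s]]] l[OF s] by simp
    moreover have "?W s = l * \<Psi> s" using Y0[OF s] l[OF s] s by simp
    ultimately show ?thesis by (simp add: lens_Phi_def)
  qed

  \<comment> \<open>The limit of l \<Psi> s / ln s is evaluated twice: directly, and through \<Phi>
    (l s) / ln (l s), where ln l is negligible against ln s.\<close>
  have "((\<lambda>s. l * (\<Psi> s / ln s)) \<longlongrightarrow> l * growth_const n) at_top"
    by (intro tendsto_intros c)
  moreover have "((\<lambda>s. l * (\<Psi> s / ln s)) \<longlongrightarrow> growth_const n * (0 + 1)) at_top"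
  proof (rule Lim_transform_eventually)
    have "filterlim (\<lambda>s. l * s) at_top at_top"
      using l_pos by (intro filterlim_tendsto_pos_mult_at_top[OF tendsto_const _ filterlim_ident])
    then have "((\<lambda>s. lens_Phi n (l * s) / ln (l * s)) \<longlongrightarrow> growth_const n) at_top"
      using lens_Phi_asymptotic filterlim_compose[of "\<lambda>s. lens_Phi n s / ln s"]
      by (simp add: asymptotic_condition_def growth_const_def)
    moreover have "((\<lambda>s. ln l / ln s) \<longlongrightarrow> 0) at_top"
      by (intro real_tendsto_divide_at_top[OF tendsto_const] ln_at_top)
    ultimately show "((\<lambda>s. lens_Phi n (l * s) / ln (l * s) * (ln l / ln s + 1)) \<longlongrightarrow> growth_const n * (0 + 1)) at_top"
      by (intro tendsto_intros)
    show "\<forall>\<^sub>F s in at_top. lens_Phi n (l * s) / ln (l * s) * (ln l / ln s + 1) = l * (\<Psi> s / ln s)"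
      using eventually_gt_at_top[of "max 1 (1 / l)"]
    proof (rule eventually_mono)
      fix s assume s: "max 1 (1 / l) < s"
      then have "l * s > 1" "s > 1" using l_pos by (auto simp: field_simps)
      then have "ln (l * s) > 0" "ln s > 0" by auto
      moreover have "ln l / ln s + 1 = ln (l * s) / ln s"
        using \<open>ln s > 0\<close> \<open>s > 1\<close> l_pos by (simp add: ln_mult field_simps)
      ultimately show "lens_Phi n (l * s) / ln (l * s) * (ln l / ln s + 1) = l * (\<Psi> s / ln s)"
        using \<Psi>_eq[of s] \<open>s > 1\<close> by simp
    qed
  qed
  ultimately have "l * growth_const n = growth_const n * (0 + 1)"
    by (rule tendsto_unique[rotated]) simp
  then have "l = 1" using growth_const_pos[of n] by simp
  then show ?thesis
    using \<Psi>_eq[of s] lens_Phi_0 init \<open>s \<ge> 0\<close> by (cases "s = 0") auto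
qed

end

section \<open>Polar coordinates and the distribution of the direction cosine\<close>

text \<open>Derivatives are asked inside the interval only, because antiderivatives such as a power
  of \<open>sqrt (1 - s\<^sup>2)\<close> need not be differentiable at s = 1.\<close>

lemma nn_integral_FTC_Ioo:
  fixes F f :: "real \<Rightarrow> real"
  assumes ab: "a \<le> b" and cont: "continuous_on {a..b} F"
    and deriv: "\<And>x. a < x \<Longrightarrow> x < b \<Longrightarrow> (F has_real_derivative f x) (at x)"
    and nonneg: "\<And>x. a < x \<Longrightarrow> x < b \<Longrightarrow> 0 \<le> f x"
  shows "(\<integral>\<^sup>+x. ennreal (f x) * indicator {a<..<b} x \<partial>lborel) = ennreal (F b - F a)"
proof (rule nn_integral_has_integral_lebesgue')
  have "(f has_integral (F b - F a)) {a..b}"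
    by (rule fundamental_theorem_of_calculus_interior[OF ab cont])
      (use deriv in \<open>auto simp: has_real_derivative_iff_has_vector_derivative\<close>)
  then show "(f has_integral (F b - F a)) {a<..<b}"
    by (simp add: has_integral_Icc_iff_Ioo)
qed (use nonneg in auto)

lemma nn_integral_lborel_scaleR:
  fixes f :: "'a::euclidean_space \<Rightarrow> ennreal"
  assumes [measurable]: "f \<in> borel_measurable borel" and c: "c > 0"
  shows "(\<integral>\<^sup>+x. f x \<partial>lborel) = ennreal (c ^ DIM('a)) * (\<integral>\<^sup>+x. f (c *\<^sub>R x) \<partial>lborel)"
  using c by (subst lborel_affine[of c 0])
    (simp_all add: nn_integral_density nn_integral_distr nn_integral_cmult)

lemma lborel_Fubini':
  fixes f :: "'a::euclidean_space \<Rightarrow> 'b::euclidean_space \<Rightarrow> ennreal"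
  assumes "case_prod f \<in> borel_measurable (borel \<Otimes>\<^sub>M borel)"
  shows "(\<integral>\<^sup>+y. (\<integral>\<^sup>+x. f x y \<partial>lborel) \<partial>lborel) = (\<integral>\<^sup>+x. (\<integral>\<^sup>+y. f x y \<partial>lborel) \<partial>lborel)"
proof -
  have "case_prod f \<in> borel_measurable (lborel \<Otimes>\<^sub>M lborel)"
    using assms by (simp add: measurable_cong_sets[OF sets_pair_measure_cong[OF sets_lborel sets_lborel] refl])
  then show ?thesis by (rule lborel_pair.Fubini')
qed

text \<open>Polar coordinates without a surface measure: the direction is sampled from the unit ball.
  The weight \<open>m |x|\<^sup>m / l\<^bsup>m+1\<^esup>\<close> on \<open>l \<ge> |x|\<close> integrates to one, and rescaling by \<open>l\<close> moves \<open>x\<close> into the ball.\<close>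
lemma nn_integral_polar:
  fixes F :: "'a::euclidean_space \<Rightarrow> ennreal"
  assumes [measurable]: "F \<in> borel_measurable borel"
  defines "m \<equiv> DIM('a)"
  shows "(\<integral>\<^sup>+x. F x \<partial>lborel) =
    (\<integral>\<^sup>+y. (\<integral>\<^sup>+r. ennreal (real m * r ^ (m - 1)) * F ((r / norm y) *\<^sub>R y) * indicator {0<..} r \<partial>lborel)
        * indicator (cball 0 1) y \<partial>lborel)"
proof -
  have m: "m > 0" by (simp add: m_def)
  have [measurable]: "cball (0::'a) l \<in> sets borel" for l by simp
  have AE0: "AE x in lborel. x \<noteq> (0::'a)" by (rule AE_lborel_singleton)
  let ?w = "\<lambda>l. ennreal (real m / l ^ (m + 1))"
  let ?N = "\<lambda>x::'a. ennreal (norm x ^ m)"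
  have one: "?N x * (\<integral>\<^sup>+l. ?w l * indicator {norm x..} l \<partial>lborel) = 1" if "x \<noteq> 0" for x :: 'a
  proof -
    have "(\<integral>\<^sup>+l. ?w l * indicator {norm x..} l \<partial>lborel) = ennreal (0 - (- (1 / norm x ^ m)))"
    proof (rule nn_integral_FTC_atLeast)
      fix l assume "norm x \<le> l"
      with that have l: "l > 0" by (smt (verit) zero_less_norm_iff)
      have "((\<lambda>l. - inverse (l ^ m)) has_real_derivative
          - (- (inverse (l ^ m) * (real m * (1 * l ^ (m - Suc 0))) * inverse (l ^ m)))) (at l)"
        using l by (intro DERIV_minus DERIV_inverse_fun[THEN DERIV_cong] DERIV_power DERIV_ident)
          (auto simp: mult_ac)
      moreover have "- (- (inverse (l ^ m) * (real m * (1 * l ^ (m - Suc 0))) * inverse (l ^ m))) = real m / l ^ (m + 1)"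
        using l m by (cases m) (simp_all add: field_simps)
      ultimately show "((\<lambda>l. - (1 / l ^ m)) has_real_derivative real m / l ^ (m + 1)) (at l)"
        by (simp only: inverse_eq_divide)
      show "0 \<le> real m / l ^ (m + 1)" using l by simp
    next
      have "filterlim (\<lambda>l::real. l ^ m) at_top at_top"
        using m by (intro filterlim_pow_at_top filterlim_ident)
      then have "((\<lambda>l::real. - (1 / l ^ m)) \<longlongrightarrow> - 0) at_top"
        by (intro tendsto_minus real_tendsto_divide_at_top[OF tendsto_const])
      then show "((\<lambda>l::real. - (1 / l ^ m)) \<longlongrightarrow> 0) at_top" by simp
    qed simp
    then show ?thesis
      using that by (simp add: ennreal_mult'[symmetric])
  qed
  \<comment> \<open>For x different from 0 the factor \<open>indicator {0<..} l\<close> leaves the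
    integral unchanged. Once the order of integration is exchanged, it confines l to values by which
    x can be rescaled.\<close>
  have "(\<integral>\<^sup>+x. F x \<partial>lborel) =
     (\<integral>\<^sup>+x. (\<integral>\<^sup>+l. F x * ?N x * (?w l * indicator {norm x..} l) * indicator {0<..} l \<partial>lborel) \<partial>lborel)"
  proof (rule nn_integral_cong_AE, use AE0 in eventually_elim)
    case (elim x)
    have "(\<integral>\<^sup>+l. F x * ?N x * (?w l * indicator {norm x..} l) * indicator {0<..} l \<partial>lborel)
        = (\<integral>\<^sup>+l. F x * ?N x * (?w l * indicator {norm x..} l) \<partial>lborel)"
    proof (rule nn_integral_cong)
      fix l :: real
      show "F x * ?N x * (?w l * indicator {norm x..} l) * indicator {0<..} l
         = F x * ?N x * (?w l * indicator {norm x..} l)"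
        using elim by (cases "norm x \<le> l") (auto simp: indicator_def less_le_trans[of 0 "norm x" l])
    qed
    also have "\<dots> = F x * (?N x * (\<integral>\<^sup>+l. ?w l * indicator {norm x..} l \<partial>lborel))"
      by (subst nn_integral_cmult) (auto simp: mult.assoc)
    finally show ?case by (simp only: one[OF elim] mult_1_right)
  qed
  also have "\<dots> = (\<integral>\<^sup>+l. (\<integral>\<^sup>+x. F x * ?N x * (?w l * indicator {norm x..} l) * indicator {0<..} l \<partial>lborel) \<partial>lborel)"
  proof (rule lborel_Fubini'[symmetric])
    have "(\<lambda>(x::'a, l). F x * ?N x * (?w l * (if norm x \<le> l then 1 else 0)) * indicator {0<..} l)
        \<in> borel_measurable (borel \<Otimes>\<^sub>M borel)"
      by measurable
    then show "(\<lambda>(x::'a, l). F x * ?N x * (?w l * indicator {norm x..} l) * indicator {0<..} l)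
        \<in> borel_measurable (borel \<Otimes>\<^sub>M borel)"
      by (simp add: indicator_def)
  qed
  also have "\<dots> = (\<integral>\<^sup>+l. (\<integral>\<^sup>+y. ennreal (real m * l ^ (m - 1)) * F (l *\<^sub>R y) * ?N y
       * indicator (cball 0 1) y * indicator {0<..} l \<partial>lborel) \<partial>lborel)"
  proof (rule nn_integral_cong)
    fix l :: real
    show "(\<integral>\<^sup>+x. F x * ?N x * (?w l * indicator {norm x..} l) * indicator {0<..} l \<partial>lborel)
       = (\<integral>\<^sup>+y. ennreal (real m * l ^ (m - 1)) * F (l *\<^sub>R y) * ?N y
           * indicator (cball 0 1) y * indicator {0<..} l \<partial>lborel)"
    proof (cases "l > 0")
      case True
      have "(\<integral>\<^sup>+x. F x * ?N x * (?w l * indicator {norm x..} l) * indicator {0<..} l \<partial>lborel)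
         = (\<integral>\<^sup>+x. F x * ?N x * (?w l * indicator (cball 0 l) x) \<partial>lborel)"
        using True by (intro nn_integral_cong) (auto simp: indicator_def)
      also have "\<dots> = ennreal (l ^ m) * (\<integral>\<^sup>+y. F (l *\<^sub>R y) * ?N (l *\<^sub>R y) * (?w l * indicator (cball 0 l) (l *\<^sub>R y)) \<partial>lborel)"
        unfolding m_def[symmetric] using True by (subst nn_integral_lborel_scaleR[of _ l]) (measurable, simp add: m_def)
      also have "\<dots> = (\<integral>\<^sup>+y. ennreal (l ^ m) * (F (l *\<^sub>R y) * ?N (l *\<^sub>R y) * (?w l * indicator (cball 0 l) (l *\<^sub>R y))) \<partial>lborel)"
        by (subst nn_integral_cmult) auto
      also have "\<dots> = (\<integral>\<^sup>+y. ennreal (real m * l ^ (m - 1)) * F (l *\<^sub>R y) * ?N y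
           * indicator (cball 0 1) y * indicator {0<..} l \<partial>lborel)"
      proof (rule nn_integral_cong)
        fix y :: 'a
        have 1: "ennreal (l ^ m) * (?N (l *\<^sub>R y) * ?w l) = ennreal (real m * l ^ (m - 1)) * ?N y"
        proof -
          have "l ^ m * (norm (l *\<^sub>R y) ^ m * (real m / l ^ (m + 1))) = real m * l ^ (m - 1) * norm y ^ m"
            using True m by (cases m) (simp_all add: power_mult_distrib field_simps)
          then show ?thesis using True
            by (simp add: ennreal_mult'[symmetric] ennreal_mult''[symmetric] del: norm_scaleR)
        qed
        have 2: "indicator (cball 0 l) (l *\<^sub>R y) = (indicator (cball 0 1) y :: ennreal)"
          using True by (auto simp: indicator_def)
        have "ennreal (l ^ m) * (F (l *\<^sub>R y) * ?N (l *\<^sub>R y) * (?w l * indicator (cball 0 l) (l *\<^sub>R y)))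
           = (ennreal (l ^ m) * (?N (l *\<^sub>R y) * ?w l)) * F (l *\<^sub>R y) * indicator (cball 0 l) (l *\<^sub>R y)"
          by (simp only: ac_simps)
        also have "\<dots> = ennreal (real m * l ^ (m - 1)) * F (l *\<^sub>R y) * ?N y
           * indicator (cball 0 1) y * indicator {0<..} l"
          unfolding 1 2 using True by (simp add: ac_simps)
        finally show "ennreal (l ^ m) * (F (l *\<^sub>R y) * ?N (l *\<^sub>R y) * (?w l * indicator (cball 0 l) (l *\<^sub>R y)))
           = ennreal (real m * l ^ (m - 1)) * F (l *\<^sub>R y) * ?N y
           * indicator (cball 0 1) y * indicator {0<..} l" .
      qed
      finally show ?thesis .
    qed simp
  qed
  also have "\<dots> = (\<integral>\<^sup>+y. (\<integral>\<^sup>+l. ennreal (real m * l ^ (m - 1)) * F (l *\<^sub>R y) * ?N y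
       * indicator (cball 0 1) y * indicator {0<..} l \<partial>lborel) \<partial>lborel)"
    by (rule lborel_Fubini'[symmetric]) measurable
  \<comment> \<open>On the ray through y the radius is r = l |y|, and all powers of |y| cancel: 1 /
    |y| from the substitution, |y|^(1-m) from the power of l, and the weight |y|^m.\<close>
  also have "\<dots> = (\<integral>\<^sup>+y. (\<integral>\<^sup>+r. ennreal (real m * r ^ (m - 1)) * F ((r / norm y) *\<^sub>R y) * indicator {0<..} r \<partial>lborel)
        * indicator (cball 0 1) y \<partial>lborel)"
  proof (rule nn_integral_cong_AE, use AE0 in eventually_elim)
    case (elim y)
    have c: "1 / norm y > 0" using elim by simp
    have "(\<integral>\<^sup>+l. ennreal (real m * l ^ (m - 1)) * F (l *\<^sub>R y) * ?N y
       * indicator (cball 0 1) y * indicator {0<..} l \<partial>lborel)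
      = ennreal \<bar>1 / norm y\<bar> * (\<integral>\<^sup>+r. ennreal (real m * (0 + 1 / norm y * r) ^ (m - 1)) * F ((0 + 1 / norm y * r) *\<^sub>R y) * ?N y
       * indicator (cball 0 1) y * indicator {0<..} (0 + 1 / norm y * r) \<partial>lborel)"
      using c by (intro nn_integral_real_affine) auto
    also have "\<dots> = (\<integral>\<^sup>+r. ennreal \<bar>1 / norm y\<bar> * (ennreal (real m * (0 + 1 / norm y * r) ^ (m - 1)) * F ((0 + 1 / norm y * r) *\<^sub>R y) * ?N y
       * indicator (cball 0 1) y * indicator {0<..} (0 + 1 / norm y * r)) \<partial>lborel)"
      by (subst nn_integral_cmult) auto
    also have "\<dots> = (\<integral>\<^sup>+r. ennreal (real m * r ^ (m - 1)) * F ((r / norm y) *\<^sub>R y) * indicator {0<..} r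
        * indicator (cball 0 1) y \<partial>lborel)"
    proof (rule nn_integral_cong)
      fix r :: real
      show "ennreal \<bar>1 / norm y\<bar> * (ennreal (real m * (0 + 1 / norm y * r) ^ (m - 1)) * F ((0 + 1 / norm y * r) *\<^sub>R y) * ?N y
           * indicator (cball 0 1) y * indicator {0<..} (0 + 1 / norm y * r))
         = ennreal (real m * r ^ (m - 1)) * F ((r / norm y) *\<^sub>R y) * indicator {0<..} r * indicator (cball 0 1) y"
      proof (cases "r > 0")
        case True
        have "1 / norm y * (real m * (r / norm y) ^ (m - 1) * norm y ^ m) = real m * r ^ (m - 1)"
          using elim m by (cases m) (simp_all add: power_divide field_simps)
        then have "ennreal \<bar>1 / norm y\<bar> * (ennreal (real m * (r / norm y) ^ (m - 1)) * ?N y) = ennreal (real m * r ^ (m - 1))"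
          using True c by (simp add: ennreal_mult'[symmetric] ennreal_mult''[symmetric])
        then have "ennreal \<bar>1 / norm y\<bar> * (ennreal (real m * (r / norm y) ^ (m - 1)) * ?N y) * (F ((r / norm y) *\<^sub>R y)  * indicator (cball 0 1) y)
           = ennreal (real m * r ^ (m - 1)) * (F ((r / norm y) *\<^sub>R y)  * indicator (cball 0 1) y)" by simp
        then show ?thesis using True elim by (simp add: ac_simps)
      next
        case False
        then show ?thesis using elim by (simp add: zero_less_divide_iff)
      qed
    qed
    also have "\<dots> = (\<integral>\<^sup>+r. ennreal (real m * r ^ (m - 1)) * F ((r / norm y) *\<^sub>R y) * indicator {0<..} r \<partial>lborel)
        * indicator (cball 0 1) y"
      by (subst nn_integral_multc) auto
    finally show ?case .
  qed
  finally show ?thesis .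
qed

lemma nn_integral_polar_component:
  fixes f :: "real \<Rightarrow> real \<Rightarrow> ennreal" and i :: "'n::finite"
  assumes f [measurable]: "case_prod f \<in> borel_measurable (borel \<Otimes>\<^sub>M borel)"
  shows "(\<integral>\<^sup>+x. f (norm x) (x $ i / norm x) \<partial>(lborel :: (real ^ 'n) measure)) =
    (\<integral>\<^sup>+y. (\<integral>\<^sup>+r. ennreal (real CARD('n) * r ^ (CARD('n) - 1)) * f r (y $ i / norm y) * indicator {0<..} r \<partial>lborel)
        * indicator (cball 0 1) y \<partial>(lborel :: (real ^ 'n) measure))"
proof -
  have [measurable]: "(\<lambda>x::real^'n. x $ i) \<in> borel_measurable borel"
    by (intro borel_measurable_continuous_onI continuous_intros)
  have *: "(\<lambda>x::real^'n. f (norm x) (x $ i / norm x)) \<in> borel_measurable borel"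
    using measurable_compose[OF _ f, of "\<lambda>x::real^'n. (norm x, x $ i / norm x)" borel] by simp
  show ?thesis
    unfolding nn_integral_polar[OF *]
  proof (rule nn_integral_cong_AE, rule eventually_mono[OF AE_lborel_singleton[of 0]])
    fix y :: "real ^ 'n" assume y: "y \<noteq> 0"
    have "(\<integral>\<^sup>+r. ennreal (real DIM(real ^ 'n) * r ^ (DIM(real ^ 'n) - 1)) *
          f (norm ((r / norm y) *\<^sub>R y)) (((r / norm y) *\<^sub>R y) $ i / norm ((r / norm y) *\<^sub>R y)) * indicator {0<..} r \<partial>lborel)
        = (\<integral>\<^sup>+r. ennreal (real CARD('n) * r ^ (CARD('n) - 1)) * f r (y $ i / norm y) * indicator {0<..} r \<partial>lborel)"
      by (intro nn_integral_cong) (use y in \<open>auto simp: indicator_def\<close>)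
    then show "(\<integral>\<^sup>+r. ennreal (real DIM(real ^ 'n) * r ^ (DIM(real ^ 'n) - 1)) *
          f (norm ((r / norm y) *\<^sub>R y)) (((r / norm y) *\<^sub>R y) $ i / norm ((r / norm y) *\<^sub>R y)) * indicator {0<..} r \<partial>lborel)
          * indicator (cball 0 1) y
        = (\<integral>\<^sup>+r. ennreal (real CARD('n) * r ^ (CARD('n) - 1)) * f r (y $ i / norm y) * indicator {0<..} r \<partial>lborel)
          * indicator (cball 0 1) y" by simp
  qed
qed

section \<open>Tail integrals of the direction cosine over the ball\<close>

definition dir_cos :: "'n::finite \<Rightarrow> real ^ 'n \<Rightarrow> real" where
  "dir_cos i y = y $ i / norm y"

lemma dir_cos_le_1: "dir_cos i y \<le> 1"
  using component_le_norm_cart[of y i] by (cases "y = 0") (auto simp: dir_cos_def divide_le_eq)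

lemma measurable_component [measurable]: "(\<lambda>x::real^'n. x $ i) \<in> borel_measurable borel"
  by (intro borel_measurable_continuous_onI continuous_intros)

lemma measurable_dir_cos [measurable]: "dir_cos i \<in> borel_measurable borel"
  unfolding dir_cos_def[abs_def] by measurable

text \<open>The cone is cut off by the plane x_i = 1 and not by a sphere, because stretching
  perpendicular to the axis preserves this cut.\<close>

definition cone_slab :: "'n::finite \<Rightarrow> real \<Rightarrow> (real ^ 'n) set" where
  "cone_slab i q = {x. 0 < x $ i \<and> x $ i < 1 \<and> q * norm x < x $ i}"

lemma cone_slab_sets [measurable]: "cone_slab i q \<in> sets borel"
  unfolding cone_slab_def by measurable

lemma cone_slab_finite:
  assumes "0 < q"
  shows "emeasure lborel (cone_slab i q) < \<infinity>"
proof (rule emeasure_bounded_finite)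
  have "cone_slab i q \<subseteq> ball 0 (1 / q)"
    using assms by (auto simp: cone_slab_def field_simps)
  then show "bounded (cone_slab i q)" using bounded_ball bounded_subset by blast
qed

text \<open>Stretching the coordinates perpendicular to the axis maps these cones onto one another.\<close>
lemma emeasure_cone_slab_stretch:
  fixes i :: "'n::finite"
  assumes q: "0 < q" "q < 1"
  shows "emeasure lborel (cone_slab i q) =
    ennreal (sqrt (1 / q\<^sup>2 - 1) ^ (CARD('n) - 1)) * emeasure lborel (cone_slab i (1 / sqrt 2))"
proof -
  \<comment> \<open>The cone consists of the points whose distance from the axis is less than l x_i,
    so l is the tangent of its half-angle. The reference cone with q = 1 / sqrt 2 has l = 1.\<close>
  define l where "l = sqrt (1 / q\<^sup>2 - 1)"
  have "q\<^sup>2 < 1" using q by (simp add: power_less_one_iff)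
  then have l: "l > 0" "q\<^sup>2 * l\<^sup>2 = 1 - q\<^sup>2"
    using q by (auto simp: l_def field_simps)
  let ?e = "axis i 1 :: real ^ 'n"
  define c where "c = (\<lambda>b. if b = ?e then 1 else l)"
  let ?S = "\<lambda>x::real^'n. 0 + (\<Sum>j\<in>Basis. (c j * (x \<bullet> j)) *\<^sub>R j)"
  have e: "?e \<in> Basis" by (simp add: axis_in_Basis_iff)
  have S_inner: "?S x \<bullet> b = c b * (x \<bullet> b)" if "b \<in> Basis" for x b
    using that by simp
  have S_i: "?S x $ i = x $ i" for x
    using S_inner[OF e, of x] by (simp add: c_def inner_axis)
  have S_norm: "(norm (?S x))\<^sup>2 = (x $ i)\<^sup>2 + l\<^sup>2 * ((norm x)\<^sup>2 - (x $ i)\<^sup>2)" for x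
  proof -
    have sum_split: "(norm z)\<^sup>2 = (z $ i)\<^sup>2 + (\<Sum>b\<in>Basis - {?e}. (z \<bullet> b)\<^sup>2)" for z :: "real ^ 'n"
      unfolding power2_norm_eq_inner euclidean_inner[of z z]
      by (subst sum.remove[OF _ e]) (auto simp: inner_axis power2_eq_square)
    have "(\<Sum>b\<in>Basis - {?e}. (?S x \<bullet> b)\<^sup>2) = (\<Sum>b\<in>Basis - {?e}. l\<^sup>2 * (x \<bullet> b)\<^sup>2)"
    proof (rule sum.cong[OF refl])
      fix b assume "b \<in> Basis - {?e}"
      then have b: "b \<in> Basis" "b \<noteq> ?e" by auto
      show "(?S x \<bullet> b)\<^sup>2 = l\<^sup>2 * (x \<bullet> b)\<^sup>2"
        unfolding S_inner[OF b(1)] using b(2) by (simp add: c_def power_mult_distrib)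
    qed
    then show ?thesis
      unfolding sum_split[of "?S x"] sum_split[of x] S_i by (simp add: sum_distrib_left)
  qed
  have mem: "?S x \<in> cone_slab i q \<longleftrightarrow> x \<in> cone_slab i (1 / sqrt 2)" for x
  proof -
    have sq: "r * norm z < t \<longleftrightarrow> r\<^sup>2 * (norm z)\<^sup>2 < t\<^sup>2" if "t > 0" "r > 0" for r t and z :: "real ^ 'n"
    proof -
      have "r * norm z < t \<longleftrightarrow> (r * norm z)\<^sup>2 < t\<^sup>2"
        using that by (metis norm_ge_zero less_imp_le mult_nonneg_nonneg power2_less_imp_less power_strict_mono zero_less_numeral)
      then show ?thesis by (simp add: power_mult_distrib)
    qed
    have "q\<^sup>2 * ((x $ i)\<^sup>2 + l\<^sup>2 * ((norm x)\<^sup>2 - (x $ i)\<^sup>2)) < (x $ i)\<^sup>2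
       \<longleftrightarrow> q\<^sup>2 * (x $ i)\<^sup>2 + (q\<^sup>2 * l\<^sup>2) * ((norm x)\<^sup>2 - (x $ i)\<^sup>2) < (x $ i)\<^sup>2"
      by (simp add: algebra_simps)
    also have "\<dots> \<longleftrightarrow> (1 - q\<^sup>2) * (norm x)\<^sup>2 < (1 - q\<^sup>2) * (2 * (x $ i)\<^sup>2)"
      unfolding l(2) by (simp add: algebra_simps)
    also have "\<dots> \<longleftrightarrow> (norm x)\<^sup>2 < 2 * (x $ i)\<^sup>2"
      using \<open>q\<^sup>2 < 1\<close> by simp
    also have "\<dots> \<longleftrightarrow> (1 / sqrt 2)\<^sup>2 * (norm x)\<^sup>2 < (x $ i)\<^sup>2"
      by (simp add: power_divide field_simps)
    finally have "q\<^sup>2 * (norm (?S x))\<^sup>2 < (x $ i)\<^sup>2 \<longleftrightarrow> (1 / sqrt 2)\<^sup>2 * (norm x)\<^sup>2 < (x $ i)\<^sup>2"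
      by (simp only: S_norm)
    then show ?thesis
      unfolding cone_slab_def mem_Collect_eq S_i
      using sq[of "x $ i" q "?S x"] sq[of "x $ i" "1 / sqrt 2" x] q(1) by auto
  qed
  have P: "(\<Prod>j\<in>Basis. \<bar>c j\<bar>) = l ^ (CARD('n) - 1)"
  proof -
    have "(\<Prod>j\<in>Basis. \<bar>c j\<bar>) = \<bar>c ?e\<bar> * (\<Prod>j\<in>Basis - {?e}. \<bar>c j\<bar>)"
      by (rule prod.remove[OF _ e]) simp
    also have "(\<Prod>j\<in>Basis - {?e}. \<bar>c j\<bar>) = (\<Prod>j\<in>Basis - {?e}. l)"
      using l by (intro prod.cong) (auto simp: c_def)
    also have "\<dots> = l ^ (CARD('n) - 1)"
      using e by (simp add: card_Diff_singleton)
    finally show ?thesis by (simp add: c_def)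
  qed
  have [measurable]: "?S \<in> borel_measurable borel" by measurable
  have "lborel = density (distr lborel borel ?S) (\<lambda>_. ennreal (\<Prod>j\<in>Basis. \<bar>c j\<bar>))"
    using l by (intro lborel_affine_euclidean) (auto simp: c_def)
  then have "emeasure lborel (cone_slab i q)
    = emeasure (density (distr lborel borel ?S) (\<lambda>_. ennreal (l ^ (CARD('n) - 1)))) (cone_slab i q)"
    unfolding P by (rule arg_cong)
  also have "\<dots> = ennreal (l ^ (CARD('n) - 1)) * emeasure (distr lborel borel ?S) (cone_slab i q)"
    by (simp add: emeasure_density nn_integral_cmult)
  also have "emeasure (distr lborel borel ?S) (cone_slab i q) = emeasure lborel (cone_slab i (1 / sqrt 2))"
  proof -
    have "?S -` cone_slab i q \<inter> space lborel = cone_slab i (1 / sqrt 2)"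
      by (rule set_eqI) (simp only: vimage_eq Int_iff space_lborel space_borel UNIV_I mem simp_thms)
    moreover have "?S \<in> lborel \<rightarrow>\<^sub>M borel" by measurable
    ultimately show ?thesis using emeasure_distr[of ?S lborel borel, OF _ cone_slab_sets] by (simp only:)
  qed
  finally show ?thesis by (simp add: l_def)
qed

text \<open>A layer-cake exchange: a function of the direction cosine that is written as an integral
  over thresholds \<open>g s\<close> below it gets integrated over the ball through tails. The
  angular integrals below are reduced to tails in this way.\<close>

lemma nn_integral_ball_tail_Fubini:
  fixes i :: "'n::finite" and w h :: "real \<Rightarrow> ennreal" and g :: "real \<Rightarrow> real"
  assumes [measurable]: "w \<in> borel_measurable borel" "h \<in> borel_measurable borel" "g \<in> borel_measurable borel"
  shows "(\<integral>\<^sup>+y. w (dir_cos i y) * indicator (cball 0 1) y * (\<integral>\<^sup>+s. h s * indicator {g s<..} (dir_cos i y) \<partial>lborel) \<partial>lborel)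
    = (\<integral>\<^sup>+s. h s * (\<integral>\<^sup>+y. w (dir_cos i y) * indicator {g s<..} (dir_cos i y) * indicator (cball 0 1) y \<partial>lborel) \<partial>lborel)"
proof -
  have [measurable]: "cball (0::real^'n) 1 \<in> sets borel" by simp
  have [measurable]: "(\<lambda>s. indicator {g s<..} t :: ennreal) \<in> borel_measurable borel" for t
  proof -
    have "(\<lambda>s. if g s < t then 1 else 0 :: ennreal) \<in> borel_measurable borel" by measurable
    then show ?thesis by (simp add: indicator_def)
  qed
  have "(\<integral>\<^sup>+y. w (dir_cos i y) * indicator (cball 0 1) y * (\<integral>\<^sup>+s. h s * indicator {g s<..} (dir_cos i y) \<partial>lborel) \<partial>lborel)
     = (\<integral>\<^sup>+y. (\<integral>\<^sup>+s. w (dir_cos i y) * indicator (cball 0 1) y * (h s * indicator {g s<..} (dir_cos i y)) \<partial>lborel) \<partial>lborel)"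
    by (intro nn_integral_cong nn_integral_cmult[symmetric]) measurable
  also have "\<dots> = (\<integral>\<^sup>+s. (\<integral>\<^sup>+y. w (dir_cos i y) * indicator (cball 0 1) y * (h s * indicator {g s<..} (dir_cos i y)) \<partial>lborel) \<partial>lborel)"
  proof (rule lborel_Fubini'[symmetric])
    have "(\<lambda>(y, s). w (dir_cos i y) * indicator (cball 0 1) y * (h s * (if g s < dir_cos i y then 1 else 0)))
      \<in> borel_measurable (borel \<Otimes>\<^sub>M borel)" by measurable
    then show "(\<lambda>(y, s). w (dir_cos i y) * indicator (cball 0 1) y * (h s * indicator {g s<..} (dir_cos i y)))
      \<in> borel_measurable (borel \<Otimes>\<^sub>M borel)" by (simp add: indicator_def)
  qed
  also have "\<dots> = (\<integral>\<^sup>+s. (\<integral>\<^sup>+y. h s * (w (dir_cos i y) * indicator {g s<..} (dir_cos i y) * indicator (cball 0 1) y) \<partial>lborel) \<partial>lborel)"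
    by (simp only: ac_simps)
  also have "\<dots> = (\<integral>\<^sup>+s. h s * (\<integral>\<^sup>+y. w (dir_cos i y) * indicator {g s<..} (dir_cos i y) * indicator (cball 0 1) y \<partial>lborel) \<partial>lborel)"
    by (intro nn_integral_cong nn_integral_cmult) measurable
  finally show ?thesis .
qed

text \<open>A ray of direction cosine t > q stays in the truncated cone for 0 < r < 1 / t, and n
  r^(n-1) integrates to t^(-n) there. Rays with t \<le> q miss the cone.\<close>

lemma power_tail_cone_slab:
  fixes i :: "'n::finite"
  assumes q: "0 < q"
  shows "(\<integral>\<^sup>+y. ennreal (1 / dir_cos i y ^ CARD('n)) * indicator {q<..} (dir_cos i y) * indicator (cball 0 1) y \<partial>lborel)
    = emeasure lborel (cone_slab i q)"
proof -
  let ?n = "CARD('n)"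
  have n: "?n \<ge> 1" by (simp add: Suc_leI)
  let ?f = "\<lambda>r t::real. indicator {q<..} t * (if r * t < 1 then 1 else 0) :: ennreal"
  have "emeasure lborel (cone_slab i q) = (\<integral>\<^sup>+x. indicator (cone_slab i q) x \<partial>lborel)"
    by (simp add: cone_slab_sets)
  also have "\<dots> = (\<integral>\<^sup>+x. ?f (norm x) (x $ i / norm x) \<partial>lborel)"
  proof (rule nn_integral_cong)
    fix x :: "real ^ 'n"
    show "indicator (cone_slab i q) x = ?f (norm x) (x $ i / norm x)"
    proof (cases "x = 0")
      case False
      have "q * norm x < x $ i \<Longrightarrow> 0 < x $ i"
        using q False by (smt (verit) mult_pos_pos zero_less_norm_iff)
      then show ?thesis
        using False q by (auto simp: cone_slab_def indicator_def less_divide_eq)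
    qed (use q in \<open>simp add: cone_slab_def\<close>)
  qed
  also have "\<dots> = (\<integral>\<^sup>+y. (\<integral>\<^sup>+r. ennreal (real ?n * r ^ (?n - 1)) * ?f r (y $ i / norm y) * indicator {0<..} r \<partial>lborel)
        * indicator (cball 0 1) y \<partial>(lborel :: (real ^ 'n) measure))"
    by (rule nn_integral_polar_component) measurable
  also have "\<dots> = (\<integral>\<^sup>+y. ennreal (1 / dir_cos i y ^ ?n) * indicator {q<..} (dir_cos i y) * indicator (cball 0 1) y \<partial>lborel)"
  proof (rule nn_integral_cong)
    fix y :: "real ^ 'n"
    define t where "t = dir_cos i y"
    have "(\<integral>\<^sup>+r. ennreal (real ?n * r ^ (?n - 1)) * ?f r t * indicator {0<..} r \<partial>lborel)
        = ennreal (1 / t ^ ?n) * indicator {q<..} t"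
    proof (cases "q < t")
      case True
      then have t: "t > 0" using q by simp
      have "(\<integral>\<^sup>+r. ennreal (real ?n * r ^ (?n - 1)) * ?f r t * indicator {0<..} r \<partial>lborel)
         = (\<integral>\<^sup>+r. ennreal (real ?n * r ^ (?n - 1)) * indicator {0<..<1/t} r \<partial>lborel)"
        using True t by (intro nn_integral_cong) (auto simp: indicator_def field_simps)
      also have "\<dots> = ennreal ((1 / t) ^ ?n - 0 ^ ?n)"
      proof (rule nn_integral_FTC_Ioo)
        show "((\<lambda>r. r ^ ?n) has_real_derivative real ?n * r ^ (?n - 1)) (at r)" for r :: real
          by (auto intro!: derivative_eq_intros)
      qed (use t in \<open>auto intro!: continuous_intros\<close>)
      finally show ?thesis using True n by (simp add: power_divide zero_power)
    qed simp
    then show "(\<integral>\<^sup>+r. ennreal (real ?n * r ^ (?n - 1)) * ?f r (y $ i / norm y) * indicator {0<..} r \<partial>lborel)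
        * indicator (cball 0 1) y = ennreal (1 / dir_cos i y ^ ?n) * indicator {q<..} (dir_cos i y) * indicator (cball 0 1) y"
      by (simp only: t_def dir_cos_def)
  qed
  finally show ?thesis ..
qed

lemma half_ball:
  fixes i :: "'n::finite"
  shows "(\<integral>\<^sup>+y. indicator {0<..} (dir_cos i y) * indicator (cball 0 1) y \<partial>(lborel :: (real ^ 'n) measure))
    = ennreal (unit_ball_vol (real CARD('n)) / 2)" (is "?H = _")
proof -
  have [measurable]: "cball (0::real^'n) 1 \<in> sets borel" by simp
  have "?H = (\<integral>\<^sup>+y. indicator {0<..} (dir_cos i (- y)) * indicator (cball 0 1) (- y) \<partial>(lborel :: (real ^ 'n) measure))"
    by (subst lborel_affine[of "-1" 0]) (simp_all add: nn_integral_density nn_integral_distr)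
  also have "\<dots> = (\<integral>\<^sup>+y. indicator {..<0} (dir_cos i y) * indicator (cball 0 1) y \<partial>(lborel :: (real ^ 'n) measure))"
    by (intro nn_integral_cong) (auto simp: indicator_def dir_cos_def)
  finally have refl: "?H = \<dots>" .
  have "{x::real^'n. x $ i = 0} \<in> null_sets lborel"
  proof -
    have "negligible {x::real^'n. x \<bullet> axis i 1 = 0}"
      by (rule negligible_standard_hyperplane) (simp add: axis_in_Basis_iff)
    then have "{x::real^'n. x $ i = 0} \<in> null_sets lebesgue"
      by (simp add: negligible_iff_null_sets inner_axis)
    moreover have "{x::real^'n. x $ i = 0} \<in> sets lborel" by measurable
    ultimately show ?thesis by (simp add: null_sets_completion_iff)
  qed
  then have AE: "AE x in lborel. (x::real^'n) $ i \<noteq> 0"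
    by (rule AE_I') auto
  have "?H + ?H = (\<integral>\<^sup>+y. indicator {0<..} (dir_cos i y) * indicator (cball 0 1) y
      + indicator {..<0} (dir_cos i y) * indicator (cball 0 1) y \<partial>(lborel :: (real ^ 'n) measure))"
    by (subst (2) refl, subst nn_integral_add) auto
  also have "\<dots> = (\<integral>\<^sup>+y. indicator (cball 0 1) y \<partial>(lborel :: (real ^ 'n) measure))"
    by (rule nn_integral_cong_AE, use AE in eventually_elim)
      (auto simp: indicator_def dir_cos_def divide_less_0_iff zero_less_divide_iff)
  also have "\<dots> = ennreal (unit_ball_vol (real CARD('n)))"
    by (simp add: emeasure_cball)
  finally have sum: "?H + ?H = ennreal (unit_ball_vol (real CARD('n)))" .
  have "H = ennreal (v / 2)" if "H + H = ennreal v" "v \<ge> 0" for H v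
    using that by (cases H) (auto simp flip: ennreal_plus)
  from this[OF sum] show ?thesis by simp
qed

lemma Beta_half_integral:
  "(\<integral>\<^sup>+s. ennreal (sqrt (1 - s\<^sup>2) ^ N) * indicator {0<..<1} s \<partial>lborel)
    = ennreal (Beta (1 / 2) (real N / 2 + 1) / 2)" (is "?I = _")
proof -
  have "?I = (\<integral>\<^sup>+s. ennreal (sqrt (1 - (0 + - 1 * s)\<^sup>2) ^ N) * indicator {0<..<1} (0 + - 1 * s) \<partial>lborel)"
    by (subst nn_integral_real_affine[of _ "-1" 0]) auto
  also have "\<dots> = (\<integral>\<^sup>+s. ennreal (sqrt (1 - s\<^sup>2) ^ N) * indicator {-1<..<0} s \<partial>lborel)"
    by (intro nn_integral_cong) (auto simp: indicator_def)
  finally have refl: "?I = \<dots>" .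
  have "?I + ?I = (\<integral>\<^sup>+s. ennreal (sqrt (1 - s\<^sup>2) ^ N) * indicator {0<..<1} s
      + ennreal (sqrt (1 - s\<^sup>2) ^ N) * indicator {-1<..<0} s \<partial>lborel)"
    by (subst (2) refl, subst nn_integral_add) auto
  also have "\<dots> = (\<integral>\<^sup>+x. ennreal (indicator {-1..1} x * sqrt (1 - x\<^sup>2) ^ N) \<partial>lborel)"
    by (intro nn_integral_cong_AE AE_I[of _ _ "{1, -1, 0}"])
      (auto simp: indicator_def emeasure_lborel_countable)
  also have "\<dots> = ennreal (Beta (1 / 2) (real N / 2 + 1))"
    by (rule emeasure_cball_aux_integral)
  finally have sum: "?I + ?I = ennreal (Beta (1 / 2) (real N / 2 + 1))" .
  have "H = ennreal (v / 2)" if "H + H = ennreal v" "v \<ge> 0" for H v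
    using that by (cases H) (auto simp flip: ennreal_plus)
  from this[OF sum] show ?thesis by (simp add: Beta_def Gamma_real_nonneg)
qed

lemma growth_const_Beta:
  assumes "n \<ge> 1"
  shows "growth_const n = 2 / Beta (1 / 2) (real (n - 1) / 2 + 1)"
proof -
  have 1: "real (n - 1) / 2 + 1 = (real n + 1) / 2" and 2: "1 / 2 + (real n + 1) / 2 = (real n + 2) / 2"
    using assms by (auto simp: of_nat_diff field_simps)
  have G: "Gamma (1 / 2 :: real) = 2 * Gamma (3 / 2)"
  proof -
    have "(1 / 2 :: real) \<notin> \<int>\<^sub>\<le>\<^sub>0" by (auto dest: nonpos_Ints_nonpos)
    from Gamma_plus1[OF this] show ?thesis by simp
  qed
  show ?thesis
    unfolding growth_const_def Beta_def 1 2 G by simp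
qed

text \<open>This equals \<omega>_(n-1) / n, the volume of the cone of height 1 over the unit ball of
  dimension n - 1, which is the reference cone with q = 1 / sqrt 2.\<close>

definition tail_const :: "'n::finite itself \<Rightarrow> real" where
  "tail_const _ = unit_ball_vol (real CARD('n)) * growth_const CARD('n) / (2 * real CARD('n))"

lemma tail_const_nonneg: "tail_const TYPE('n::finite) \<ge> 0"
  unfolding tail_const_def using growth_const_pos[of "CARD('n)"] by simp

lemma power_times_sqrt_tail:
  assumes "0 < s" "s < (1::real)"
  shows "s ^ N * sqrt (1 / s\<^sup>2 - 1) ^ N = sqrt (1 - s\<^sup>2) ^ N"
proof -
  have "s * sqrt (1 / s\<^sup>2 - 1) = sqrt (1 - s\<^sup>2)"
    using assms by (simp add: real_sqrt_divide diff_divide_distrib[symmetric] field_simps flip: real_sqrt_mult)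
  then show ?thesis by (metis power_mult_distrib)
qed

text \<open>Stretching fixes the dependence on q up to the volume K of the reference cone. To find
  K, the half ball {t > 0} is expressed through all these tails, which yields a Beta
  integral.\<close>

lemma power_tail_value:
  fixes i :: "'n::finite"
  assumes q: "0 < q" "q < 1"
  shows "(\<integral>\<^sup>+y. ennreal (1 / dir_cos i y ^ CARD('n)) * indicator {q<..} (dir_cos i y) * indicator (cball 0 1) y \<partial>lborel)
    = ennreal (tail_const TYPE('n) * sqrt (1 / q\<^sup>2 - 1) ^ (CARD('n) - 1))"
proof -
  let ?n = "CARD('n)"
  have n: "?n \<ge> 1" by (simp add: Suc_leI)
  have [measurable]: "cball (0::real^'n) 1 \<in> sets borel" by simp
  define K where "K = measure lborel (cone_slab i (1 / sqrt 2))"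
  have K0: "K \<ge> 0" by (simp add: K_def)
  have K: "emeasure lborel (cone_slab i (1 / sqrt 2)) = ennreal K"
    unfolding K_def using cone_slab_finite[of "1 / sqrt 2" i] by (intro emeasure_eq_ennreal_measure) auto
  have A: "(\<integral>\<^sup>+y. ennreal (1 / dir_cos i y ^ ?n) * indicator {q<..} (dir_cos i y) * indicator (cball 0 1) y \<partial>lborel)
      = ennreal (K * sqrt (1 / q\<^sup>2 - 1) ^ (?n - 1))" if q: "0 < q" "q < 1" for q
    unfolding power_tail_cone_slab[OF q(1)] emeasure_cone_slab_stretch[OF q] K
    using K0 q by (simp add: ennreal_mult''[symmetric] mult.commute power_le_one)
  \<comment> \<open>For 0 < t \<le> 1 the constant 1 is t^(-n) times the integral of n s^(n-1) over
    (0, t), which brings in the tails of t^(-n) at the thresholds s.\<close>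
  have "ennreal (unit_ball_vol (real ?n) / 2)
    = (\<integral>\<^sup>+y. indicator {0<..} (dir_cos i y) * indicator (cball 0 1) y \<partial>(lborel :: (real ^ 'n) measure))"
    by (rule half_ball[symmetric])
  also have "\<dots> = (\<integral>\<^sup>+y. ennreal (1 / dir_cos i y ^ ?n) * indicator (cball 0 1) y
      * (\<integral>\<^sup>+s. ennreal (real ?n * s ^ (?n - 1)) * indicator {0<..<1} s * indicator {s<..} (dir_cos i y) \<partial>lborel) \<partial>lborel)"
  proof (rule nn_integral_cong)
    fix y :: "real ^ 'n"
    define t where "t = dir_cos i y"
    have t1: "t \<le> 1" by (simp add: t_def dir_cos_le_1)
    have "indicator {0<..} t = ennreal (1 / t ^ ?n)
        * (\<integral>\<^sup>+s. ennreal (real ?n * s ^ (?n - 1)) * indicator {0<..<1} s * indicator {s<..} t \<partial>lborel)"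
    proof (cases "t > 0")
      case True
      have "(\<integral>\<^sup>+s. ennreal (real ?n * s ^ (?n - 1)) * indicator {0<..<1} s * indicator {s<..} t \<partial>lborel)
        = (\<integral>\<^sup>+s. ennreal (real ?n * s ^ (?n - 1)) * indicator {0<..<t} s \<partial>lborel)"
        using t1 by (intro nn_integral_cong) (auto simp: indicator_def)
      also have "\<dots> = ennreal (t ^ ?n - 0 ^ ?n)"
      proof (rule nn_integral_FTC_Ioo)
        show "((\<lambda>r. r ^ ?n) has_real_derivative real ?n * r ^ (?n - 1)) (at r)" for r :: real
          by (auto intro!: derivative_eq_intros)
      qed (use True in \<open>auto intro!: continuous_intros\<close>)
      finally show ?thesis using True n by (simp add: zero_power ennreal_mult'[symmetric])
    next
      case False
      then have z: "ennreal (real ?n * s ^ (?n - 1)) * indicator {0<..<1} s * indicator {s<..} t = 0" for s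
        by (auto simp: indicator_def)
      show ?thesis unfolding z using False by simp
    qed
    then show "indicator {0<..} (dir_cos i y) * indicator (cball 0 1) y
       = ennreal (1 / dir_cos i y ^ ?n) * indicator (cball 0 1) y
      * (\<integral>\<^sup>+s. ennreal (real ?n * s ^ (?n - 1)) * indicator {0<..<1} s * indicator {s<..} (dir_cos i y) \<partial>lborel)"
      by (simp add: t_def mult_ac)
  qed
  also have "\<dots> = (\<integral>\<^sup>+s. ennreal (real ?n * s ^ (?n - 1)) * indicator {0<..<1} s
      * (\<integral>\<^sup>+y. ennreal (1 / dir_cos i y ^ ?n) * indicator {s<..} (dir_cos i y) * indicator (cball 0 1) y \<partial>lborel) \<partial>lborel)"
    by (rule nn_integral_ball_tail_Fubini) auto
  also have "\<dots> = (\<integral>\<^sup>+s. ennreal (real ?n * K) * (ennreal (sqrt (1 - s\<^sup>2) ^ (?n - 1)) * indicator {0<..<1} s) \<partial>lborel)"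
  proof (rule nn_integral_cong)
    fix s :: real
    show "ennreal (real ?n * s ^ (?n - 1)) * indicator {0<..<1} s
      * (\<integral>\<^sup>+y. ennreal (1 / dir_cos i y ^ ?n) * indicator {s<..} (dir_cos i y) * indicator (cball 0 1) y \<partial>lborel)
      = ennreal (real ?n * K) * (ennreal (sqrt (1 - s\<^sup>2) ^ (?n - 1)) * indicator {0<..<1} s)"
    proof (cases "s \<in> {0<..<1}")
      case True
      then have s: "0 < s" "s < 1" by auto
      have "real ?n * s ^ (?n - 1) * (K * sqrt (1 / s\<^sup>2 - 1) ^ (?n - 1))
          = real ?n * K * (s ^ (?n - 1) * sqrt (1 / s\<^sup>2 - 1) ^ (?n - 1))" by (simp only: ac_simps)
      then have "real ?n * s ^ (?n - 1) * (K * sqrt (1 / s\<^sup>2 - 1) ^ (?n - 1)) = real ?n * K * sqrt (1 - s\<^sup>2) ^ (?n - 1)"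
        unfolding power_times_sqrt_tail[OF s] .
      then show ?thesis unfolding A[OF s] using True s K0
        by (simp add: ennreal_mult'[symmetric] ennreal_mult''[symmetric] power_le_one)
    qed simp
  qed
  also have "\<dots> = ennreal (real ?n * K) * ennreal (Beta (1 / 2) (real (?n - 1) / 2 + 1) / 2)"
    by (subst nn_integral_cmult) (auto simp: Beta_half_integral)
  finally have eq: "ennreal (unit_ball_vol (real ?n) / 2)
    = ennreal (real ?n * K) * ennreal (Beta (1 / 2) (real (?n - 1) / 2 + 1) / 2)" .
  have B: "Beta (1 / 2) (real (?n - 1) / 2 + 1) > 0"
    unfolding Beta_def
    by (intro divide_pos_pos mult_pos_pos Gamma_real_pos add_nonneg_pos divide_nonneg_nonneg of_nat_0_le_iff) simp_all
  have "unit_ball_vol (real ?n) / 2 = real ?n * K * (Beta (1 / 2) (real (?n - 1) / 2 + 1) / 2)"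
  proof (rule ennreal_inj[THEN iffD1])
    show "ennreal (unit_ball_vol (real ?n) / 2)
       = ennreal (real ?n * K * (Beta (1 / 2) (real (?n - 1) / 2 + 1) / 2))"
      unfolding eq using K0 B by (intro ennreal_mult'[symmetric]) auto
  qed (use K0 B in auto)
  moreover note B
  ultimately have "K = tail_const TYPE('n)"
    unfolding tail_const_def growth_const_Beta[OF n] using n by (simp add: field_simps)
  then show ?thesis using A[OF q] by simp
qed

text \<open>Write t = t^(-n) t^(n+1), where t^(n+1) is q^(n+1) plus the integral of (n + 1) s^n over
  (q, t). This expresses the tail of t through the tails of t^(-n). For n = 1 the result does not
  depend on q, in accordance with |t| = 1 almost everywhere.\<close>

lemma dir_cos_tail_value:
  fixes i :: "'n::finite"
  assumes q: "0 < q" "q < 1"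
  shows "(\<integral>\<^sup>+y. ennreal (dir_cos i y) * indicator {q<..} (dir_cos i y) * indicator (cball 0 1) y \<partial>lborel)
    = ennreal (tail_const TYPE('n) * sqrt (1 - q\<^sup>2) ^ (CARD('n) - 1))"
proof -
  let ?n = "CARD('n)" and ?K = "tail_const TYPE('n)"
  have n: "?n \<ge> 1" by (simp add: Suc_leI)
  note K0 = tail_const_nonneg[where 'n = 'n]
  have [measurable]: "cball (0::real^'n) 1 \<in> sets borel" by simp
  define J where "J t = (\<integral>\<^sup>+s. ennreal (real (?n + 1) * s ^ ?n) * indicator {q<..<1} s * indicator {s<..} t \<partial>lborel)" for t
  have J [measurable]: "J \<in> borel_measurable borel"
  proof -
    have "(\<lambda>t. \<integral>\<^sup>+s. ennreal (real (?n + 1) * s ^ ?n) * indicator {q<..<1} s * (if s < t then 1 else 0) \<partial>lborel)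
      \<in> borel_measurable borel" by measurable
    then show ?thesis by (simp add: J_def[abs_def] indicator_def)
  qed
  have "(\<integral>\<^sup>+y. ennreal (dir_cos i y) * indicator {q<..} (dir_cos i y) * indicator (cball 0 1) y \<partial>lborel)
    = (\<integral>\<^sup>+y. ennreal (q ^ (?n + 1)) * (ennreal (1 / dir_cos i y ^ ?n) * indicator {q<..} (dir_cos i y) * indicator (cball 0 1) y)
        + ennreal (1 / dir_cos i y ^ ?n) * indicator (cball 0 1) y
      * J (dir_cos i y) \<partial>lborel)"
  proof (rule nn_integral_cong)
    fix y :: "real ^ 'n"
    define t where "t = dir_cos i y"
    have t1: "t \<le> 1" by (simp add: t_def dir_cos_le_1)
    have "ennreal t * indicator {q<..} t = ennreal (q ^ (?n + 1)) * (ennreal (1 / t ^ ?n) * indicator {q<..} t) + ennreal (1 / t ^ ?n)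
        * J t"
    proof (cases "t > q")
      case True
      have "J t
        = (\<integral>\<^sup>+s. ennreal (real (?n + 1) * s ^ ?n) * indicator {q<..<t} s \<partial>lborel)"
        unfolding J_def using t1 by (intro nn_integral_cong) (auto simp: indicator_def)
      also have "\<dots> = ennreal (t ^ (?n + 1) - q ^ (?n + 1))"
      proof (rule nn_integral_FTC_Ioo)
        show "((\<lambda>r. r ^ (?n + 1)) has_real_derivative real (?n + 1) * r ^ ?n) (at r)" for r :: real
          by (rule DERIV_cong[OF DERIV_pow]) simp
      qed (use True q in \<open>auto intro!: continuous_intros\<close>)
      finally have I: "J t
        = ennreal (t ^ (?n + 1) - q ^ (?n + 1))" .
      have "q ^ (?n + 1) \<le> t ^ (?n + 1)" using True q by (intro power_mono) auto
      moreover have "q ^ (?n + 1) * (1 / t ^ ?n) + 1 / t ^ ?n * (t ^ (?n + 1) - q ^ (?n + 1)) = t"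
        using True q by (simp add: field_simps)
      ultimately show ?thesis unfolding I using True q
        by (simp add: ennreal_mult'[symmetric] ennreal_plus[symmetric] del: ennreal_plus power_Suc)
    next
      case False
      then have z: "ennreal (real (?n + 1) * s ^ ?n) * indicator {q<..<1} s * indicator {s<..} t = 0" for s
        by (auto simp: indicator_def)
      show ?thesis unfolding J_def z using False by simp
    qed
    then have "(ennreal t * indicator {q<..} t) * indicator (cball 0 1) y
      = (ennreal (q ^ (?n + 1)) * (ennreal (1 / t ^ ?n) * indicator {q<..} t) + ennreal (1 / t ^ ?n)
        * J t) * indicator (cball 0 1) y"
      by (simp only:)
    then show "ennreal (dir_cos i y) * indicator {q<..} (dir_cos i y) * indicator (cball 0 1) y
      = ennreal (q ^ (?n + 1)) * (ennreal (1 / dir_cos i y ^ ?n) * indicator {q<..} (dir_cos i y) * indicator (cball 0 1) y)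
        + ennreal (1 / dir_cos i y ^ ?n) * indicator (cball 0 1) y
      * J (dir_cos i y)"
      unfolding t_def distrib_right by (simp only: ac_simps)
  qed
  also have "\<dots> = ennreal (q ^ (?n + 1)) * (\<integral>\<^sup>+y. ennreal (1 / dir_cos i y ^ ?n) * indicator {q<..} (dir_cos i y) * indicator (cball 0 1) y \<partial>lborel)
        + (\<integral>\<^sup>+y. ennreal (1 / dir_cos i y ^ ?n) * indicator (cball 0 1) y
      * J (dir_cos i y) \<partial>lborel)"
  proof -
    have "(\<lambda>y. ennreal (1 / dir_cos i y ^ ?n) * indicator {q<..} (dir_cos i y) * indicator (cball 0 1) y)
        \<in> borel_measurable lborel"
      and "(\<lambda>y. ennreal (1 / dir_cos i y ^ ?n) * indicator (cball 0 1) y * J (dir_cos i y)) \<in> borel_measurable lborel"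
      by measurable
    then show ?thesis
      by (simp only: nn_integral_add nn_integral_cmult borel_measurable_times_ennreal borel_measurable_const)
  qed
  also have "(\<integral>\<^sup>+y. ennreal (1 / dir_cos i y ^ ?n) * indicator (cball 0 1) y
      * J (dir_cos i y) \<partial>lborel)
    = (\<integral>\<^sup>+s. ennreal (real (?n + 1) * s ^ ?n) * indicator {q<..<1} s
      * (\<integral>\<^sup>+y. ennreal (1 / dir_cos i y ^ ?n) * indicator {s<..} (dir_cos i y) * indicator (cball 0 1) y \<partial>lborel) \<partial>lborel)"
    unfolding J_def by (rule nn_integral_ball_tail_Fubini) auto
  also have "\<dots> = (\<integral>\<^sup>+s. ennreal ?K * (ennreal (real (?n + 1) * (s * sqrt (1 - s\<^sup>2) ^ (?n - 1))) * indicator {q<..<1} s) \<partial>lborel)"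
  proof (rule nn_integral_cong)
    fix s :: real
    show "ennreal (real (?n + 1) * s ^ ?n) * indicator {q<..<1} s
      * (\<integral>\<^sup>+y. ennreal (1 / dir_cos i y ^ ?n) * indicator {s<..} (dir_cos i y) * indicator (cball 0 1) y \<partial>lborel)
      = ennreal ?K * (ennreal (real (?n + 1) * (s * sqrt (1 - s\<^sup>2) ^ (?n - 1))) * indicator {q<..<1} s)"
    proof (cases "s \<in> {q<..<1}")
      case True
      then have s: "0 < s" "s < 1" using q by auto
      have "s ^ ?n = s * s ^ (?n - 1)" using n by (metis power_minus_mult mult.commute zero_less_one order_less_le_trans One_nat_def Suc_le_lessD)
      then have "real (?n + 1) * s ^ ?n * (?K * sqrt (1 / s\<^sup>2 - 1) ^ (?n - 1))
         = ?K * (real (?n + 1) * (s * (s ^ (?n - 1) * sqrt (1 / s\<^sup>2 - 1) ^ (?n - 1))))"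
        by (simp only: ac_simps)
      then have "real (?n + 1) * s ^ ?n * (?K * sqrt (1 / s\<^sup>2 - 1) ^ (?n - 1))
         = ?K * (real (?n + 1) * (s * sqrt (1 - s\<^sup>2) ^ (?n - 1)))"
        unfolding power_times_sqrt_tail[OF s] .
      then show ?thesis unfolding power_tail_value[OF s] using True s K0
        by (simp add: ennreal_mult'[symmetric] ennreal_mult''[symmetric] power_le_one del: of_nat_Suc)
    qed simp
  qed
  also have "\<dots> = ennreal ?K * (\<integral>\<^sup>+s. ennreal (real (?n + 1) * (s * sqrt (1 - s\<^sup>2) ^ (?n - 1))) * indicator {q<..<1} s \<partial>lborel)"
    by (rule nn_integral_cmult) measurable
  also have "(\<integral>\<^sup>+s. ennreal (real (?n + 1) * (s * sqrt (1 - s\<^sup>2) ^ (?n - 1))) * indicator {q<..<1} s \<partial>lborel)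
     = ennreal (- (sqrt (1 - 1\<^sup>2) ^ (?n + 1)) - - (sqrt (1 - q\<^sup>2) ^ (?n + 1)))"
  proof (rule nn_integral_FTC_Ioo)
    show "continuous_on {q..1} (\<lambda>s. - (sqrt (1 - s\<^sup>2) ^ (?n + 1)))"
      by (intro continuous_intros)
    fix s assume s: "q < s" "s < 1"
    then have S: "1 - s\<^sup>2 > 0" using q by (simp add: power_less_one_iff)
    have "((\<lambda>s. sqrt (1 - s\<^sup>2)) has_real_derivative - s / sqrt (1 - s\<^sup>2)) (at s)"
      using S by (auto intro!: derivative_eq_intros simp: field_simps)
    note D = DERIV_minus[OF DERIV_power[OF this, of "?n + 1"]]
    have alg: "- (real (m + 1) * (- s / S * S ^ (m + 1 - Suc 0))) = real (m + 1) * (s * S ^ (m - 1))"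
      if "S > 0" "m \<ge> 1" for S :: real and m
      using that by (cases m) (simp_all add: field_simps)
    show "((\<lambda>s. - (sqrt (1 - s\<^sup>2) ^ (?n + 1))) has_real_derivative real (?n + 1) * (s * sqrt (1 - s\<^sup>2) ^ (?n - 1))) (at s)"
      by (rule DERIV_cong[OF D alg]) (use S n in auto)
    show "0 \<le> real (?n + 1) * (s * sqrt (1 - s\<^sup>2) ^ (?n - 1))"
      using s q S by auto
  qed (use q in auto)
  also have "ennreal (q ^ (?n + 1)) * (\<integral>\<^sup>+y. ennreal (1 / dir_cos i y ^ ?n) * indicator {q<..} (dir_cos i y) * indicator (cball 0 1) y \<partial>lborel)
      = ennreal (?K * (q\<^sup>2 * sqrt (1 - q\<^sup>2) ^ (?n - 1)))"
  proof -
    have "q ^ (?n + 1) = q\<^sup>2 * q ^ (?n - 1)" using n by (simp flip: power_add)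
    then have "q ^ (?n + 1) * (?K * sqrt (1 / q\<^sup>2 - 1) ^ (?n - 1))
       = ?K * (q\<^sup>2 * (q ^ (?n - 1) * sqrt (1 / q\<^sup>2 - 1) ^ (?n - 1)))" by (simp only: ac_simps)
    then have "q ^ (?n + 1) * (?K * sqrt (1 / q\<^sup>2 - 1) ^ (?n - 1)) = ?K * (q\<^sup>2 * sqrt (1 - q\<^sup>2) ^ (?n - 1))"
      unfolding power_times_sqrt_tail[OF q] .
    moreover have "ennreal (q ^ (?n + 1)) * ennreal x = ennreal (q ^ (?n + 1) * x)" for x
      using q by (intro ennreal_mult'[symmetric] zero_le_power) simp
    ultimately show ?thesis
      unfolding power_tail_value[OF q] by (simp only:)
  qed
  \<comment> \<open>With S = sqrt (1 - q^2), the boundary term contributes q^2 S^(n-1) and the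
    integral S^(n+1) = (1 - q^2) S^(n-1).\<close>
  also have "ennreal (?K * (q\<^sup>2 * sqrt (1 - q\<^sup>2) ^ (?n - 1))) + ennreal ?K * ennreal (- (sqrt (1 - 1\<^sup>2) ^ (?n + 1)) - - (sqrt (1 - q\<^sup>2) ^ (?n + 1)))
      = ennreal (?K * sqrt (1 - q\<^sup>2) ^ (?n - 1))"
  proof -
    have q2: "q\<^sup>2 < 1" using q by (simp add: power_less_one_iff)
    have "sqrt (1 - q\<^sup>2) ^ (?n + 1) = (sqrt (1 - q\<^sup>2))\<^sup>2 * sqrt (1 - q\<^sup>2) ^ (?n - 1)"
      using n by (simp flip: power_add del: real_sqrt_pow2 real_sqrt_pow2_iff)
    then have e: "sqrt (1 - q\<^sup>2) ^ (?n + 1) = (1 - q\<^sup>2) * sqrt (1 - q\<^sup>2) ^ (?n - 1)"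
      using q2 by simp
    have "- (sqrt (1 - 1\<^sup>2) ^ (?n + 1)) - - (sqrt (1 - q\<^sup>2) ^ (?n + 1)) = (1 - q\<^sup>2) * sqrt (1 - q\<^sup>2) ^ (?n - 1)"
      unfolding e by simp
    then have "ennreal (?K * (q\<^sup>2 * sqrt (1 - q\<^sup>2) ^ (?n - 1))) + ennreal ?K * ennreal (- (sqrt (1 - 1\<^sup>2) ^ (?n + 1)) - - (sqrt (1 - q\<^sup>2) ^ (?n + 1)))
      = ennreal (?K * (q\<^sup>2 * sqrt (1 - q\<^sup>2) ^ (?n - 1)) + ?K * ((1 - q\<^sup>2) * sqrt (1 - q\<^sup>2) ^ (?n - 1)))"
      using K0 q2 q by (simp only: ennreal_mult'[symmetric]) (intro ennreal_plus[symmetric] mult_nonneg_nonneg zero_le_power; simp)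
    also have "?K * (q\<^sup>2 * sqrt (1 - q\<^sup>2) ^ (?n - 1)) + ?K * ((1 - q\<^sup>2) * sqrt (1 - q\<^sup>2) ^ (?n - 1)) = ?K * sqrt (1 - q\<^sup>2) ^ (?n - 1)"
      by (simp add: algebra_simps)
    finally show ?thesis .
  qed
  finally show ?thesis .
qed

lemma ell_nn_integral:
  assumes p: "0 < p" "p < 1"
  shows "(\<integral>\<^sup>+u. ennreal (sqrt (1 - u\<^sup>2) ^ (n - 1) / sqrt (p\<^sup>2 + (1 - p\<^sup>2) * u\<^sup>2) ^ m) * indicator {0<..<1} u \<partial>lborel)
    = ennreal (ell m n p)"
proof (rule nn_integral_has_integral_lebesgue')
  have "((\<lambda>u. sqrt (1 - u\<^sup>2) ^ (n - 1) / sqrt (p\<^sup>2 + (1 - p\<^sup>2) * u\<^sup>2) ^ m) has_integral ell m n p) {0..1}"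
    unfolding ell_def using ell_integrable[of p "n - 1" 0 m] p by (intro integrable_integral) auto
  then show "((\<lambda>u. sqrt (1 - u\<^sup>2) ^ (n - 1) / sqrt (p\<^sup>2 + (1 - p\<^sup>2) * u\<^sup>2) ^ m) has_integral ell m n p) {0<..<1}"
    by (simp add: has_integral_Icc_iff_Ioo)
  fix u :: real assume "u \<in> {0<..<1}"
  then have "u\<^sup>2 \<le> 1" by (auto simp: power_le_one)
  then show "0 \<le> sqrt (1 - u\<^sup>2) ^ (n - 1) / sqrt (p\<^sup>2 + (1 - p\<^sup>2) * u\<^sup>2) ^ m"
    using less_imp_le[OF lens_Q_power_pos[of p u m]] p
    by (intro divide_nonneg_nonneg zero_le_power[of "sqrt (1 - u\<^sup>2)"]) auto
qed

text \<open>At the level q = sqrt (p^2 + (1 - p^2) u^2) one has sqrt (1 - q^2) = k sqrt (1 - u^2),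
  so the tail releases k^(n-1). Together with the k in the integrand this is the origin of the
  factor \<open>sqrt (1 - p\<^sup>2) ^ n\<close> in \<open>lens_W\<close> and
  \<open>lens_U\<close>.\<close>

lemma lens_tail_value:
  fixes i :: "'n::finite"
  assumes p: "0 < p" "p < 1" and C: "C \<ge> 0"
  defines "k \<equiv> sqrt (1 - p\<^sup>2)"
  shows "(\<integral>\<^sup>+y. ennreal (dir_cos i y) * indicator (cball 0 1) y
      * (\<integral>\<^sup>+u. ennreal (C * (k / sqrt (p\<^sup>2 + (1 - p\<^sup>2) * u\<^sup>2) ^ m)) * indicator {0<..<1} u
           * indicator {sqrt (p\<^sup>2 + (1 - p\<^sup>2) * u\<^sup>2)<..} (dir_cos i y) \<partial>lborel) \<partial>lborel)
    = ennreal (C * tail_const TYPE('n) * k ^ CARD('n) * ell m CARD('n) p)"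
proof -
  let ?n = "CARD('n)" and ?K = "tail_const TYPE('n)"
  let ?Q = "\<lambda>u::real. p\<^sup>2 + (1 - p\<^sup>2) * u\<^sup>2"
  have n: "?n \<ge> 1" by (simp add: Suc_leI)
  note K0 = tail_const_nonneg[where 'n = 'n]
  have p2: "1 - p\<^sup>2 > 0" using p by (simp add: power_less_one_iff)
  then have k: "k > 0" by (simp add: k_def)
  have "(\<integral>\<^sup>+y. ennreal (dir_cos i y) * indicator (cball 0 1) y
      * (\<integral>\<^sup>+u. ennreal (C * (k / sqrt (?Q u) ^ m)) * indicator {0<..<1} u * indicator {sqrt (?Q u)<..} (dir_cos i y) \<partial>lborel) \<partial>lborel)
    = (\<integral>\<^sup>+u. ennreal (C * (k / sqrt (?Q u) ^ m)) * indicator {0<..<1} u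
       * (\<integral>\<^sup>+y. ennreal (dir_cos i y) * indicator {sqrt (?Q u)<..} (dir_cos i y) * indicator (cball 0 1) y \<partial>lborel) \<partial>lborel)"
    by (rule nn_integral_ball_tail_Fubini) measurable
  also have "\<dots> = (\<integral>\<^sup>+u. ennreal (C * ?K * k ^ ?n) * (ennreal (sqrt (1 - u\<^sup>2) ^ (?n - 1) / sqrt (?Q u) ^ m) * indicator {0<..<1} u) \<partial>lborel)"
  proof (rule nn_integral_cong)
    fix u :: real
    show "ennreal (C * (k / sqrt (?Q u) ^ m)) * indicator {0<..<1} u
       * (\<integral>\<^sup>+y. ennreal (dir_cos i y) * indicator {sqrt (?Q u)<..} (dir_cos i y) * indicator (cball 0 1) y \<partial>lborel)
      = ennreal (C * ?K * k ^ ?n) * (ennreal (sqrt (1 - u\<^sup>2) ^ (?n - 1) / sqrt (?Q u) ^ m) * indicator {0<..<1} u)"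
    proof (cases "u \<in> {0<..<1}")
      case True
      then have u2: "u\<^sup>2 < 1" by (auto simp: power_less_one_iff)
      have Q0: "?Q u > 0" using p by (intro lens_Q_pos) auto
      have "(1 - p\<^sup>2) * u\<^sup>2 < (1 - p\<^sup>2) * 1" using u2 p2 by (intro mult_strict_left_mono) auto
      then have Q1: "?Q u < 1" by simp
      have q: "0 < sqrt (?Q u)" "sqrt (?Q u) < 1" using Q0 Q1 by auto
      have "1 - (sqrt (?Q u))\<^sup>2 = (1 - p\<^sup>2) * (1 - u\<^sup>2)" using Q0 by (simp add: algebra_simps)
      then have "sqrt (1 - (sqrt (?Q u))\<^sup>2) = k * sqrt (1 - u\<^sup>2)"
        unfolding k_def by (simp add: real_sqrt_mult)
      then have val: "(\<integral>\<^sup>+y. ennreal (dir_cos i y) * indicator {sqrt (?Q u)<..} (dir_cos i y) * indicator (cball 0 1) y \<partial>lborel)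
         = ennreal (?K * (k * sqrt (1 - u\<^sup>2)) ^ (?n - 1))"
        using dir_cos_tail_value[OF q, of i] by simp
      have kn: "k ^ ?n = k * k ^ (?n - 1)" using n by (cases ?n) auto
      have eq: "C * (k / S) * (?K * (k * w) ^ (?n - 1)) = C * ?K * k ^ ?n * (w ^ (?n - 1) / S)" for S w
        unfolding kn by (simp add: power_mult_distrib)
      have "ennreal (C * (k / sqrt (?Q u) ^ m)) * ennreal (?K * (k * sqrt (1 - u\<^sup>2)) ^ (?n - 1))
         = ennreal (C * (k / sqrt (?Q u) ^ m) * (?K * (k * sqrt (1 - u\<^sup>2)) ^ (?n - 1)))"
        using C k q by (intro ennreal_mult'[symmetric] mult_nonneg_nonneg divide_nonneg_nonneg zero_le_power) auto
      also have "\<dots> = ennreal (C * ?K * k ^ ?n) * ennreal (sqrt (1 - u\<^sup>2) ^ (?n - 1) / sqrt (?Q u) ^ m)"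
        unfolding eq using C k K0 by (intro ennreal_mult' mult_nonneg_nonneg zero_le_power) auto
      finally show ?thesis unfolding val using True by simp
    qed simp
  qed
  also have "\<dots> = ennreal (C * ?K * k ^ ?n) * ennreal (ell m ?n p)"
    by (subst nn_integral_cmult) (measurable, simp only: ell_nn_integral[OF p])
  also have "\<dots> = ennreal (C * ?K * k ^ ?n * ell m ?n p)"
    using C k K0 by (intro ennreal_mult'[symmetric] mult_nonneg_nonneg zero_le_power) auto
  finally show ?thesis .
qed

section \<open>Integrals over lenses\<close>

definition lens :: "'n::finite \<Rightarrow> real \<Rightarrow> real \<Rightarrow> (real ^ 'n) set" where
  "lens i a b = {x. a * (norm x)\<^sup>2 + b < x $ i}"

lemma lens_sets [measurable]: "lens i a b \<in> sets borel"
  unfolding lens_def by measurable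

text \<open>A ray of direction cosine t meets the lens between the roots of a r^2 - t r + b, whose
  discriminant is s^2.\<close>

lemma lens_radial_set:
  fixes a b t r :: real
  assumes ab: "a > 0" "b > 0" and t: "2 * sqrt (a * b) < t"
  defines "s \<equiv> sqrt (t\<^sup>2 - (2 * sqrt (a * b))\<^sup>2)"
  shows "0 < r \<and> a * r\<^sup>2 + b < r * t \<longleftrightarrow> (t - s) / (2 * a) < r \<and> r < (t + s) / (2 * a)"
    and "0 < s" "s < t" "(t - s) * (t + s) = 4 * a * b"
proof -
  have t0: "t > 0" using t ab by (smt (verit) mult_pos_pos real_sqrt_gt_zero)
  have p2: "(2 * sqrt (a * b))\<^sup>2 = 4 * a * b" using ab by (simp add: power_mult_distrib)
  have "(2 * sqrt (a * b))\<^sup>2 < t\<^sup>2" using t ab by (intro power_strict_mono) auto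
  then have s: "s > 0" "s\<^sup>2 = t\<^sup>2 - 4 * a * b" unfolding s_def p2 by auto
  show "0 < s" by fact
  show st: "s < t"
    using s(2) ab t0 by (intro power2_less_imp_less[of s t]) auto
  show prod: "(t - s) * (t + s) = 4 * a * b"
    using s(2) by (simp add: algebra_simps power2_eq_square)
  have "4 * a * (r * t - a * r\<^sup>2 - b) = - ((2 * a * r - (t - s)) * (2 * a * r - (t + s)))"
    using s(2) by (simp add: algebra_simps power2_eq_square)
  then have "a * r\<^sup>2 + b < r * t \<longleftrightarrow> 0 < - ((2 * a * r - (t - s)) * (2 * a * r - (t + s)))"
    using ab by (smt (verit, best) mult_pos_pos zero_less_mult_pos)
  also have "\<dots> \<longleftrightarrow> t - s < 2 * a * r \<and> 2 * a * r < t + s"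
    using s(1) by (auto simp: mult_less_0_iff)
  also have "\<dots> \<longleftrightarrow> (t - s) / (2 * a) < r \<and> r < (t + s) / (2 * a)"
    using ab by (simp add: divide_less_eq less_divide_eq mult_ac)
  finally show "0 < r \<and> a * r\<^sup>2 + b < r * t \<longleftrightarrow> (t - s) / (2 * a) < r \<and> r < (t + s) / (2 * a)"
    using st ab by (smt (verit, ccfv_SIG) divide_pos_pos)
qed

lemma lens_u_range:
  fixes p t u :: real
  assumes p: "0 < p" "p < 1" and t: "p < t" "t \<le> 1"
  defines "k \<equiv> sqrt (1 - p\<^sup>2)" and "s \<equiv> sqrt (t\<^sup>2 - p\<^sup>2)"
  shows "0 < u \<and> u < 1 \<and> sqrt (p\<^sup>2 + (1 - p\<^sup>2) * u\<^sup>2) < t \<longleftrightarrow> 0 < u \<and> u < s / k"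
    and "0 < k" "0 < s" "sqrt (p\<^sup>2 + (1 - p\<^sup>2) * (s / k)\<^sup>2) = t" "k\<^sup>2 = 1 - p\<^sup>2"
proof -
  have p2: "1 - p\<^sup>2 > 0" using p by (simp add: power_less_one_iff)
  show k: "0 < k" "k\<^sup>2 = 1 - p\<^sup>2" using p2 by (auto simp: k_def)
  have pt: "p\<^sup>2 < t\<^sup>2" using p t by (intro power_strict_mono) auto
  then have s: "0 < s" "s\<^sup>2 = t\<^sup>2 - p\<^sup>2" by (auto simp: s_def)
  show "0 < s" by fact
  have "(1 - p\<^sup>2) * (s / k)\<^sup>2 = s\<^sup>2" using k by (simp add: power_divide flip: k(2))
  then show "sqrt (p\<^sup>2 + (1 - p\<^sup>2) * (s / k)\<^sup>2) = t" using s t p by simp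
  have "s \<le> k" unfolding s_def k_def using t p by (simp add: power_le_one)
  then have sk: "s / k \<le> 1" using k by simp
  have "sqrt (p\<^sup>2 + (1 - p\<^sup>2) * u\<^sup>2) < t \<longleftrightarrow> u < s / k" if u: "u > 0"
  proof -
    have "sqrt (p\<^sup>2 + (1 - p\<^sup>2) * u\<^sup>2) < t \<longleftrightarrow> sqrt (p\<^sup>2 + (1 - p\<^sup>2) * u\<^sup>2) < sqrt (t\<^sup>2)"
      using t p by simp
    also have "\<dots> \<longleftrightarrow> (k * u)\<^sup>2 < s\<^sup>2"
      unfolding real_sqrt_less_iff by (simp add: s(2) power_mult_distrib k(2) less_diff_eq add.commute)
    also have "\<dots> \<longleftrightarrow> k * u < s"
      using k s u by (metis less_imp_le mult_pos_pos power2_less_imp_less power_strict_mono zero_less_numeral)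
    also have "\<dots> \<longleftrightarrow> u < s / k" using k by (simp add: less_divide_eq mult.commute)
    finally show ?thesis .
  qed
  then show "0 < u \<and> u < 1 \<and> sqrt (p\<^sup>2 + (1 - p\<^sup>2) * u\<^sup>2) < t \<longleftrightarrow> 0 < u \<and> u < s / k"
    using sk by auto
qed

text \<open>These rewrite chord integrals as integrals over levels q from p to t. As functions of
  the upper limit, arcosh (t / p) = ln (t + s) - ln p has the derivative 1 / s, and s / t has p^2 /
  (t^2 s), both singular at t = p. The variable u, with q = sqrt (p^2 + (1 - p^2) u^2), removes this
  singularity.\<close>

lemma lens_u_integral:
  fixes p t :: real
  assumes p: "0 < p" "p < 1" and t: "p < t" "t \<le> 1"
  defines "k \<equiv> sqrt (1 - p\<^sup>2)" and "s \<equiv> sqrt (t\<^sup>2 - p\<^sup>2)"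
  assumes C: "C \<ge> 0"
  shows "(\<integral>\<^sup>+u. ennreal (C * (k / sqrt (p\<^sup>2 + (1 - p\<^sup>2) * u\<^sup>2) ^ 1)) * indicator {0<..<1} u
           * indicator {sqrt (p\<^sup>2 + (1 - p\<^sup>2) * u\<^sup>2)<..} t \<partial>lborel) = ennreal (C * (ln (t + s) - ln p))"
    and "(\<integral>\<^sup>+u. ennreal (C * p\<^sup>2 * (k / sqrt (p\<^sup>2 + (1 - p\<^sup>2) * u\<^sup>2) ^ 3)) * indicator {0<..<1} u
           * indicator {sqrt (p\<^sup>2 + (1 - p\<^sup>2) * u\<^sup>2)<..} t \<partial>lborel) = ennreal (C * (s / t))"
proof -
  let ?S = "\<lambda>u. sqrt (p\<^sup>2 + (1 - p\<^sup>2) * u\<^sup>2)"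
  note r = lens_u_range[OF p t, folded k_def s_def]
  have S: "?S u > 0" for u using lens_Q_pos[of p u] p by simp
  have S2: "(?S u)\<^sup>2 = p\<^sup>2 + k\<^sup>2 * u\<^sup>2" for u using lens_Q_pos[of p u] p r(5) by simp
  have dS: "(?S has_real_derivative k\<^sup>2 * u / ?S u) (at u)" for u
    using lens_Q_pos[of p u] p unfolding r(5) by (auto intro!: derivative_eq_intros simp: field_simps)
  have ind: "(\<integral>\<^sup>+u. ennreal (f u) * indicator {0<..<1} u * indicator {?S u<..} t \<partial>lborel)
    = (\<integral>\<^sup>+u. ennreal (f u) * indicator {0<..<s / k} u \<partial>lborel)" for f
    using r(1) by (intro nn_integral_cong) (force simp: indicator_def)
  have Scont: "continuous_on {0..s / k} ?S" by (intro continuous_intros)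
  have "(\<integral>\<^sup>+u. ennreal (C * (k / ?S u ^ 1)) * indicator {0<..<s / k} u \<partial>lborel)
     = ennreal (C * ln (k * (s / k) + ?S (s / k)) - C * ln (k * 0 + ?S 0))"
  proof (rule nn_integral_FTC_Ioo)
    show "0 \<le> s / k" using r by simp
    have nz: "k * u + ?S u > 0" if "u \<ge> 0" for u
      using that r(2) S[of u] by (intro add_nonneg_pos mult_nonneg_nonneg) auto
    show "continuous_on {0..s / k} (\<lambda>u. C * ln (k * u + ?S u))"
      by (intro continuous_intros Scont ballI less_imp_neq[THEN not_sym] nz) auto
    fix u assume u: "0 < u" "u < s / k"
    have "((\<lambda>u. C * ln (k * u + ?S u)) has_real_derivative
        C * (1 / (k * u + ?S u) * (k * 1 + k\<^sup>2 * u / ?S u))) (at u)"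
      using nz[of u] u
      by (intro DERIV_cmult DERIV_chain2[OF DERIV_ln_divide DERIV_add] DERIV_ident dS) auto
    moreover have "1 / (k * u + ?S u) * (k * 1 + k\<^sup>2 * u / ?S u) = k / ?S u ^ 1"
    proof -
      have "1 / (k * u + S) * (k + k\<^sup>2 * u / S) = k / S ^ 1" if "S > 0" "k * u + S > 0" for S :: real
      proof -
        have "k + k\<^sup>2 * u / S = k * (k * u + S) / S" using that by (simp add: field_simps power2_eq_square)
        then show ?thesis using that by simp
      qed
      from this[OF S nz[of u]] u show ?thesis by simp
    qed
    ultimately show "((\<lambda>u. C * ln (k * u + ?S u)) has_real_derivative C * (k / ?S u ^ 1)) (at u)"
      by (simp only:)
    show "0 \<le> C * (k / ?S u ^ 1)" using C r(2) less_imp_le[OF S[of u]]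
      by (intro mult_nonneg_nonneg divide_nonneg_nonneg zero_le_power) auto
  qed
  moreover have "C * ln (k * (s / k) + ?S (s / k)) - C * ln (k * 0 + ?S 0) = C * (ln (t + s) - ln p)"
    using r(2,4) p by (simp add: algebra_simps)
  ultimately show "(\<integral>\<^sup>+u. ennreal (C * (k / ?S u ^ 1)) * indicator {0<..<1} u * indicator {?S u<..} t \<partial>lborel)
     = ennreal (C * (ln (t + s) - ln p))"
    unfolding ind by (simp only:)
  have "(\<integral>\<^sup>+u. ennreal (C * p\<^sup>2 * (k / ?S u ^ 3)) * indicator {0<..<s / k} u \<partial>lborel)
     = ennreal (C * (k * (s / k) / ?S (s / k)) - C * (k * 0 / ?S 0))"
  proof (rule nn_integral_FTC_Ioo)
    show "0 \<le> s / k" using r by simp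
    show "continuous_on {0..s / k} (\<lambda>u. C * (k * u / ?S u))"
      by (intro continuous_intros Scont ballI less_imp_neq[THEN not_sym] S)
    fix u assume u: "0 < u" "u < s / k"
    have "((\<lambda>u. C * (k * u / ?S u)) has_real_derivative
        C * ((k * 1 * ?S u - k * u * (k\<^sup>2 * u / ?S u)) / (?S u * ?S u))) (at u)"
      using S[of u] by (intro DERIV_cmult DERIV_divide DERIV_ident dS) auto
    moreover have "C * ((k * 1 * ?S u - k * u * (k\<^sup>2 * u / ?S u)) / (?S u * ?S u)) = C * p\<^sup>2 * (k / ?S u ^ 3)"
    proof -
      have "C * ((k * 1 * S - k * u * (k\<^sup>2 * u / S)) / (S * S)) = C * p\<^sup>2 * (k / S ^ 3)"
        if "S > 0" "S\<^sup>2 = p\<^sup>2 + k\<^sup>2 * u\<^sup>2" for S :: real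
      proof -
        have "C * ((k * 1 * S - k * u * (k\<^sup>2 * u / S)) / (S * S)) = C * k * (S\<^sup>2 - k\<^sup>2 * u\<^sup>2) / S ^ 3"
          using that(1) by (simp add: field_simps power2_eq_square power3_eq_cube)
        then show ?thesis by (simp add: that(2))
      qed
      from this[OF S S2] show ?thesis .
    qed
    ultimately show "((\<lambda>u. C * (k * u / ?S u)) has_real_derivative C * p\<^sup>2 * (k / ?S u ^ 3)) (at u)"
      by (simp only:)
    show "0 \<le> C * p\<^sup>2 * (k / ?S u ^ 3)" using C p r(2) less_imp_le[OF S[of u]]
      by (intro mult_nonneg_nonneg divide_nonneg_nonneg zero_le_power) auto
  qed
  moreover have "C * (k * (s / k) / ?S (s / k)) - C * (k * 0 / ?S 0) = C * (s / t)"
    using r(2,4) by simp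
  ultimately show "(\<integral>\<^sup>+u. ennreal (C * p\<^sup>2 * (k / ?S u ^ 3)) * indicator {0<..<1} u * indicator {?S u<..} t \<partial>lborel)
     = ennreal (C * (s / t))"
    unfolding ind by (simp only:)
qed

text \<open>The common frame of the three lens integrals. What an individual weight has to supply is
  \<open>inner\<close>: its integral along the chord of direction cosine t, as t times an integral
  over the levels below t.\<close>

lemma lens_integral_polar:
  fixes i :: "'n::finite" and a b :: real and \<phi> :: "real \<Rightarrow> real \<Rightarrow> real"
  assumes ab: "a > 0" "b > 0" and p: "p = 2 * sqrt (a * b)" "p < 1" and C: "C \<ge> 0"
    and [measurable]: "case_prod \<phi> \<in> borel_measurable (borel \<Otimes>\<^sub>M borel)"
    and inner: "\<And>t. p < t \<Longrightarrow> t \<le> 1 \<Longrightarrow>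
      (\<integral>\<^sup>+r. ennreal (real CARD('n) * r ^ (CARD('n) - 1) * \<phi> r t) * indicator {r. 0 < r \<and> a * r\<^sup>2 + b < r * t} r \<partial>lborel)
      = ennreal t * (\<integral>\<^sup>+u. ennreal (C * (sqrt (1 - p\<^sup>2) / sqrt (p\<^sup>2 + (1 - p\<^sup>2) * u\<^sup>2) ^ m)) * indicator {0<..<1} u
           * indicator {sqrt (p\<^sup>2 + (1 - p\<^sup>2) * u\<^sup>2)<..} t \<partial>lborel)"
  shows "(\<integral>\<^sup>+x. ennreal (\<phi> (norm x) (dir_cos i x)) * indicator (lens i a b) x \<partial>lborel)
    = ennreal (C * tail_const TYPE('n) * sqrt (1 - p\<^sup>2) ^ CARD('n) * ell m CARD('n) p)"
proof -
  let ?n = "CARD('n)"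
  let ?S = "\<lambda>u. sqrt (p\<^sup>2 + (1 - p\<^sup>2) * u\<^sup>2)"
  let ?f = "\<lambda>r t. ennreal (\<phi> r t) * (if a * r\<^sup>2 + b < r * t then 1 else 0)"
  have p0: "p > 0" using ab p by simp
  have "(\<integral>\<^sup>+x. ennreal (\<phi> (norm x) (dir_cos i x)) * indicator (lens i a b) x \<partial>lborel)
     = (\<integral>\<^sup>+x. ?f (norm x) (x $ i / norm x) \<partial>lborel)"
  proof (rule nn_integral_cong)
    fix x :: "real ^ 'n"
    have "norm x * (x $ i / norm x) = x $ i" by (cases "x = 0") auto
    then show "ennreal (\<phi> (norm x) (dir_cos i x)) * indicator (lens i a b) x = ?f (norm x) (x $ i / norm x)"
      by (auto simp: dir_cos_def lens_def indicator_def)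
  qed
  also have "\<dots> = (\<integral>\<^sup>+y. (\<integral>\<^sup>+r. ennreal (real ?n * r ^ (?n - 1)) * ?f r (y $ i / norm y) * indicator {0<..} r \<partial>lborel)
        * indicator (cball 0 1) y \<partial>(lborel :: (real ^ 'n) measure))"
    by (rule nn_integral_polar_component) measurable
  also have "\<dots> = (\<integral>\<^sup>+y. ennreal (dir_cos i y) * indicator (cball 0 1) y
      * (\<integral>\<^sup>+u. ennreal (C * (sqrt (1 - p\<^sup>2) / ?S u ^ m)) * indicator {0<..<1} u * indicator {?S u<..} (dir_cos i y) \<partial>lborel) \<partial>lborel)"
  proof (rule nn_integral_cong)
    fix y :: "real ^ 'n"
    define t where "t = dir_cos i y"
    have t1: "t \<le> 1" by (simp add: t_def dir_cos_le_1)
    have "(\<integral>\<^sup>+r. ennreal (real ?n * r ^ (?n - 1)) * ?f r t * indicator {0<..} r \<partial>lborel)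
       = (\<integral>\<^sup>+r. ennreal (real ?n * r ^ (?n - 1) * \<phi> r t) * indicator {r. 0 < r \<and> a * r\<^sup>2 + b < r * t} r \<partial>lborel)"
      by (intro nn_integral_cong) (auto simp: indicator_def ennreal_mult')
    also have "\<dots> = ennreal t * (\<integral>\<^sup>+u. ennreal (C * (sqrt (1 - p\<^sup>2) / ?S u ^ m)) * indicator {0<..<1} u * indicator {?S u<..} t \<partial>lborel)"
    proof (cases "p < t")
      case True
      then show ?thesis using inner t1 by simp
    next
      case False
      \<comment> \<open>For t \<le> p both sides vanish: the ray misses the lens by the inequality
        of arithmetic and geometric means, and no level lies below p.\<close>
      have 1: "\<not> (0 < r \<and> a * r\<^sup>2 + b < r * t)" for r
      proof (cases "r > 0")
        case True
        have "0 \<le> (sqrt a * r - sqrt b)\<^sup>2" by simp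
        also have "\<dots> = a * r\<^sup>2 + b - r * p"
          using ab by (simp add: p(1) power2_diff power_mult_distrib real_sqrt_mult algebra_simps)
        finally have "r * p \<le> a * r\<^sup>2 + b" by simp
        moreover have "r * t \<le> r * p" using True False by (intro mult_left_mono) auto
        ultimately show ?thesis by simp
      qed simp
      have 2: "\<not> ?S u < t" for u
      proof -
        have "p = sqrt (p\<^sup>2)" using p0 by simp
        also have "\<dots> \<le> ?S u" using p0 p(2) by (intro real_sqrt_le_mono) (simp add: power_le_one)
        finally show ?thesis using False by simp
      qed
      show ?thesis using 1 2 by simp
    qed
    finally have "(\<integral>\<^sup>+r. ennreal (real ?n * r ^ (?n - 1)) * ?f r t * indicator {0<..} r \<partial>lborel) * indicator (cball 0 1) y
      = ennreal t * (\<integral>\<^sup>+u. ennreal (C * (sqrt (1 - p\<^sup>2) / ?S u ^ m)) * indicator {0<..<1} u * indicator {?S u<..} t \<partial>lborel) * indicator (cball 0 1) y"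
      by (simp only:)
    then show "(\<integral>\<^sup>+r. ennreal (real ?n * r ^ (?n - 1)) * ?f r (y $ i / norm y) * indicator {0<..} r \<partial>lborel) * indicator (cball 0 1) y
      = ennreal (dir_cos i y) * indicator (cball 0 1) y
      * (\<integral>\<^sup>+u. ennreal (C * (sqrt (1 - p\<^sup>2) / ?S u ^ m)) * indicator {0<..<1} u * indicator {?S u<..} (dir_cos i y) \<partial>lborel)"
      unfolding t_def by (simp only: dir_cos_def[symmetric] ac_simps)
  qed
  also have "\<dots> = ennreal (C * tail_const TYPE('n) * sqrt (1 - p\<^sup>2) ^ ?n * ell m ?n p)"
    by (rule lens_tail_value[OF p0 p(2) C])
  finally show ?thesis .
qed

lemma lens_W_integral:
  fixes i :: "'n::finite" and a b :: real
  assumes ab: "a > 0" "b > 0" and p1: "2 * sqrt (a * b) < 1"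
  shows "(\<integral>\<^sup>+x. ennreal (x $ i / norm x ^ (CARD('n) + 1)) * indicator (lens i a b) x \<partial>lborel)
    = ennreal (unit_ball_vol (real CARD('n)) * lens_W CARD('n) (2 * sqrt (a * b)))"
proof -
  let ?n = "CARD('n)"
  have n: "?n \<ge> 1" by (simp add: Suc_leI)
  define p where "p = 2 * sqrt (a * b)"
  have p: "0 < p" "p < 1" using ab p1 by (auto simp: p_def)
  have "(\<integral>\<^sup>+x. ennreal (norm x * dir_cos i x / norm x ^ (?n + 1)) * indicator (lens i a b) x \<partial>lborel)
    = ennreal ((2 * real ?n) * tail_const TYPE('n) * sqrt (1 - p\<^sup>2) ^ ?n * ell 1 ?n p)"
  proof (rule lens_integral_polar[OF ab p_def p(2), where \<phi> = "\<lambda>r t. r * t / r ^ (?n + 1)"])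
    fix t assume t: "p < t" "t \<le> 1"
    define s where "s = sqrt (t\<^sup>2 - p\<^sup>2)"
    note R = lens_radial_set[OF ab, of t, folded p_def, OF t(1), folded s_def]
    have "(\<integral>\<^sup>+r. ennreal (real ?n * r ^ (?n - 1) * (r * t / r ^ (?n + 1))) * indicator {r. 0 < r \<and> a * r\<^sup>2 + b < r * t} r \<partial>lborel)
      = (\<integral>\<^sup>+r. ennreal (real ?n * t / r) * indicator {(t - s) / (2 * a)<..<(t + s) / (2 * a)} r \<partial>lborel)"
    proof (intro nn_integral_cong)
      fix r :: real
      have "real ?n * r ^ (?n - 1) * (r * t / r ^ (?n + 1)) = real ?n * t / r" if "r > 0"
        using that n by (cases ?n) (auto simp: field_simps)
      then show "ennreal (real ?n * r ^ (?n - 1) * (r * t / r ^ (?n + 1))) * indicator {r. 0 < r \<and> a * r\<^sup>2 + b < r * t} r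
          = ennreal (real ?n * t / r) * indicator {(t - s) / (2 * a)<..<(t + s) / (2 * a)} r"
        using R(1)[of r] by (simp only: indicator_def mem_Collect_eq greaterThanLessThan_iff) (auto simp del: times_divide_eq_right)
    qed
    also have "\<dots> = ennreal (real ?n * t * ln ((t + s) / (2 * a)) - real ?n * t * ln ((t - s) / (2 * a)))"
    proof (rule nn_integral_FTC_Ioo)
      show "(t - s) / (2 * a) \<le> (t + s) / (2 * a)" using R ab by (intro divide_right_mono) auto
      have lo: "(t - s) / (2 * a) > 0" using R ab by (intro divide_pos_pos) auto
      show "continuous_on {(t - s) / (2 * a)..(t + s) / (2 * a)} (\<lambda>r. real ?n * t * ln r)"
        using lo by (intro continuous_intros) auto
      fix r assume "(t - s) / (2 * a) < r"
      then have r: "r > 0" using lo by linarith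
      show "((\<lambda>r. real ?n * t * ln r) has_real_derivative real ?n * t / r) (at r)"
        using DERIV_cmult[OF DERIV_ln[OF r], of "real ?n * t"] by (simp add: divide_inverse)
      show "0 \<le> real ?n * t / r" using r p t by simp
    qed
    \<comment> \<open>Along the chord the integrand is n t / r. Since t - s and t + s have the
      product p^2, the logarithm of the ratio of the endpoints is 2 (ln (t + s) - ln p); hence the
      constant C = 2 n.\<close>
    also have "real ?n * t * ln ((t + s) / (2 * a)) - real ?n * t * ln ((t - s) / (2 * a)) = t * (2 * real ?n * (ln (t + s) - ln p))"
    proof -
      have pos: "t - s > 0" "t + s > 0" using R by auto
      have "(t - s) * (t + s) = p * p" using R(4) ab by (simp add: p_def)
      then have "ln ((t - s) * (t + s)) = ln (p * p)" by simp
      then have "ln (t - s) + ln (t + s) = ln p + ln p" using pos p by (simp add: ln_mult)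
      moreover have "ln ((t + s) / (2 * a)) = ln (t + s) - ln (2 * a)" "ln ((t - s) / (2 * a)) = ln (t - s) - ln (2 * a)"
        using pos ab by (simp_all add: ln_div)
      ultimately have "ln ((t + s) / (2 * a)) - ln ((t - s) / (2 * a)) = 2 * (ln (t + s) - ln p)" by simp
      then have "real ?n * t * (ln ((t + s) / (2 * a)) - ln ((t - s) / (2 * a))) = real ?n * t * (2 * (ln (t + s) - ln p))"
        by simp
      then show ?thesis by (simp add: algebra_simps)
    qed
    also have "ennreal (t * (2 * real ?n * (ln (t + s) - ln p))) = ennreal t * ennreal (2 * real ?n * (ln (t + s) - ln p))"
      using t p by (intro ennreal_mult') auto
    also have "ennreal (2 * real ?n * (ln (t + s) - ln p)) = (\<integral>\<^sup>+u. ennreal (2 * real ?n * (sqrt (1 - p\<^sup>2) / sqrt (p\<^sup>2 + (1 - p\<^sup>2) * u\<^sup>2) ^ 1)) * indicator {0<..<1} u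
           * indicator {sqrt (p\<^sup>2 + (1 - p\<^sup>2) * u\<^sup>2)<..} t \<partial>lborel)"
      unfolding s_def by (rule lens_u_integral(1)[OF p t, symmetric]) simp
    finally show "(\<integral>\<^sup>+r. ennreal (real ?n * r ^ (?n - 1) * (r * t / r ^ (?n + 1))) * indicator {r. 0 < r \<and> a * r\<^sup>2 + b < r * t} r \<partial>lborel)
      = ennreal t * (\<integral>\<^sup>+u. ennreal (2 * real ?n * (sqrt (1 - p\<^sup>2) / sqrt (p\<^sup>2 + (1 - p\<^sup>2) * u\<^sup>2) ^ 1)) * indicator {0<..<1} u
           * indicator {sqrt (p\<^sup>2 + (1 - p\<^sup>2) * u\<^sup>2)<..} t \<partial>lborel)" .
  qed (simp, measurable)
  moreover have "norm x * dir_cos i x = x $ i" for x by (cases "x = 0") (auto simp: dir_cos_def)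
  moreover have "(2 * real ?n) * tail_const TYPE('n) * sqrt (1 - p\<^sup>2) ^ ?n * ell 1 ?n p = unit_ball_vol (real ?n) * lens_W ?n p"
    using n by (simp add: tail_const_def lens_W_def)
  ultimately show ?thesis by (simp add: p_def)
qed

text \<open>The chord has length s / a, and 1 / r^2 integrates to s / b over it because its
  endpoints have the product b / a. So the two integrals differ by the factor b / a only, and after
  normalisation their geometric mean is U p, whatever a and b are.\<close>

lemma lens_U_integral:
  fixes i :: "'n::finite" and a b :: real
  assumes ab: "a > 0" "b > 0" and p1: "2 * sqrt (a * b) < 1"
  defines "p \<equiv> 2 * sqrt (a * b)"
  shows "(\<integral>\<^sup>+x. ennreal (1 / norm x ^ (CARD('n) - 1)) * indicator (lens i a b) x \<partial>lborel)
    = ennreal (unit_ball_vol (real CARD('n)) * (p / (2 * a) * lens_U CARD('n) p))" (is ?U)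
    and "(\<integral>\<^sup>+x. ennreal (1 / norm x ^ (CARD('n) + 1)) * indicator (lens i a b) x \<partial>lborel)
    = ennreal (unit_ball_vol (real CARD('n)) * (p / (2 * b) * lens_U CARD('n) p))" (is ?V)
proof -
  let ?n = "CARD('n)"
  have n: "?n \<ge> 1" by (simp add: Suc_leI)
  have p: "0 < p" "p < 1" using ab p1 by (auto simp: p_def)
  have p_def': "p = 2 * sqrt (a * b)" by (simp add: p_def)
  have "(\<integral>\<^sup>+x. ennreal (1 / norm x ^ (?n - 1)) * indicator (lens i a b) x \<partial>lborel)
    = ennreal ((real ?n / a * p\<^sup>2) * tail_const TYPE('n) * sqrt (1 - p\<^sup>2) ^ ?n * ell 3 ?n p)"
  proof (rule lens_integral_polar[OF ab p_def' p(2), where \<phi> = "\<lambda>r t. 1 / r ^ (?n - 1)"])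
    fix t assume t: "p < t" "t \<le> 1"
    define s where "s = sqrt (t\<^sup>2 - p\<^sup>2)"
    note R = lens_radial_set[OF ab, of t, folded p_def, OF t(1), folded s_def]
    have "(\<integral>\<^sup>+r. ennreal (real ?n * r ^ (?n - 1) * (1 / r ^ (?n - 1))) * indicator {r. 0 < r \<and> a * r\<^sup>2 + b < r * t} r \<partial>lborel)
      = (\<integral>\<^sup>+r. ennreal (real ?n) * indicator {(t - s) / (2 * a)<..<(t + s) / (2 * a)} r \<partial>lborel)"
    proof (intro nn_integral_cong)
      fix r :: real
      have "real ?n * r ^ (?n - 1) * (1 / r ^ (?n - 1)) = real ?n" if "r > 0"
        using that by simp
      then show "ennreal (real ?n * r ^ (?n - 1) * (1 / r ^ (?n - 1))) * indicator {r. 0 < r \<and> a * r\<^sup>2 + b < r * t} r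
          = ennreal (real ?n) * indicator {(t - s) / (2 * a)<..<(t + s) / (2 * a)} r"
        using R(1)[of r] by (simp only: indicator_def mem_Collect_eq greaterThanLessThan_iff) (auto simp del: times_divide_eq_right)
    qed
    also have "\<dots> = ennreal (real ?n * ((t + s) / (2 * a)) - real ?n * ((t - s) / (2 * a)))"
    proof (rule nn_integral_FTC_Ioo)
      show "(t - s) / (2 * a) \<le> (t + s) / (2 * a)" using R ab by (intro divide_right_mono) auto
    qed (auto intro!: continuous_intros derivative_eq_intros)
    also have "real ?n * ((t + s) / (2 * a)) - real ?n * ((t - s) / (2 * a)) = t * (real ?n / a * (s / t))"
      using R ab by (simp add: field_simps)
    also have "ennreal (t * (real ?n / a * (s / t))) = ennreal t * ennreal (real ?n / a * (s / t))"
      using t p by (intro ennreal_mult') auto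
    also have "ennreal (real ?n / a * (s / t)) = (\<integral>\<^sup>+u. ennreal (real ?n / a * p\<^sup>2 * (sqrt (1 - p\<^sup>2) / sqrt (p\<^sup>2 + (1 - p\<^sup>2) * u\<^sup>2) ^ 3)) * indicator {0<..<1} u
           * indicator {sqrt (p\<^sup>2 + (1 - p\<^sup>2) * u\<^sup>2)<..} t \<partial>lborel)"
      unfolding s_def by (rule lens_u_integral(2)[OF p t, symmetric]) (use ab in simp)
    finally show "(\<integral>\<^sup>+r. ennreal (real ?n * r ^ (?n - 1) * (1 / r ^ (?n - 1))) * indicator {r. 0 < r \<and> a * r\<^sup>2 + b < r * t} r \<partial>lborel)
      = ennreal t * (\<integral>\<^sup>+u. ennreal (real ?n / a * p\<^sup>2 * (sqrt (1 - p\<^sup>2) / sqrt (p\<^sup>2 + (1 - p\<^sup>2) * u\<^sup>2) ^ 3)) * indicator {0<..<1} u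
           * indicator {sqrt (p\<^sup>2 + (1 - p\<^sup>2) * u\<^sup>2)<..} t \<partial>lborel)" .
  qed (use ab in simp, measurable)
  also have "(real ?n / a * p\<^sup>2) * tail_const TYPE('n) * sqrt (1 - p\<^sup>2) ^ ?n * ell 3 ?n p
     = unit_ball_vol (real ?n) * (p / (2 * a) * lens_U ?n p)"
    using n ab by (simp add: tail_const_def lens_U_def power2_eq_square mult_ac)
  finally show ?U .
  have "(\<integral>\<^sup>+x. ennreal (1 / norm x ^ (?n + 1)) * indicator (lens i a b) x \<partial>lborel)
    = ennreal ((real ?n / b * p\<^sup>2) * tail_const TYPE('n) * sqrt (1 - p\<^sup>2) ^ ?n * ell 3 ?n p)"
  proof (rule lens_integral_polar[OF ab p_def' p(2), where \<phi> = "\<lambda>r t. 1 / r ^ (?n + 1)"])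
    fix t assume t: "p < t" "t \<le> 1"
    define s where "s = sqrt (t\<^sup>2 - p\<^sup>2)"
    note R = lens_radial_set[OF ab, of t, folded p_def, OF t(1), folded s_def]
    have "(\<integral>\<^sup>+r. ennreal (real ?n * r ^ (?n - 1) * (1 / r ^ (?n + 1))) * indicator {r. 0 < r \<and> a * r\<^sup>2 + b < r * t} r \<partial>lborel)
      = (\<integral>\<^sup>+r. ennreal (real ?n / r\<^sup>2) * indicator {(t - s) / (2 * a)<..<(t + s) / (2 * a)} r \<partial>lborel)"
    proof (intro nn_integral_cong)
      fix r :: real
      have "real ?n * r ^ (?n - 1) * (1 / r ^ (?n + 1)) = real ?n / r\<^sup>2" if "r > 0"
        using that n by (cases ?n) (auto simp: field_simps power2_eq_square)
      then show "ennreal (real ?n * r ^ (?n - 1) * (1 / r ^ (?n + 1))) * indicator {r. 0 < r \<and> a * r\<^sup>2 + b < r * t} r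
          = ennreal (real ?n / r\<^sup>2) * indicator {(t - s) / (2 * a)<..<(t + s) / (2 * a)} r"
        using R(1)[of r] by (simp only: indicator_def mem_Collect_eq greaterThanLessThan_iff) (auto simp del: times_divide_eq_right)
    qed
    also have "\<dots> = ennreal (- (real ?n * inverse ((t + s) / (2 * a))) - - (real ?n * inverse ((t - s) / (2 * a))))"
    proof (rule nn_integral_FTC_Ioo)
      show "(t - s) / (2 * a) \<le> (t + s) / (2 * a)" using R ab by (intro divide_right_mono) auto
      have lo: "(t - s) / (2 * a) > 0" using R ab by (intro divide_pos_pos) auto
      show "continuous_on {(t - s) / (2 * a)..(t + s) / (2 * a)} (\<lambda>r. - (real ?n * inverse r))"
        using lo by (intro continuous_intros) auto
      fix r assume "(t - s) / (2 * a) < r"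
      then have r: "r > 0" using lo by linarith
      show "((\<lambda>r. - (real ?n * inverse r)) has_real_derivative real ?n / r\<^sup>2) (at r)"
        using r by (auto intro!: derivative_eq_intros simp: field_simps power2_eq_square)
    qed simp
    also have "- (real ?n * inverse ((t + s) / (2 * a))) - - (real ?n * inverse ((t - s) / (2 * a))) = t * (real ?n / b * (s / t))"
    proof -
      have pos: "t - s > 0" "t + s > 0" "t > 0" using R by auto
      have "- (real ?n * inverse ((t + s) / (2 * a))) - - (real ?n * inverse ((t - s) / (2 * a)))
         = real ?n * (4 * a * s) / ((t - s) * (t + s))"
        using pos ab by (simp add: divide_simps) (simp add: algebra_simps)
      also have "\<dots> = t * (real ?n / b * (s / t))"
        unfolding R(4) using pos ab by simp
      finally show ?thesis .
    qed
    also have "ennreal (t * (real ?n / b * (s / t))) = ennreal t * ennreal (real ?n / b * (s / t))"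
      using t p by (intro ennreal_mult') auto
    also have "ennreal (real ?n / b * (s / t)) = (\<integral>\<^sup>+u. ennreal (real ?n / b * p\<^sup>2 * (sqrt (1 - p\<^sup>2) / sqrt (p\<^sup>2 + (1 - p\<^sup>2) * u\<^sup>2) ^ 3)) * indicator {0<..<1} u
           * indicator {sqrt (p\<^sup>2 + (1 - p\<^sup>2) * u\<^sup>2)<..} t \<partial>lborel)"
      unfolding s_def by (rule lens_u_integral(2)[OF p t, symmetric]) (use ab in simp)
    finally show "(\<integral>\<^sup>+r. ennreal (real ?n * r ^ (?n - 1) * (1 / r ^ (?n + 1))) * indicator {r. 0 < r \<and> a * r\<^sup>2 + b < r * t} r \<partial>lborel)
      = ennreal t * (\<integral>\<^sup>+u. ennreal (real ?n / b * p\<^sup>2 * (sqrt (1 - p\<^sup>2) / sqrt (p\<^sup>2 + (1 - p\<^sup>2) * u\<^sup>2) ^ 3)) * indicator {0<..<1} u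
           * indicator {sqrt (p\<^sup>2 + (1 - p\<^sup>2) * u\<^sup>2)<..} t \<partial>lborel)" .
  qed (use ab in simp, measurable)
  also have "(real ?n / b * p\<^sup>2) * tail_const TYPE('n) * sqrt (1 - p\<^sup>2) ^ ?n * ell 3 ?n p
     = unit_ball_vol (real ?n) * (p / (2 * b) * lens_U ?n p)"
    using n ab by (simp add: tail_const_def lens_U_def power2_eq_square mult_ac)
  finally show ?V .
qed

section \<open>Admissible densities\<close>

lemma sets_lbn [measurable_cong, simp]:
  "sets (lebesgue_ball_normalized :: (real ^ 'n::finite) measure) = sets lebesgue"
  by (simp add: lebesgue_ball_normalized_def)

lemma borel_measurable_lbn_iff:
  "f \<in> borel_measurable (lebesgue_ball_normalized :: (real ^ 'n::finite) measure) \<longleftrightarrow> f \<in> borel_measurable lebesgue"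
  by (simp add: lebesgue_ball_normalized_def)

lemma borel_measurable_lbn_borel:
  "f \<in> borel_measurable borel \<Longrightarrow> f \<in> borel_measurable (lebesgue_ball_normalized :: (real ^ 'n::finite) measure)"
  unfolding borel_measurable_lbn_iff by (intro measurable_completion) simp

lemma has_bochner_integral_lbn:
  fixes f :: "real ^ 'n::finite \<Rightarrow> real"
  assumes f [measurable]: "f \<in> borel_measurable borel" and nonneg: "\<And>x. 0 \<le> f x" and I: "I \<ge> 0"
    and nn: "(\<integral>\<^sup>+x. ennreal (f x) \<partial>lborel) = ennreal (unit_ball_vol (real CARD('n)) * I)"
  shows "has_bochner_integral lebesgue_ball_normalized f I"
proof (rule has_bochner_integral_nn_integral)
  show "f \<in> borel_measurable lebesgue_ball_normalized"
    using f by (rule borel_measurable_lbn_borel)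
  have "(\<lambda>x. ennreal (f x)) \<in> borel_measurable lebesgue"
    by (intro measurable_completion) simp
  then have "(\<integral>\<^sup>+x. ennreal (f x) \<partial>lebesgue_ball_normalized)
     = ennreal (1 / unit_ball_vol (real CARD('n))) * (\<integral>\<^sup>+x. ennreal (f x) \<partial>lborel)"
    unfolding lebesgue_ball_normalized_def
    by (simp add: nn_integral_density nn_integral_cmult nn_integral_completion)
  also have "\<dots> = ennreal (1 / unit_ball_vol (real CARD('n)) * (unit_ball_vol (real CARD('n)) * I))"
    unfolding nn by (intro ennreal_mult'[symmetric]) simp
  also have "1 / unit_ball_vol (real CARD('n)) * (unit_ball_vol (real CARD('n)) * I) = I"
  proof -
    have "unit_ball_vol (real CARD('n)) \<noteq> 0"
      by (rule less_imp_neq[THEN not_sym]) simp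
    then show ?thesis by simp
  qed
  finally show "(\<integral>\<^sup>+x. ennreal (f x) \<partial>lebesgue_ball_normalized) = ennreal I" .
qed (use nonneg I in auto)

text \<open>Under x |-> -x the left-hand integral changes its sign and the two others are invariant;
  this turns the bound for that integral into one for its absolute value.\<close>

lemma lbn_reflect:
  "distr lebesgue_ball_normalized lebesgue uminus = (lebesgue_ball_normalized :: (real ^ 'n::finite) measure)"
  and measurable_uminus_lebesgue: "(uminus :: real ^ 'n \<Rightarrow> real ^ 'n) \<in> lebesgue \<rightarrow>\<^sub>M lebesgue"
proof -
  have T: "(\<lambda>x::real^'n. 0 + (\<Sum>j\<in>Basis. (- 1 * (x \<bullet> j)) *\<^sub>R j)) = uminus"
    by (rule ext) (simp add: sum_negf euclidean_representation)
  show meas: "(uminus :: real ^ 'n \<Rightarrow> real ^ 'n) \<in> lebesgue \<rightarrow>\<^sub>M lebesgue"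
    using lebesgue_affine_measurable[of "\<lambda>_::real^'n. - 1" 0] unfolding T by simp
  have "lebesgue = density (distr lebesgue lebesgue (uminus :: real ^ 'n \<Rightarrow> real ^ 'n)) (\<lambda>_. 1)"
    using lebesgue_affine_euclidean[of "\<lambda>_::real^'n. - 1" 0] unfolding T by simp
  then have leb: "distr lebesgue lebesgue (uminus :: real ^ 'n \<Rightarrow> real ^ 'n) = lebesgue"
    by (simp add: density_1)
  let ?c = "\<lambda>_::real^'n. ennreal (1 / unit_ball_vol (real CARD('n)))"
  have "distr (density lebesgue ?c) lebesgue uminus = density (distr lebesgue lebesgue uminus) ?c"
    by (rule density_distr[symmetric]) (use meas in auto)
  then show "distr lebesgue_ball_normalized lebesgue uminus = (lebesgue_ball_normalized :: (real ^ 'n::finite) measure)"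
    unfolding leb lebesgue_ball_normalized_def .
qed

lemma integral_lbn_reflect:
  fixes f :: "real ^ 'n::finite \<Rightarrow> real"
  assumes "f \<in> borel_measurable lebesgue"
  shows "(LINT x|lebesgue_ball_normalized. f (- x)) = (LINT x|lebesgue_ball_normalized. f x)"
    and "integrable lebesgue_ball_normalized (\<lambda>x. f (- x)) \<longleftrightarrow> integrable lebesgue_ball_normalized f"
proof -
  have m: "uminus \<in> lebesgue_ball_normalized \<rightarrow>\<^sub>M (lebesgue :: (real ^ 'n) measure)"
    using measurable_uminus_lebesgue
    by (simp add: measurable_cong_sets[OF sets_lbn refl])
  show "(LINT x|lebesgue_ball_normalized. f (- x)) = (LINT x|lebesgue_ball_normalized. f x)"
    using integral_distr[OF m assms] by (simp add: lbn_reflect)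
  show "integrable lebesgue_ball_normalized (\<lambda>x. f (- x)) \<longleftrightarrow> integrable lebesgue_ball_normalized f"
    using integrable_distr_eq[OF m assms] by (simp add: lbn_reflect)
qed

lemma borel_in_lebesgue_measurable:
  "f \<in> borel_measurable borel \<Longrightarrow> f \<in> borel_measurable (lebesgue :: (real ^ 'n::finite) measure)"
  by (intro measurable_completion) simp

lemma admissible_measurable:
  fixes \<rho> :: "real ^ 'n::finite \<Rightarrow> real"
  assumes "admissible \<rho>"
  shows "(\<lambda>x. \<rho> x / norm x ^ k) \<in> borel_measurable lebesgue"
    and "(\<lambda>x. x $ i * \<rho> x / norm x ^ k) \<in> borel_measurable lebesgue"
proof -
  have [measurable]: "\<rho> \<in> borel_measurable lebesgue" using assms by (simp add: admissible_def)
  have [measurable]: "(\<lambda>x::real^'n. norm x ^ k) \<in> borel_measurable lebesgue"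
    "(\<lambda>x::real^'n. x $ i) \<in> borel_measurable lebesgue"
    by (intro borel_in_lebesgue_measurable; measurable)+
  show "(\<lambda>x. \<rho> x / norm x ^ k) \<in> borel_measurable lebesgue" by measurable
  show "(\<lambda>x. x $ i * \<rho> x / norm x ^ k) \<in> borel_measurable lebesgue" by measurable
qed

lemma admissible_reflect:
  fixes \<rho> :: "real ^ 'n::finite \<Rightarrow> real"
  assumes \<rho>: "admissible \<rho>"
  shows "admissible (\<lambda>x. \<rho> (- x))"
proof -
  have m: "\<rho> \<in> borel_measurable lebesgue" using \<rho> by (simp add: admissible_def)
  have "(\<lambda>x. \<rho> (- x)) \<in> borel_measurable lebesgue"
    by (rule measurable_compose[OF measurable_uminus_lebesgue m])
  moreover have "0 \<notin> closure {x. \<rho> (- x) \<noteq> 0}"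
  proof -
    have "0 \<notin> closure {x. \<rho> x \<noteq> 0}" using \<rho> by (simp add: admissible_def)
    then obtain e where e: "e > 0" "\<And>y. \<rho> y \<noteq> 0 \<Longrightarrow> \<not> norm y < e"
      by (auto simp: closure_approachable)
    have "\<not> norm y < e" if "\<rho> (- y) \<noteq> 0" for y
      using e(2)[OF that] by simp
    then show ?thesis using e(1) by (auto simp: closure_approachable)
  qed
  moreover have "integrable lebesgue_ball_normalized (\<lambda>x. \<rho> (- x) / norm x ^ k)
      \<longleftrightarrow> integrable lebesgue_ball_normalized (\<lambda>x. \<rho> x / norm x ^ k)" for k
    using integral_lbn_reflect(2)[OF admissible_measurable(1)[OF \<rho>, of k]] by simp
  ultimately show ?thesis using \<rho> by (simp add: admissible_def del: power_Suc)
qed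

lemma lens_has_integrals:
  fixes i :: "'n::finite" and a b :: real
  assumes ab: "a > 0" "b > 0" and p1: "2 * sqrt (a * b) < 1"
  defines "p \<equiv> 2 * sqrt (a * b)"
  shows "has_bochner_integral lebesgue_ball_normalized (\<lambda>x. indicator (lens i a b) x / norm x ^ (CARD('n) - 1))
      (p / (2 * a) * lens_U CARD('n) p)" (is ?U)
    and "has_bochner_integral lebesgue_ball_normalized (\<lambda>x. indicator (lens i a b) x / norm x ^ (CARD('n) + 1))
      (p / (2 * b) * lens_U CARD('n) p)" (is ?V)
    and "has_bochner_integral lebesgue_ball_normalized (\<lambda>x. x $ i * indicator (lens i a b) x / norm x ^ (CARD('n) + 1))
      (lens_W CARD('n) p)" (is ?W)
proof -
  have p: "0 < p" "p < 1" using ab p1 by (auto simp: p_def)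
  have U: "0 \<le> lens_U CARD('n) p" and W: "0 \<le> lens_W CARD('n) p"
    using lens_U_pos[OF p] lens_W_pos[OF p] by (auto intro: less_imp_le)
  show ?U
  proof (rule has_bochner_integral_lbn)
    show "(\<integral>\<^sup>+x. ennreal (indicator (lens i a b) x / norm x ^ (CARD('n) - 1)) \<partial>lborel)
       = ennreal (unit_ball_vol (real CARD('n)) * (p / (2 * a) * lens_U CARD('n) p))"
      unfolding lens_U_integral(1)[OF ab p1, of i, folded p_def, symmetric]
      by (intro nn_integral_cong) (auto simp: indicator_def)
  qed (use U p ab in auto)
  show ?V
  proof (rule has_bochner_integral_lbn)
    show "(\<integral>\<^sup>+x. ennreal (indicator (lens i a b) x / norm x ^ (CARD('n) + 1)) \<partial>lborel)
       = ennreal (unit_ball_vol (real CARD('n)) * (p / (2 * b) * lens_U CARD('n) p))"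
      unfolding lens_U_integral(2)[OF ab p1, of i, folded p_def, symmetric]
      by (intro nn_integral_cong) (auto simp: indicator_def)
  qed (use U p ab in auto)
  have pos: "0 < x $ i" if "x \<in> lens i a b" for x
  proof -
    have "0 \<le> a * (norm x)\<^sup>2" using ab by simp
    then show ?thesis using that ab unfolding lens_def mem_Collect_eq by linarith
  qed
  show ?W
  proof (rule has_bochner_integral_lbn)
    show "(\<integral>\<^sup>+x. ennreal (x $ i * indicator (lens i a b) x / norm x ^ (CARD('n) + 1)) \<partial>lborel)
       = ennreal (unit_ball_vol (real CARD('n)) * lens_W CARD('n) p)"
      unfolding lens_W_integral[OF ab p1, of i, folded p_def, symmetric]
      by (intro nn_integral_cong) (auto simp: indicator_def)
    show "0 \<le> x $ i * indicator (lens i a b) x / norm x ^ (CARD('n) + 1)" for x :: "real ^ 'n"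
      using pos[of x] by (auto simp: indicator_def)
  qed (use W in auto)
qed

lemma admissible_lens:
  fixes i :: "'n::finite" and a b :: real
  assumes ab: "a > 0" "b > 0" and p1: "2 * sqrt (a * b) < 1"
  shows "admissible (indicator (lens i a b) :: real ^ 'n \<Rightarrow> real)"
  unfolding admissible_def
proof (intro conjI allI)
  show "(indicator (lens i a b) :: real ^ 'n \<Rightarrow> real) \<in> borel_measurable lebesgue"
    by (rule borel_in_lebesgue_measurable) simp
  \<comment> \<open>The closed region given by the weak inequality contains the support and still
    misses 0, because b > 0.\<close>
  have "closed {x::real^'n. a * (norm x)\<^sup>2 + b \<le> x $ i}"
    by (intro closed_Collect_le continuous_intros)
  moreover have "{x. indicator (lens i a b) x \<noteq> (0::real)} \<subseteq> {x. a * (norm x)\<^sup>2 + b \<le> x $ i}"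
    by (auto simp: indicator_def lens_def)
  ultimately have "closure {x. indicator (lens i a b) x \<noteq> (0::real)} \<subseteq> {x. a * (norm x)\<^sup>2 + b \<le> x $ i}"
    by (intro closure_minimal)
  then show "0 \<notin> closure {x. indicator (lens i a b) x \<noteq> (0::real)}" using ab by auto
qed (use lens_has_integrals[OF ab p1, of i] in \<open>auto simp: has_bochner_integral_iff\<close>)

text \<open>From |x_i| \<le> |x| \<le> |x|^2 + 1 the integrand is dominated by the sum of the two
  integrands on the right-hand side.\<close>

lemma admissible_integrable:
  fixes \<rho> :: "real ^ 'n::finite \<Rightarrow> real"
  assumes \<rho>: "admissible \<rho>"
  shows "integrable lebesgue_ball_normalized (\<lambda>x. x $ i * \<rho> x / norm x ^ (CARD('n) + 1))"
proof (rule Bochner_Integration.integrable_bound)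
  let ?n = "CARD('n)"
  show "integrable lebesgue_ball_normalized (\<lambda>x. \<rho> x / norm x ^ (?n - 1) + \<rho> x / norm x ^ (?n + 1))"
    using \<rho> by (intro Bochner_Integration.integrable_add) (auto simp: admissible_def)
  show "(\<lambda>x. x $ i * \<rho> x / norm x ^ (?n + 1)) \<in> borel_measurable lebesgue_ball_normalized"
    unfolding borel_measurable_lbn_iff by (rule admissible_measurable[OF \<rho>])
  show "AE x in lebesgue_ball_normalized. norm (x $ i * \<rho> x / norm x ^ (?n + 1))
      \<le> norm (\<rho> x / norm x ^ (?n - 1) + \<rho> x / norm x ^ (?n + 1))"
  proof (rule AE_I2)
    fix x :: "real ^ 'n"
    have r: "0 \<le> \<rho> x" using \<rho> by (simp add: admissible_def)
    show "norm (x $ i * \<rho> x / norm x ^ (?n + 1)) \<le> norm (\<rho> x / norm x ^ (?n - 1) + \<rho> x / norm x ^ (?n + 1))"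
    proof (cases "x = 0")
      case False
      have n: "?n + 1 = (?n - 1) + 2" using zero_less_card_finite[where 'a = 'n] by simp
      have eq: "\<rho> x / norm x ^ (?n - 1) + \<rho> x / norm x ^ (?n + 1) = ((norm x)\<^sup>2 + 1) * \<rho> x / norm x ^ (?n + 1)"
        unfolding n power_add using False by (simp add: field_simps)
      have "0 \<le> (norm x - 1)\<^sup>2" by simp
      then have "2 * norm x \<le> (norm x)\<^sup>2 + 1" by (simp add: power2_diff)
      then have "norm x \<le> (norm x)\<^sup>2 + 1" using norm_ge_zero[of x] by linarith
      then have "\<bar>x $ i\<bar> \<le> (norm x)\<^sup>2 + 1" using component_le_norm_cart[of x i] by linarith
      then have "\<bar>x $ i\<bar> * \<rho> x / norm x ^ (?n + 1) \<le> ((norm x)\<^sup>2 + 1) * \<rho> x / norm x ^ (?n + 1)"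
        using r by (intro divide_right_mono mult_right_mono) auto
      then show ?thesis unfolding eq using r by (simp add: abs_mult)
    qed (use r in simp)
  qed
qed

text \<open>Bang-bang principle: for fixed multipliers the linear functional is maximised by the
  indicator of the lens on which its integrand is positive.\<close>
lemma admissible_le_lens:
  fixes i :: "'n::finite" and \<rho> :: "real ^ 'n \<Rightarrow> real" and a b :: real
  assumes ab: "a > 0" "b > 0" and p1: "2 * sqrt (a * b) < 1" and \<rho>: "admissible \<rho>"
  defines "p \<equiv> 2 * sqrt (a * b)"
  shows "(LINT x|lebesgue_ball_normalized. x $ i * \<rho> x / norm x ^ (CARD('n) + 1))
    \<le> lens_W CARD('n) p - p * lens_U CARD('n) p
      + a * (LINT x|lebesgue_ball_normalized. \<rho> x / norm x ^ (CARD('n) - 1))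
      + b * (LINT x|lebesgue_ball_normalized. \<rho> x / norm x ^ (CARD('n) + 1))"
proof -
  let ?n = "CARD('n)" and ?M = "lebesgue_ball_normalized :: (real ^ 'n) measure"
  let ?F = "\<lambda>\<rho> x. x $ i * \<rho> x / norm x ^ (?n + 1) - a * (\<rho> x / norm x ^ (?n - 1)) - b * (\<rho> x / norm x ^ (?n + 1)) :: real"
  let ?L = "indicator (lens i a b) :: real ^ 'n \<Rightarrow> real"
  have int: "integrable ?M (?F \<rho>)"
    "integral\<^sup>L ?M (?F \<rho>) = (LINT x|?M. x $ i * \<rho> x / norm x ^ (?n + 1))
      - a * (LINT x|?M. \<rho> x / norm x ^ (?n - 1)) - b * (LINT x|?M. \<rho> x / norm x ^ (?n + 1))"
    if "admissible \<rho>" for \<rho>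
  proof -
    have I: "integrable ?M (\<lambda>x. x $ i * \<rho> x / norm x ^ (?n + 1))" "integrable ?M (\<lambda>x. \<rho> x / norm x ^ (?n - 1))"
      "integrable ?M (\<lambda>x. \<rho> x / norm x ^ (?n + 1))"
      using admissible_integrable[OF that] that by (auto simp: admissible_def)
    show "integrable ?M (?F \<rho>)"
      by (intro Bochner_Integration.integrable_diff integrable_mult_right I)
    show "integral\<^sup>L ?M (?F \<rho>) = (LINT x|?M. x $ i * \<rho> x / norm x ^ (?n + 1))
      - a * (LINT x|?M. \<rho> x / norm x ^ (?n - 1)) - b * (LINT x|?M. \<rho> x / norm x ^ (?n + 1))"
      by (simp only: Bochner_Integration.integral_diff Bochner_Integration.integrable_diff
          integrable_mult_right I integral_mult_right_zero)
  qed
  have "integral\<^sup>L ?M (?F \<rho>) \<le> integral\<^sup>L ?M (?F ?L)"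
  proof (rule integral_mono[OF int(1)[OF \<rho>] int(1)[OF admissible_lens[OF ab p1]]])
    fix x :: "real ^ 'n"
    have r: "0 \<le> \<rho> x" "\<rho> x \<le> 1" using \<rho> by (auto simp: admissible_def)
    show "?F \<rho> x \<le> ?F ?L x"
    proof (cases "x = 0")
      \<comment> \<open>At the origin the factorisation \<open>F\<close> used below fails. For n = 1
        the term with the exponent n - 1 = 0 is not erased by division by zero, so its sign is
        needed.\<close>
      case True
      have "0 \<le> a * (\<rho> 0 / norm (0 :: real ^ 'n) ^ (?n - 1))" "(0 :: real ^ 'n) \<notin> lens i a b"
        using ab \<rho> by (auto simp: lens_def admissible_def)
      then show ?thesis using True by simp
    next
      case False
      have n: "?n + 1 = (?n - 1) + 2" using zero_less_card_finite[where 'a = 'n] by simp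
      have F: "?F \<sigma> x = (x $ i - a * (norm x)\<^sup>2 - b) * \<sigma> x / norm x ^ (?n + 1)" for \<sigma> :: "real ^ 'n \<Rightarrow> real"
        unfolding n power_add using False by (simp add: field_simps)
      have "(x $ i - a * (norm x)\<^sup>2 - b) * \<rho> x \<le> (x $ i - a * (norm x)\<^sup>2 - b) * ?L x"
      proof (cases "x \<in> lens i a b")
        case True
        then have "x $ i - a * (norm x)\<^sup>2 - b \<ge> 0" by (simp add: lens_def)
        then show ?thesis using True r by (simp add: mult_left_le)
      next
        case False
        then have "x $ i - a * (norm x)\<^sup>2 - b \<le> 0" by (simp add: lens_def)
        then show ?thesis using False r by (simp add: mult_nonpos_nonneg)
      qed
      then show ?thesis unfolding F by (intro divide_right_mono) auto
    qed
  qed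
  also have "integral\<^sup>L ?M (?F ?L) = lens_W ?n p - a * (p / (2 * a) * lens_U ?n p) - b * (p / (2 * b) * lens_U ?n p)"
    unfolding int(2)[OF admissible_lens[OF ab p1]]
    using lens_has_integrals[OF ab p1, of i, folded p_def] by (simp add: has_bochner_integral_iff)
  also have "\<dots> = lens_W ?n p - p * lens_U ?n p"
    using ab by (simp add: field_simps)
  finally show ?thesis unfolding int(2)[OF \<rho>] by simp
qed

text \<open>The bang-bang inequality with multipliers q / 2, q / 2 is tested on the indicator of the
  lens with a = b = p / 2, whose two right-hand integrals are both U p.\<close>

lemma lens_optimality_card: "lens_optimality CARD('n::finite)"
proof
  show "CARD('n) \<ge> 1" by (simp add: Suc_leI)
  fix p q :: real assume pq: "0 < p" "p < 1" "0 < q" "q < 1"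
  obtain i :: 'n where True by simp
  have e: "2 * sqrt (r / 2 * (r / 2)) = r" if "0 < r" for r :: real
    unfolding real_sqrt_abs2 using that by simp
  let ?L = "indicator (lens i (p / 2) (p / 2)) :: real ^ 'n \<Rightarrow> real"
  have "admissible ?L" using pq e[of p] by (intro admissible_lens) auto
  moreover have "(LINT x|lebesgue_ball_normalized. x $ i * ?L x / norm x ^ (CARD('n) + 1)) = lens_W CARD('n) p"
    "(LINT x|lebesgue_ball_normalized. ?L x / norm x ^ (CARD('n) - 1)) = lens_U CARD('n) p"
    "(LINT x|lebesgue_ball_normalized. ?L x / norm x ^ (CARD('n) + 1)) = lens_U CARD('n) p"
    using lens_has_integrals[of "p / 2" "p / 2" i] pq unfolding e[OF pq(1)]
    by (simp_all add: has_bochner_integral_iff)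
  ultimately show "lens_W CARD('n) p - q * lens_U CARD('n) p \<le> lens_W CARD('n) q - q * lens_U CARD('n) q"
    using admissible_le_lens[of "q / 2" "q / 2" ?L i] pq unfolding e[OF pq(3)] by simp
qed

text \<open>Among the multipliers with 2 sqrt (a b) = p these minimise a u + b v. If U p = sqrt (u
  v), they also describe the scaled lens whose two integrals are exactly u and v.\<close>

lemma lens_multipliers:
  fixes p u v :: real
  assumes "p > 0" "u > 0" "v > 0"
  defines "a \<equiv> p / 2 * sqrt (v / u)" and "b \<equiv> p / 2 * sqrt (u / v)"
  shows "a > 0" "b > 0" "2 * sqrt (a * b) = p"
    and "a * u = p / 2 * sqrt (u * v)" "b * v = p / 2 * sqrt (u * v)"
proof -
  show ab: "a > 0" "b > 0" using assms by simp_all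
  have "a * b = (p / 2)\<^sup>2 * (sqrt (v / u) * sqrt (u / v))"
    unfolding a_def b_def by (simp only: power2_eq_square ac_simps)
  also have "sqrt (v / u) * sqrt (u / v) = 1"
    using assms(2,3) by (simp flip: real_sqrt_mult)
  finally show "2 * sqrt (a * b) = p" using assms(1) by simp
  have "sqrt (v / u) * u = sqrt (u * v)" "sqrt (u / v) * v = sqrt (u * v)"
    using assms(2,3) by (simp_all add: real_sqrt_divide real_sqrt_mult field_simps)
  then show "a * u = p / 2 * sqrt (u * v)" "b * v = p / 2 * sqrt (u * v)"
    unfolding a_def b_def by simp_all
qed

lemma admissible_le_lens_Phi:
  fixes i :: "'n::finite" and \<rho> :: "real ^ 'n \<Rightarrow> real"
  assumes \<rho>: "admissible \<rho>"
  shows "(LINT x|lebesgue_ball_normalized. x $ i * \<rho> x / norm x ^ (CARD('n) + 1))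
    \<le> lens_Phi CARD('n) (sqrt ((LINT x|lebesgue_ball_normalized. \<rho> x / norm x ^ (CARD('n) - 1)) *
                    (LINT x|lebesgue_ball_normalized. \<rho> x / norm x ^ (CARD('n) + 1))))"
proof -
  let ?n = "CARD('n)" and ?M = "lebesgue_ball_normalized :: (real ^ 'n) measure"
  interpret lens_optimality ?n by (rule lens_optimality_card)
  define u where "u = (LINT x|?M. \<rho> x / norm x ^ (?n - 1))"
  define v where "v = (LINT x|?M. \<rho> x / norm x ^ (?n + 1))"
  have r: "0 \<le> \<rho> x" for x using \<rho> by (auto simp: admissible_def)
  have uv: "u \<ge> 0" "v \<ge> 0" unfolding u_def v_def using r by (auto intro!: integral_nonneg_AE)
  have I: "integrable ?M (\<lambda>x. \<rho> x / norm x ^ (?n - 1))" "integrable ?M (\<lambda>x. \<rho> x / norm x ^ (?n + 1))"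
    using \<rho> by (auto simp: admissible_def)
  \<comment> \<open>The multipliers exist only for positive u and v. If one of these integrals is 0,
    then \<open>\<rho> x / norm x ^ k\<close> vanishes almost everywhere, and so does the left-hand
    integrand, at x = 0 because x_i = 0.\<close>
  have vanish: "(LINT x|?M. x $ i * \<rho> x / norm x ^ (?n + 1)) = 0"
    if "integrable ?M (\<lambda>x. \<rho> x / norm x ^ k)" "(LINT x|?M. \<rho> x / norm x ^ k) = 0" for k
  proof -
    have "AE x in ?M. \<rho> x / norm x ^ k = 0"
      using that integral_nonneg_eq_0_iff_AE[OF that(1)] r by simp
    then have "AE x in ?M. x $ i * \<rho> x / norm x ^ (?n + 1) = 0"
      by eventually_elim auto
    then show ?thesis by (rule integral_eq_zero_AE)
  qed
  show ?thesis
  proof (cases "u > 0 \<and> v > 0")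
    case True
    define p where "p = lens_P ?n (sqrt (u * v))"
    have s: "sqrt (u * v) > 0" using True by simp
    have p: "0 < p" "p < 1" "lens_U ?n p = sqrt (u * v)"
      using lens_P[of "sqrt (u * v)"] lens_P_less_1[OF s] s by (auto simp: p_def)
    define a where "a = p / 2 * sqrt (v / u)"
    define b where "b = p / 2 * sqrt (u / v)"
    have uv: "u > 0" "v > 0" using True by auto
    note m = lens_multipliers[OF p(1) uv, folded a_def b_def]
    have p1: "2 * sqrt (a * b) < 1" using m(3) p by simp
    \<comment> \<open>Because U p = sqrt (u v), the two multiplier terms add up to p U p and cancel
      the negative term, leaving W p.\<close>
    have "(LINT x|?M. x $ i * \<rho> x / norm x ^ (?n + 1))
       \<le> lens_W ?n p - p * lens_U ?n p + p / 2 * sqrt (u * v) + p / 2 * sqrt (u * v)"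
      using admissible_le_lens[OF m(1,2) p1 \<rho>, of i] unfolding u_def[symmetric] v_def[symmetric] m(3,4,5) .
    then show ?thesis unfolding u_def[symmetric] v_def[symmetric] lens_Phi_def p_def[symmetric]
      by (simp add: p(3))
  next
    case False
    then have "u = 0 \<or> v = 0" using uv by auto
    then have X: "(LINT x|?M. x $ i * \<rho> x / norm x ^ (?n + 1)) = 0"
      using vanish[OF I(1)] vanish[OF I(2)] by (auto simp: u_def v_def)
    have "sqrt (u * v) = 0" using \<open>u = 0 \<or> v = 0\<close> by auto
    then show ?thesis unfolding u_def[symmetric] v_def[symmetric] X by (simp only: lens_Phi_0)
  qed
qed

theorem theorem2p5:
  fixes i :: "'n::finite"
  shows "\<exists>\<Phi> :: real \<Rightarrow> real.
    (solves_initial_problem CARD('n) \<Phi> \<and> asymptotic_condition CARD('n) \<Phi>) \<and>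
    (\<forall>\<Psi>. solves_initial_problem CARD('n) \<Psi> \<and> asymptotic_condition CARD('n) \<Psi>
          \<longrightarrow> (\<forall>s\<ge>0. \<Psi> s = \<Phi> s)) \<and>
    (\<forall>\<rho> :: real ^ 'n \<Rightarrow> real. admissible \<rho> \<longrightarrow>
       \<bar>LINT x|lebesgue_ball_normalized. x $ i * \<rho> x / norm x ^ (CARD('n) + 1)\<bar>
         \<le> \<Phi> (sqrt ((LINT x|lebesgue_ball_normalized. \<rho> x / norm x ^ (CARD('n) - 1)) *
                    (LINT x|lebesgue_ball_normalized. \<rho> x / norm x ^ (CARD('n) + 1))))) \<and>
    (\<forall>u>0. \<forall>v>0.
       (SUP \<rho> \<in> {\<rho> :: real ^ 'n \<Rightarrow> real. admissible \<rho> \<and>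
                 (LINT x|lebesgue_ball_normalized. \<rho> x / norm x ^ (CARD('n) - 1)) = u \<and>
                 (LINT x|lebesgue_ball_normalized. \<rho> x / norm x ^ (CARD('n) + 1)) = v}.
          ereal \<bar>LINT x|lebesgue_ball_normalized. x $ i * \<rho> x / norm x ^ (CARD('n) + 1)\<bar>)
       = ereal (\<Phi> (sqrt (u * v))))"
proof -
  let ?n = "CARD('n)" and ?M = "lebesgue_ball_normalized :: (real ^ 'n) measure"
  let ?X = "\<lambda>\<rho>. LINT x|?M. x $ i * \<rho> x / norm x ^ (?n + 1)"
  let ?U = "\<lambda>\<rho>. LINT x|?M. \<rho> x / norm x ^ (?n - 1)"
  let ?V = "\<lambda>\<rho>. LINT x|?M. \<rho> x / norm x ^ (?n + 1)"
  interpret lens_optimality ?n by (rule lens_optimality_card)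
  have ineq: "\<bar>?X \<rho>\<bar> \<le> lens_Phi ?n (sqrt (?U \<rho> * ?V \<rho>))" if \<rho>: "admissible \<rho>" for \<rho>
  proof -
    have "?U (\<lambda>x. \<rho> (- x)) = ?U \<rho>" "?V (\<lambda>x. \<rho> (- x)) = ?V \<rho>"
      using integral_lbn_reflect(1)[OF admissible_measurable(1)[OF \<rho>, of "?n - 1"]]
        integral_lbn_reflect(1)[OF admissible_measurable(1)[OF \<rho>, of "?n + 1"]] by simp_all
    moreover have "?X (\<lambda>x. \<rho> (- x)) = - ?X \<rho>"
      using integral_lbn_reflect(1)[OF admissible_measurable(2)[OF \<rho>, of i "?n + 1"]]
      by (simp add: minus_equation_iff eq_commute)
    ultimately show ?thesis
      using admissible_le_lens_Phi[OF \<rho>, of i] admissible_le_lens_Phi[OF admissible_reflect[OF \<rho>], of i]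
      by (simp add: abs_le_iff)
  qed
  have sharp: "(SUP \<rho> \<in> {\<rho>. admissible \<rho> \<and> ?U \<rho> = u \<and> ?V \<rho> = v}. ereal \<bar>?X \<rho>\<bar>) = ereal (lens_Phi ?n (sqrt (u * v)))"
    if uv: "u > 0" "v > 0" for u v
  proof (rule antisym)
    show "(SUP \<rho> \<in> {\<rho>. admissible \<rho> \<and> ?U \<rho> = u \<and> ?V \<rho> = v}. ereal \<bar>?X \<rho>\<bar>) \<le> ereal (lens_Phi ?n (sqrt (u * v)))"
      using ineq by (intro SUP_least) auto
    define p where "p = lens_P ?n (sqrt (u * v))"
    have s: "sqrt (u * v) > 0" using uv by simp
    have p: "0 < p" "p < 1" "lens_U ?n p = sqrt (u * v)"
      using lens_P[of "sqrt (u * v)"] lens_P_less_1[OF s] s by (auto simp: p_def)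
    define a where "a = p / 2 * sqrt (v / u)"
    define b where "b = p / 2 * sqrt (u / v)"
    note m = lens_multipliers[OF p(1) uv, folded a_def b_def]
    have p1: "2 * sqrt (a * b) < 1" using m(3) p by simp
    let ?L = "indicator (lens i a b) :: real ^ 'n \<Rightarrow> real"
    \<comment> \<open>The lens that is optimal for these multipliers has precisely the prescribed
      integrals u and v, so the supremum is attained.\<close>
    have vals: "p / (2 * a) * lens_U ?n p = u" "p / (2 * b) * lens_U ?n p = v"
      using m(1,2,4,5) p by (simp_all add: field_simps)
    have "admissible ?L" "?U ?L = u" "?V ?L = v"
      using admissible_lens[OF m(1,2) p1, of i] lens_has_integrals[OF m(1,2) p1, of i]
      unfolding m(3) vals by (simp_all add: has_bochner_integral_iff)
    moreover have "?X ?L = lens_Phi ?n (sqrt (u * v))"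
      using lens_has_integrals(3)[OF m(1,2) p1, of i] unfolding m(3)
      by (simp add: has_bochner_integral_iff lens_Phi_def p_def)
    ultimately show "ereal (lens_Phi ?n (sqrt (u * v))) \<le> (SUP \<rho> \<in> {\<rho>. admissible \<rho> \<and> ?U \<rho> = u \<and> ?V \<rho> = v}. ereal \<bar>?X \<rho>\<bar>)"
      by (intro SUP_upper2[of ?L]) auto
  qed
  show ?thesis
  proof (intro exI[of _ "lens_Phi ?n"] conjI allI impI)
    fix \<Psi> and s :: real assume "solves_initial_problem ?n \<Psi> \<and> asymptotic_condition ?n \<Psi>" "0 \<le> s"
    then show "\<Psi> s = lens_Phi ?n s" using lens_Phi_unique by blast
  qed (fact lens_Phi_solves lens_Phi_asymptotic | erule ineq | erule (1) sharp)+
qed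

end
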